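(* Let $K$ be a finite extension of $\mathbb{Q}_p$ with $p$ odd, let $f\in K[x]$ be squarefree with set of roots $\mathcal{R}\subset\overline{K}$, and let $I$ be the inertia subgroup of $\operatorname{Gal}(K(\mathcal{R})/K)$. Assume $I$ is tame (i.e. $p\nmid |I|$). Then: (i) $\operatorname{lcm}_{\mathfrak{s}} \operatorname{denom} d_{\mathfrak{s}} = |I|$, where the $\operatorname{lcm}$ runs over all proper clusters $\mathfrak{s}$. (ii) Fix a cluster $\mathfrak{s}$. Then the orbits under $I_{\mathfrak{s}}$ of the children of $\mathfrak{s}$ which are not orphans of $\mathfrak{s}$ all have equal length. (iii) Let $\mathfrak{s}'$ be a child of the proper cluster $\mathfrak{s}$ which is not an orphan of $\mathfrak{s}$. Then the length of the orbit of $\mathfrak{s}'$ under $I_{\mathfrak{s}}$ is $\operatorname{denom}(d_{\mathfrak{s}}[I:I_{\mathfrak{s}}])$. (iv) Let $\mathfrak{s}$ be a cluster. Then $[I:I_{\mathfrak{s}}]=\operatorname{lcm}_{\mathfrak{s}\subsetneq\mathfrak{s}'}\operatorname{denom} d^*_{\mathfrak{s}'}$, the $\operatorname{lcm}$ running over all clusters $\mathfrak{s}'$ properly containing $\mathfrak{s}$, where $d^*_{\mathfrak{s}'}=1$ if the child of $\mathfrak{s}'$ containing $\mathfrak{s}$ is an orphan of $\mathfrak{s}'$, and $d^*_{\mathfrak{s}'}=d_{\mathfrak{s}'}$ otherwise.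
   Context: $v$ is the valuation on $\overline{K}$ normalised so that $v(K^\times)=\mathbb{Z}$. For $\alpha=a/b\in\mathbb{Q}$ with $\gcd(a,b)=1$, $b>0$, $\operatorname{denom}\alpha=b$. A cluster is a nonempty subset $\mathfrak{s}\subseteq\mathcal{R}$ of the form $D\cap\mathcal{R}$ for a disc $D=\{x\in\overline{K}: v(x-z)\ge d\}$ with $z\in\overline{K}$, $d\in\mathbb{Q}$. A cluster is proper if $|\mathfrak{s}|>1$, and then its depth is $d_{\mathfrak{s}}=\min_{r,r'\in\mathfrak{s}}v(r-r')$. A child of $\mathfrak{s}$ is a maximal cluster properly contained in $\mathfrak{s}$. $I_{\mathfrak{s}}$ denotes the stabiliser of $\mathfrak{s}$ in $I$ (which acts on $\mathcal{R}$ and hence on clusters). If among the children of $\mathfrak{s}$ there is exactly one fixed by $I_{\mathfrak{s}}$, it is called an orphan of $\mathfrak{s}$. An empty $\operatorname{lcm}$ is $1$. *)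

theory Defs
  imports
    "HOL-Algebra.Algebraic_Closure_Type"
    "HOL-Algebra.Generated_Fields"
    "HOL-Algebra.Group_Action"
    "HOL-Algebra.Bij"
    "HOL-Computational_Algebra.Squarefree"
begin

definition denom :: "rat \<Rightarrow> nat" where
  "denom a = nat (snd (quotient_of a))"

section \<open>Valuations and finite extensions of the p-adic numbers\<close>

text \<open>
  Valuations are written additively with values in the rationals. The value at \<open>0\<close> is
  mathematically \<open>\<infinity>\<close>; here \<open>v 0\<close> is an arbitrary number that is never used, and
  \<open>val_ge v x d\<close> and \<open>val_gt v x d\<close> express \<open>v x \<ge> d\<close> and \<open>v x > d\<close> under the convention \<open>v 0 = \<infinity>\<close>.
\<close>

definition valuation :: "('a::field \<Rightarrow> rat) \<Rightarrow> bool" where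
  "valuation v \<longleftrightarrow>
     (\<forall>x y. x \<noteq> 0 \<longrightarrow> y \<noteq> 0 \<longrightarrow> v (x * y) = v x + v y) \<and>
     (\<forall>x y. x \<noteq> 0 \<longrightarrow> y \<noteq> 0 \<longrightarrow> x + y \<noteq> 0 \<longrightarrow> v (x + y) \<ge> min (v x) (v y))"

definition val_ge :: "('a::field \<Rightarrow> rat) \<Rightarrow> 'a \<Rightarrow> rat \<Rightarrow> bool" where
  "val_ge v x d \<longleftrightarrow> x = 0 \<or> v x \<ge> d"

definition val_gt :: "('a::field \<Rightarrow> rat) \<Rightarrow> 'a \<Rightarrow> rat \<Rightarrow> bool" where
  "val_gt v x d \<longleftrightarrow> x = 0 \<or> v x > d"

definition padic_val_rat :: "nat \<Rightarrow> rat \<Rightarrow> int" where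
  "padic_val_rat p q =
     int (multiplicity (int p) (fst (quotient_of q))) - int (multiplicity (int p) (snd (quotient_of q)))"

text \<open>
  The field \<open>'q\<close> with the valuation \<open>w\<close> is \<open>\<rat>\<^sub>p\<close> with its \<open>p\<close>-adic valuation, i.e. the completion of
  the rationals with respect to the \<open>p\<close>-adic valuation: \<open>w\<close> extends the latter, the rationals are
  dense, and every Cauchy sequence converges. This determines \<open>('q, w)\<close> up to unique isomorphism.
\<close>

definition is_Qp :: "nat \<Rightarrow> ('q::field_char_0 \<Rightarrow> rat) \<Rightarrow> bool" where
  "is_Qp p w \<longleftrightarrow>
     valuation w \<and>
     (\<forall>q. q \<noteq> 0 \<longrightarrow> w (of_rat q) = of_int (padic_val_rat p q)) \<and>
     (\<forall>x N. \<exists>q. val_ge w (x - of_rat q) N) \<and>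
     (\<forall>Y :: nat \<Rightarrow> 'q.
        (\<forall>N. \<exists>n0. \<forall>m\<ge>n0. \<forall>n\<ge>n0. val_ge w (Y m - Y n) N) \<longrightarrow>
        (\<exists>x. \<forall>N. \<exists>n0. \<forall>n\<ge>n0. val_ge w (Y n - x) N))"

definition finite_field_extension :: "('q::field \<Rightarrow> 'k::field) \<Rightarrow> bool" where
  "finite_field_extension \<iota> \<longleftrightarrow>
     \<iota> \<in> ring_hom ring_of_type_algebra ring_of_type_algebra \<and>
     (\<exists>B. finite B \<and> (\<forall>x. \<exists>c. x = (\<Sum>b\<in>B. \<iota> (c b) * b)))"

text \<open>
  The valuation on the algebraic closure of \<open>'k\<close> that extends, up to scaling, the valuation \<open>w\<close>
  of the base field, normalised to have value group \<open>\<int>\<close> on \<open>'k\<close>.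
\<close>

definition normalised_valuation ::
    "('q::field \<Rightarrow> rat) \<Rightarrow> ('q \<Rightarrow> 'k::field) \<Rightarrow> ('k alg_closure \<Rightarrow> rat) \<Rightarrow> bool" where
  "normalised_valuation w \<iota> v \<longleftrightarrow>
     valuation v \<and>
     (\<exists>c>0. \<forall>x. x \<noteq> 0 \<longrightarrow> v (to_ac (\<iota> x)) = c * w x) \<and>
     (\<lambda>x. v (to_ac x)) ` (UNIV - {0}) = \<int>"

section \<open>Galois and inertia groups\<close>

definition ac_roots :: "'k::field poly \<Rightarrow> 'k alg_closure set" where
  "ac_roots f = {x. poly (map_poly to_ac f) x = 0}"

definition root_field :: "'k::field poly \<Rightarrow> 'k alg_closure set" where
  "root_field f = generate_field ring_of_type_algebra (range to_ac \<union> ac_roots f)"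

definition galois_group :: "'a::field set \<Rightarrow> 'a set \<Rightarrow> ('a \<Rightarrow> 'a) monoid" where
  "galois_group K L = BijGroup L \<lparr>carrier :=
     {\<sigma> \<in> Bij L. (\<forall>x\<in>L. \<forall>y\<in>L. \<sigma> (x + y) = \<sigma> x + \<sigma> y \<and> \<sigma> (x * y) = \<sigma> x * \<sigma> y) \<and>
                (\<forall>x\<in>K. \<sigma> x = x)}\<rparr>"

definition inertia_group :: "('a::field \<Rightarrow> rat) \<Rightarrow> 'a set \<Rightarrow> 'a set \<Rightarrow> ('a \<Rightarrow> 'a) monoid" where
  "inertia_group v K L = galois_group K L \<lparr>carrier :=
     {\<sigma> \<in> carrier (galois_group K L). \<forall>x\<in>L. val_ge v x 0 \<longrightarrow> val_gt v (\<sigma> x - x) 0}\<rparr>"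

section \<open>Clusters\<close>

definition disc :: "('a::field \<Rightarrow> rat) \<Rightarrow> 'a \<Rightarrow> rat \<Rightarrow> 'a set" where
  "disc v z d = {x. val_ge v (x - z) d}"

definition cluster :: "('a::field \<Rightarrow> rat) \<Rightarrow> 'a set \<Rightarrow> 'a set \<Rightarrow> bool" where
  "cluster v R s \<longleftrightarrow> s \<noteq> {} \<and> (\<exists>z d. s = disc v z d \<inter> R)"

definition proper_cluster :: "('a::field \<Rightarrow> rat) \<Rightarrow> 'a set \<Rightarrow> 'a set \<Rightarrow> bool" where
  "proper_cluster v R s \<longleftrightarrow> cluster v R s \<and> card s > 1"

text \<open>Pairs with \<open>r = r'\<close> have \<open>v (r - r') = \<infinity>\<close> and do not affect the minimum for proper clusters.\<close>

definition depth :: "('a::field \<Rightarrow> rat) \<Rightarrow> 'a set \<Rightarrow> rat" where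
  "depth v s = Min {v (r - r') | r r'. r \<in> s \<and> r' \<in> s \<and> r \<noteq> r'}"

definition child :: "('a::field \<Rightarrow> rat) \<Rightarrow> 'a set \<Rightarrow> 'a set \<Rightarrow> 'a set \<Rightarrow> bool" where
  "child v R s c \<longleftrightarrow> cluster v R c \<and> c \<subset> s \<and> \<not> (\<exists>t. cluster v R t \<and> c \<subset> t \<and> t \<subset> s)"

definition cluster_stab :: "('a \<Rightarrow> 'a) monoid \<Rightarrow> 'a set \<Rightarrow> ('a \<Rightarrow> 'a) monoid" where
  "cluster_stab G s = G \<lparr>carrier := stabilizer G image s\<rparr>"

definition stab_index :: "('a \<Rightarrow> 'a) monoid \<Rightarrow> 'a set \<Rightarrow> nat" where
  "stab_index G s = card (rcosets\<^bsub>G\<^esub> (carrier (cluster_stab G s)))"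

definition orphan ::
    "('a::field \<Rightarrow> rat) \<Rightarrow> 'a set \<Rightarrow> ('a \<Rightarrow> 'a) monoid \<Rightarrow> 'a set \<Rightarrow> 'a set \<Rightarrow> bool" where
  "orphan v R G s c \<longleftrightarrow>
     {c'. child v R s c' \<and> (\<forall>\<sigma>\<in>carrier (cluster_stab G s). \<sigma> ` c' = c')} = {c}"

text \<open>
  \<open>depth_star v R G s s'\<close> is \<open>d\<^sup>*\<close> of \<open>s'\<close> relative to \<open>s \<subset> s'\<close>; exactly one child of \<open>s'\<close> contains \<open>s\<close>.
\<close>

definition depth_star ::
    "('a::field \<Rightarrow> rat) \<Rightarrow> 'a set \<Rightarrow> ('a \<Rightarrow> 'a) monoid \<Rightarrow> 'a set \<Rightarrow> 'a set \<Rightarrow> rat" where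
  "depth_star v R G s s' =
     (if \<exists>c. child v R s' c \<and> s \<subseteq> c \<and> orphan v R G s' c then 1 else depth v s')"

end

theory Submission
  imports Defs
begin

text \<open>
  Let \<open>L = K(\<R>)\<close>. For \<open>\<sigma> \<in> I\<close> and \<open>x \<in> L\<^sup>\<times>\<close> the residue class of \<open>\<sigma> x / x\<close> depends only on
  \<open>\<sigma>\<close> and \<open>v x\<close>, so that each value \<open>d\<close> of \<open>L\<close> gives a character \<open>\<theta>(d)\<close> of \<open>I\<close>, and these
  characters add up with \<open>d\<close>. Since \<open>|I|\<close> is a unit, averaging shows that a subgroup \<open>H\<close> of \<open>I\<close>
  has a fixed element of value \<open>d\<close> as soon as \<open>\<theta>(d)\<close> is trivial on \<open>H\<close>, and that \<open>\<sigma> x - x\<close> never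
  has a value on which \<open>\<sigma>\<close> acts trivially. As the field fixed by \<open>I\<close> is unramified over \<open>K\<close>,
  taking norms and counting roots of unity in the residue field gives that \<open>\<theta>(d)\<close> takes exactly
  \<open>denom ([I : H] d)\<close> values on \<open>H\<close>.

  The stabiliser \<open>H\<close> of a cluster \<open>s\<close> of depth \<open>d\<close> fixes a centre \<open>z\<close> of \<open>s\<close>, the average of an
  orbit. The child containing the roots close to \<open>z\<close>, if any, is fixed, and an element of \<open>H\<close>
  fixes any other child iff \<open>\<theta>(d)\<close> is trivial on it. This gives the orbit lengths, and the formula
  for the index of the stabiliser follows by induction along the chain of clusters containing \<open>s\<close>.
\<close>

subsection \<open>Denominators and subgroups of the rationals\<close>

lemma denom_pos: "denom q > 0"
  unfolding denom_def using quotient_of_denom_pos' by simp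

lemma denom_1 [simp]: "denom 1 = 1"
  unfolding denom_def by simp

lemma denom_dvd_iff: "denom q dvd n \<longleftrightarrow> of_nat n * q \<in> \<int>"
proof -
  obtain a b where ab: "quotient_of q = (a, b)" by fastforce
  have b: "b > 0" "coprime a b" using ab quotient_of_denom_pos quotient_of_coprime by blast+
  have q: "q = of_int a / of_int b" using quotient_of_div[OF ab] .
  have "denom q dvd n \<longleftrightarrow> b dvd int n"
    unfolding denom_def using ab b(1) by (simp add: nat_dvd_iff)
  also have "\<dots> \<longleftrightarrow> b dvd int n * a"
    using b(2) by (simp add: coprime_commute coprime_dvd_mult_left_iff)
  also have "\<dots> \<longleftrightarrow> of_nat n * q \<in> \<int>"
  proof
    assume "b dvd int n * a"
    then obtain k where k: "int n * a = b * k" by blast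
    have "of_nat n * q = of_int (int n * a) / of_int b" by (simp add: q)
    also have "\<dots> = of_int k" using b(1) by (simp add: k)
    finally show "of_nat n * q \<in> \<int>" by simp
  next
    assume "of_nat n * q \<in> \<int>"
    then obtain k where "of_nat n * q = of_int k" by (auto elim: Ints_cases)
    then have "(of_int (int n * a) :: rat) = of_int (b * k)" using b(1) by (simp add: q field_simps)
    then have "int n * a = b * k" by (simp only: of_int_eq_iff)
    then show "b dvd int n * a" by simp
  qed
  finally show ?thesis .
qed

lemma denom_mult_in_Ints: "of_nat (denom q) * q \<in> \<int>"
  using denom_dvd_iff[of q "denom q"] by simp

lemma denom_inverse_of_nat:
  assumes "m > 0" shows "denom (1 / of_nat m) = m"
proof (rule dvd_antisym)
  show "denom (1 / of_nat m) dvd m" unfolding denom_dvd_iff using assms by simp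
  obtain k where "of_nat (denom (1 / of_nat m)) * (1 / of_nat m :: rat) = of_int k"
    using denom_mult_in_Ints by (blast elim: Ints_cases)
  then have "(of_int (int (denom (1 / of_nat m))) :: rat) = of_int (k * int m)"
    using assms by (simp add: field_simps)
  then have "int (denom (1 / of_nat m)) = k * int m" by (simp only: of_int_eq_iff)
  then show "m dvd denom (1 / of_nat m)" by (metis dvd_triv_right int_dvd_int_iff)
qed

lemma mult_denom_eq_lcm:
  assumes "n > 0"
  shows "n * denom (of_nat n * q) = lcm (denom q) n"
proof (rule dvd_antisym)
  have "of_nat (n * denom (of_nat n * q)) * q \<in> \<int>"
    using denom_mult_in_Ints[of "of_nat n * q"] by (simp add: ac_simps)
  then have "denom q dvd n * denom (of_nat n * q)" unfolding denom_dvd_iff .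
  then show "lcm (denom q) n dvd n * denom (of_nat n * q)" by simp
  obtain k where k: "lcm (denom q) n = n * k" using dvd_lcm2 by blast
  have "denom q dvd n * k" unfolding k[symmetric] by simp
  then have "of_nat k * (of_nat n * q) \<in> \<int>" unfolding denom_dvd_iff by (simp add: ac_simps)
  then have "denom (of_nat n * q) dvd k" unfolding denom_dvd_iff .
  then show "n * denom (of_nat n * q) dvd lcm (denom q) n" unfolding k by simp
qed

lemma int_mult_closed:
  fixes A :: "'a::ring_1 set"
  assumes diff: "\<And>a b. a \<in> A \<Longrightarrow> b \<in> A \<Longrightarrow> a - b \<in> A" and "a \<in> A"
  shows "of_int k * a \<in> A"
proof -
  have zero: "0 \<in> A" using diff[OF assms(2,2)] by simp
  show ?thesis
  proof (induction k rule: int_induct[where k = 0])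
    case (step1 k)
    have "- a \<in> A" using diff[OF zero assms(2)] by simp
    from diff[OF step1.IH this] show ?case by (simp add: algebra_simps)
  next
    case (step2 k)
    from diff[OF step2.IH assms(2)] show ?case by (simp add: algebra_simps)
  qed (simp add: zero)
qed

lemma int_subgroup_eq_multiples:
  fixes A :: "int set"
  assumes diff: "\<And>a b. a \<in> A \<Longrightarrow> b \<in> A \<Longrightarrow> a - b \<in> A" and "A \<noteq> {}"
  obtains g :: nat where "A = range (\<lambda>k. k * int g)"
proof -
  have int_mult: "k * a \<in> A" if "a \<in> A" for k a using int_mult_closed[OF diff that] by simp
  have add: "a + b \<in> A" if "a \<in> A" "b \<in> A" for a b
    using diff[OF that(1) int_mult[OF that(2), of "-1"]] by simp
  define N where "N = {k :: nat. int k \<in> A}"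
  have "gcd k l \<in> N" if "k \<in> N" "l \<in> N" for k l
  proof -
    obtain x y where "x * int k + y * int l = int (gcd k l)"
      using bezout_int[of "int k" "int l"] by (auto simp: gcd_int_int_eq)
    moreover have "x * int k + y * int l \<in> A"
      using that unfolding N_def by (intro add int_mult) auto
    ultimately show ?thesis unfolding N_def by simp
  qed
  moreover have nat_abs: "nat \<bar>a\<bar> \<in> N" if "a \<in> A" for a
    unfolding N_def using int_mult[OF that, of "sgn a"] by (simp add: sgn_if split: if_splits)
  ultimately have "Gcd N \<in> N" using \<open>A \<noteq> {}\<close> by (intro Gcd_in) auto
  then have "range (\<lambda>k. k * int (Gcd N)) \<subseteq> A" using int_mult unfolding N_def by auto
  moreover have "a \<in> range (\<lambda>k. k * int (Gcd N))" if "a \<in> A" for a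
  proof -
    have "int (Gcd N) dvd a" using Gcd_dvd[OF nat_abs[OF that]] by (simp add: nat_abs_dvd_iff)
    then show ?thesis by (auto simp: mult.commute elim!: dvdE)
  qed
  ultimately show ?thesis using that by blast
qed

lemma rat_subgroup_eq_multiples:
  fixes A :: "rat set"
  assumes diff: "\<And>a b. a \<in> A \<Longrightarrow> b \<in> A \<Longrightarrow> a - b \<in> A" and one: "1 \<in> A"
    and "n > 0" and bounded_denominators: "\<And>a. a \<in> A \<Longrightarrow> of_nat n * a \<in> \<int>"
  obtains m :: nat where "m > 0" "A = range (\<lambda>k. of_int k / of_nat m)"
proof -
  define Z where "Z = {k. of_int k / of_nat n \<in> A}"
  have n_in: "int n \<in> Z" unfolding Z_def using one \<open>n > 0\<close> by simp
  have "k - l \<in> Z" if "k \<in> Z" "l \<in> Z" for k l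
    using diff that unfolding Z_def by (fastforce simp: diff_divide_distrib)
  then obtain g where g: "Z = range (\<lambda>k. k * int g)"
    using n_in by (elim int_subgroup_eq_multiples) blast+
  then obtain l where "int n = l * int g" using n_in by blast
  then obtain m where m: "n = m * g" by (metis dvd_def int_dvd_int_iff dvd_triv_right mult.commute)
  with \<open>n > 0\<close> have pos: "m > 0" "g > 0" by auto
  have quotient: "of_int (k * int g) / of_nat n = (of_int k / of_nat m :: rat)" for k
    unfolding m using pos by (simp add: field_simps)
  have "A = (\<lambda>k. of_int k / of_nat n) ` Z"
  proof (intro equalityI subsetI)
    fix a assume a: "a \<in> A"
    obtain k where "of_nat n * a = of_int k"
      using bounded_denominators[OF a] by (auto elim: Ints_cases)
    then have "a = of_int k / of_nat n" using \<open>n > 0\<close> by (simp add: field_simps)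
    then show "a \<in> (\<lambda>k. of_int k / of_nat n) ` Z" using a unfolding Z_def by blast
  qed (auto simp: Z_def)
  also have "\<dots> = range (\<lambda>k. of_int k / of_nat m)" unfolding g image_image quotient ..
  finally show ?thesis using that pos(1) by blast
qed

subsection \<open>Subfields\<close>

lemma ring_of_type_algebra_inverse:
  fixes x :: "'a::field" assumes "x \<noteq> 0"
  shows "inv\<^bsub>ring_of_type_algebra\<^esub> x = inverse x"
proof -
  interpret field "ring_of_type_algebra :: 'a ring" by (rule field_from_type_algebra)
  show ?thesis
    using assms by (intro comm_inv_char) (auto simp: ring_of_type_algebra_def)
qed

lemma ring_of_type_algebra_uminus:
  fixes x :: "'a::field"
  shows "\<ominus>\<^bsub>ring_of_type_algebra\<^esub> x = - x"
proof -
  interpret field "ring_of_type_algebra :: 'a ring" by (rule field_from_type_algebra)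
  show ?thesis by (rule minus_equality) (auto simp: ring_of_type_algebra_def)
qed

locale type_subfield =
  fixes L :: "'a::field set"
  assumes subfield: "subfield L ring_of_type_algebra"
begin

lemma one_in: "1 \<in> L" and zero_in: "0 \<in> L"
  and add_in: "x \<in> L \<Longrightarrow> y \<in> L \<Longrightarrow> x + y \<in> L"
  and mult_in: "x \<in> L \<Longrightarrow> y \<in> L \<Longrightarrow> x * y \<in> L"
  and uminus_in: "x \<in> L \<Longrightarrow> - x \<in> L"
  using subringE(2,3,5-7)[OF subfieldE(1)[OF subfield]]
  by (simp_all add: ring_of_type_algebra_uminus) (simp_all add: ring_of_type_algebra_def)

lemma inverse_in: "x \<in> L \<Longrightarrow> inverse x \<in> L"
proof (cases "x = 0")
  case False
  interpret field "ring_of_type_algebra :: 'a ring" by (rule field_from_type_algebra)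
  assume "x \<in> L"
  with False have "x \<in> L - {\<zero>\<^bsub>ring_of_type_algebra\<^esub>}" by (simp add: ring_of_type_algebra_def)
  then show ?thesis
    using subfield_m_inv(1)[OF subfield, of x] False by (simp add: ring_of_type_algebra_inverse)
qed simp

lemma diff_in: "x \<in> L \<Longrightarrow> y \<in> L \<Longrightarrow> x - y \<in> L"
  using add_in[of x "- y"] uminus_in by simp

lemma divide_in: "x \<in> L \<Longrightarrow> y \<in> L \<Longrightarrow> x / y \<in> L"
  using mult_in[of x "inverse y"] inverse_in by (simp add: divide_inverse)

lemma power_in: "x \<in> L \<Longrightarrow> x ^ n \<in> L"
  by (induction n) (auto intro: mult_in one_in)

lemma of_nat_in: "of_nat n \<in> L"
  by (induction n) (auto intro: add_in one_in zero_in)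

lemma sum_in: "(\<And>i. i \<in> A \<Longrightarrow> f i \<in> L) \<Longrightarrow> sum f A \<in> L"
  by (induction A rule: infinite_finite_induct) (auto intro: add_in zero_in)

lemma prod_in: "(\<And>i. i \<in> A \<Longrightarrow> f i \<in> L) \<Longrightarrow> prod f A \<in> L"
  by (induction A rule: infinite_finite_induct) (auto intro: mult_in one_in)

lemmas closed = zero_in one_in add_in mult_in uminus_in inverse_in diff_in divide_in power_in
  of_nat_in sum_in prod_in

end

lemma type_subfieldI:
  assumes one: "1 \<in> L" and diff: "\<And>x y. x \<in> L \<Longrightarrow> y \<in> L \<Longrightarrow> x - y \<in> L"
    and mult: "\<And>x y. x \<in> L \<Longrightarrow> y \<in> L \<Longrightarrow> x * y \<in> L"
    and inverse: "\<And>x. x \<in> L \<Longrightarrow> x \<noteq> 0 \<Longrightarrow> inverse x \<in> L"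
  shows "type_subfield (L :: 'a::field set)"
proof (rule type_subfield.intro)
  interpret field "ring_of_type_algebra :: 'a ring" by (rule field_from_type_algebra)
  have uminus: "- x \<in> L" if "x \<in> L" for x using diff[OF diff[OF one one] that] by simp
  have add: "x + y \<in> L" if "x \<in> L" "y \<in> L" for x y using diff[OF that(1) uminus[OF that(2)]] by simp
  have subring: "subring L ring_of_type_algebra"
    using one mult add uminus
    by (intro subringI)
      (auto simp: ring_of_type_algebra_uminus, auto simp: ring_of_type_algebra_def)
  show "subfield L ring_of_type_algebra"
  proof (rule subfieldI'[OF subring])
    fix x assume "x \<in> L - {\<zero>\<^bsub>ring_of_type_algebra\<^esub>}"
    then have "x \<in> L" "x \<noteq> 0" by (auto simp: ring_of_type_algebra_def)
    then show "inv\<^bsub>ring_of_type_algebra\<^esub> x \<in> L"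
      using inverse by (simp add: ring_of_type_algebra_inverse)
  qed
qed

lemma type_subfield_generate_field:
  "type_subfield (generate_field (ring_of_type_algebra :: 'a::field ring) S)"
  by (intro type_subfield.intro field.generate_field_is_subfield[OF field_from_type_algebra])
    (simp add: ring_of_type_algebra_def)

lemma generate_field_least:
  assumes "type_subfield E" "S \<subseteq> E"
  shows "generate_field (ring_of_type_algebra :: 'a::field ring) S \<subseteq> E"
  using assms type_subfield.subfield
  by (intro field.generate_field_min_subfield1[OF field_from_type_algebra])
    (auto simp: ring_of_type_algebra_def)

subsection \<open>Polynomials over a subfield\<close>

definition polys_over :: "'a::zero set \<Rightarrow> 'a poly set" where
  "polys_over K = {p. \<forall>i. coeff p i \<in> K}"

lemma polys_over_mono: "K \<subseteq> E \<Longrightarrow> polys_over K \<subseteq> polys_over E"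
  unfolding polys_over_def by blast

lemma pCons_in_polys_over_iff: "pCons a p \<in> polys_over K \<longleftrightarrow> a \<in> K \<and> p \<in> polys_over K"
  unfolding polys_over_def by (auto simp: coeff_pCons split: nat.split)

lemma coeff_in_polys_over: "p \<in> polys_over K \<Longrightarrow> coeff p i \<in> K"
  unfolding polys_over_def by blast

lemma lead_coeff_synthetic_div:
  "degree p > 0 \<Longrightarrow> lead_coeff (synthetic_div p c) = lead_coeff p"
proof (induction p)
  case (pCons a p)
  show ?case
  proof (cases "degree p = 0")
    case True
    then show ?thesis using pCons.prems by (elim degree_eq_zeroE) (simp split: if_splits)
  next
    case False
    then have "synthetic_div p c \<noteq> 0" "p \<noteq> 0" by (auto simp: synthetic_div_eq_0_iff)
    then show ?thesis using pCons.IH False by simp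
  qed
qed simp

context type_subfield
begin

lemma polys_over_0: "0 \<in> polys_over L"
  unfolding polys_over_def by (simp add: zero_in)

lemma polys_over_diff: "p \<in> polys_over L \<Longrightarrow> q \<in> polys_over L \<Longrightarrow> p - q \<in> polys_over L"
  unfolding polys_over_def by (simp add: diff_in)

lemma polys_over_add: "p \<in> polys_over L \<Longrightarrow> q \<in> polys_over L \<Longrightarrow> p + q \<in> polys_over L"
  unfolding polys_over_def by (simp add: add_in)

lemma polys_over_mult: "p \<in> polys_over L \<Longrightarrow> q \<in> polys_over L \<Longrightarrow> p * q \<in> polys_over L"
  unfolding polys_over_def by (simp add: coeff_mult sum_in mult_in)

lemma polys_over_smult: "a \<in> L \<Longrightarrow> p \<in> polys_over L \<Longrightarrow> smult a p \<in> polys_over L"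
  unfolding polys_over_def by (simp add: mult_in)

lemma polys_over_const: "a \<in> L \<Longrightarrow> [:a:] \<in> polys_over L"
  by (simp add: pCons_in_polys_over_iff polys_over_0)

lemma polys_over_X: "[:0, 1:] \<in> polys_over L"
  by (simp add: pCons_in_polys_over_iff polys_over_0 zero_in one_in)

lemma polys_over_pderiv: "p \<in> polys_over L \<Longrightarrow> pderiv p \<in> polys_over L"
  unfolding polys_over_def using of_nat_in[of "Suc n" for n] by (simp add: coeff_pderiv mult_in)

lemma polys_over_pcompose: "p \<in> polys_over L \<Longrightarrow> q \<in> polys_over L \<Longrightarrow> pcompose p q \<in> polys_over L"
proof (induction p)
  case (pCons a p)
  then show ?case unfolding pcompose_pCons
    by (intro polys_over_add polys_over_mult polys_over_const) (auto simp: pCons_in_polys_over_iff)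
qed (simp add: polys_over_0)

lemma polys_over_mod: "p \<in> polys_over L \<Longrightarrow> q \<in> polys_over L \<Longrightarrow> p mod q \<in> polys_over L"
proof (induction p)
  case (pCons a p)
  then have "pCons a (p mod q) \<in> polys_over L" by (simp add: pCons_in_polys_over_iff)
  with pCons.prems(2) show ?case
    using pCons.prems(1) unfolding mod_pCons_eq
    by (auto intro!: polys_over_diff polys_over_smult divide_in coeff_in_polys_over)
qed (simp add: polys_over_0)

lemma polys_over_div: "p \<in> polys_over L \<Longrightarrow> q \<in> polys_over L \<Longrightarrow> p div q \<in> polys_over L"
proof (induction p)
  case (pCons a p)
  have "pCons a (p mod q) \<in> polys_over L" "p div q \<in> polys_over L"
    using pCons by (simp_all add: pCons_in_polys_over_iff polys_over_mod)
  with pCons.prems(2) show ?case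
    using polys_over_0 unfolding div_pCons_eq
    by (auto simp: pCons_in_polys_over_iff[of _ "p div q"] intro!: divide_in coeff_in_polys_over)
qed (simp add: polys_over_0)

lemma poly_in: "p \<in> polys_over L \<Longrightarrow> x \<in> L \<Longrightarrow> poly p x \<in> L"
  unfolding poly_altdef using coeff_in_polys_over by (intro closed) blast

end

subsection \<open>Field embeddings\<close>

locale field_embedding = type_subfield L for L :: "'a::field set" +
  fixes \<sigma> :: "'a \<Rightarrow> 'b::field"
  assumes add: "x \<in> L \<Longrightarrow> y \<in> L \<Longrightarrow> \<sigma> (x + y) = \<sigma> x + \<sigma> y"
    and mult: "x \<in> L \<Longrightarrow> y \<in> L \<Longrightarrow> \<sigma> (x * y) = \<sigma> x * \<sigma> y"
    and one: "\<sigma> 1 = 1"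
begin

lemma zero: "\<sigma> 0 = 0"
  by (metis add add_0 add_cancel_right_right zero_in)

lemma uminus: "x \<in> L \<Longrightarrow> \<sigma> (- x) = - \<sigma> x"
  using add[of x "- x"] zero uminus_in by (simp add: eq_neg_iff_add_eq_0 add.commute)

lemma diff: "x \<in> L \<Longrightarrow> y \<in> L \<Longrightarrow> \<sigma> (x - y) = \<sigma> x - \<sigma> y"
  using add[of x "- y"] uminus uminus_in by simp

lemma nonzero: "x \<in> L \<Longrightarrow> x \<noteq> 0 \<Longrightarrow> \<sigma> x \<noteq> 0"
  using mult[of x "inverse x"] one inverse_in by auto

lemma inverse: "x \<in> L \<Longrightarrow> \<sigma> (inverse x) = inverse (\<sigma> x)"
  using mult[of x "inverse x"] one inverse_in zero
  by (cases "x = 0") (auto intro: inverse_unique[symmetric])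

lemma divide: "x \<in> L \<Longrightarrow> y \<in> L \<Longrightarrow> \<sigma> (x / y) = \<sigma> x / \<sigma> y"
  using mult[of x "inverse y"] inverse inverse_in by (simp add: divide_inverse)

lemma power: "x \<in> L \<Longrightarrow> \<sigma> (x ^ n) = \<sigma> x ^ n"
  by (induction n) (auto simp: one mult power_in)

lemma of_nat: "\<sigma> (of_nat n) = of_nat n"
  by (induction n) (auto simp: zero one add closed)

lemma sum: "(\<And>i. i \<in> A \<Longrightarrow> f i \<in> L) \<Longrightarrow> \<sigma> (sum f A) = (\<Sum>i\<in>A. \<sigma> (f i))"
  by (induction A rule: infinite_finite_induct) (auto simp: zero add sum_in)

lemma prod: "(\<And>i. i \<in> A \<Longrightarrow> f i \<in> L) \<Longrightarrow> \<sigma> (prod f A) = (\<Prod>i\<in>A. \<sigma> (f i))"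
  by (induction A rule: infinite_finite_induct) (auto simp: one mult prod_in)

lemma inj_on: "inj_on \<sigma> L"
proof (rule inj_onI)
  fix x y assume "x \<in> L" "y \<in> L" "\<sigma> x = \<sigma> y"
  then show "x = y" using diff[of x y] nonzero[of "x - y"] diff_in by auto
qed

lemma type_subfield_image: "type_subfield (\<sigma> ` L)"
proof (rule type_subfieldI)
  show "1 \<in> \<sigma> ` L" using one one_in by (metis imageI)
  fix x assume "x \<in> \<sigma> ` L"
  then obtain x' where x: "x = \<sigma> x'" "x' \<in> L" by blast
  show "Fields.inverse x \<in> \<sigma> ` L" unfolding x(1) using inverse x(2) inverse_in by force
  fix y assume "y \<in> \<sigma> ` L"
  then obtain y' where y: "y = \<sigma> y'" "y' \<in> L" by blast
  show "x - y \<in> \<sigma> ` L" "x * y \<in> \<sigma> ` L"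
    unfolding x(1) y(1) using x(2) y(2) by (force simp: diff[symmetric] mult[symmetric] closed)+
qed

lemma type_subfield_preimage:
  assumes "type_subfield E" shows "type_subfield {x \<in> L. \<sigma> x \<in> E}"
proof -
  interpret E: type_subfield E by fact
  show ?thesis by (rule type_subfieldI) (auto simp: one diff mult inverse closed E.closed)
qed

end

lemma (in type_subfield) poly_embedding:
  assumes "field_embedding E \<sigma>" "L \<subseteq> E" "\<And>k. k \<in> L \<Longrightarrow> \<sigma> k = k"
    and "p \<in> polys_over L" "x \<in> E"
  shows "\<sigma> (poly p x) = poly p (\<sigma> x)"
proof -
  interpret \<sigma>: field_embedding E \<sigma> by fact
  from assms(4) show ?thesis
  proof (induction p)
    case (pCons a p)
    then have a: "a \<in> L" and p: "p \<in> polys_over L" by (simp_all add: pCons_in_polys_over_iff)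
    then have "poly p x \<in> E" using \<sigma>.poly_in polys_over_mono[OF assms(2)] assms(5) by blast
    then have "\<sigma> (x * poly p x) = \<sigma> x * poly p (\<sigma> x)"
      using \<sigma>.mult[OF assms(5)] pCons.IH[OF p] by simp
    moreover have "a \<in> E" "x * poly p x \<in> E" "\<sigma> a = a"
      using a assms(2,3,5) \<open>poly p x \<in> E\<close> by (auto intro: \<sigma>.mult_in)
    ultimately show ?case using \<sigma>.add by simp
  qed (simp add: \<sigma>.zero)
qed

lemma (in field_embedding) type_subfield_fixed:
  fixes \<tau> :: "'a \<Rightarrow> 'b"
  assumes "field_embedding L \<tau>" shows "type_subfield {x \<in> L. \<sigma> x = \<tau> x}"
proof -
  interpret \<tau>: field_embedding L \<tau> by fact
  show ?thesis
    by (rule type_subfieldI)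
      (auto simp: one diff mult inverse closed \<tau>.one \<tau>.diff \<tau>.mult \<tau>.inverse)
qed

subsection \<open>Groups of field automorphisms\<close>

lemma subgroup_BijGroup_action:
  assumes "subgroup H (BijGroup S)"
  shows "group_action (BijGroup S\<lparr>carrier := H\<rparr>) S (\<lambda>\<sigma>. \<sigma>)"
proof -
  have "group_hom (BijGroup S) (BijGroup S) (\<lambda>\<sigma>. \<sigma>)"
    using group_BijGroup[of S] by (simp add: group_hom_def group_hom_axioms_def hom_def Pi_def
        group.is_group monoid.m_closed group.is_monoid)
  then show ?thesis using assms by (rule group_action.induced_action[OF group_action.intro])
qed

lemma (in group_action) group_action_Pow:
  "group_action G (Pow E) (\<lambda>g. \<lambda>S\<in>Pow E. \<phi> g ` S)"
proof -
  interpret group_hom G "BijGroup E" \<phi> by (rule group_hom)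
  let ?image = "\<lambda>g. \<lambda>S\<in>Pow E. \<phi> g ` S"
  have Bij: "?image g \<in> Bij (Pow E)" if "g \<in> carrier G" for g
  proof -
    have "bij_betw (\<phi> g) E E" using bij_prop0[OF that] by (simp add: Bij_def)
    then have "bij_betw ((`) (\<phi> g)) (Pow E) (Pow E)" by (rule bij_betw_Pow)
    then show ?thesis by (simp add: Bij_def)
  qed
  have "?image (g \<otimes> h) = compose (Pow E) (?image g) (?image h)"
    if "g \<in> carrier G" "h \<in> carrier G" for g h
  proof (rule extensionalityI[of _ "Pow E"])
    fix S assume S: "S \<in> Pow E"
    have "\<phi> (g \<otimes> h) ` S = \<phi> g ` \<phi> h ` S"
      unfolding image_image using that S composition_rule by (intro image_cong) auto
    moreover have "\<phi> h ` S \<in> Pow E" using surj_prop[OF that(2)] S by blast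
    ultimately show "?image (g \<otimes> h) S = compose (Pow E) (?image g) (?image h) S"
      using S by (simp add: compose_eq)
  qed auto
  then have "?image \<in> hom G (BijGroup (Pow E))"
    using Bij by (intro homI) (auto simp: BijGroup_def)
  then show ?thesis
    by (simp add: group_action_def group_hom_def group_hom_axioms_def group_BijGroup is_group)
qed

locale automorphism_group = type_subfield L + group_action G L "\<lambda>\<sigma>. \<sigma>"
  for L :: "'a::field set" and G :: "('a \<Rightarrow> 'a) monoid" (structure) +
  assumes field_embedding: "\<sigma> \<in> carrier G \<Longrightarrow> field_embedding L \<sigma>"
begin

sublocale group G using group_hom by (simp add: group_hom_def)

lemmas apply_mult = composition_rule and apply_in = element_image[OF _ _ refl]

lemma apply_one: "x \<in> L \<Longrightarrow> \<one> x = x"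
  by (simp flip: id_eq_one)

lemma apply_inv:
  assumes "\<sigma> \<in> carrier G" "x \<in> L"
  shows "(inv \<sigma>) (\<sigma> x) = x" "\<sigma> ((inv \<sigma>) x) = x"
  using apply_mult[of x "inv \<sigma>" \<sigma>] apply_mult[of x \<sigma> "inv \<sigma>"] apply_one assms by simp_all

lemma automorphism_eqI:
  assumes "\<sigma> \<in> carrier G" "\<tau> \<in> carrier G" "\<And>x. x \<in> L \<Longrightarrow> \<sigma> x = \<tau> x"
  shows "\<sigma> = \<tau>"
  using bij_prop0[of \<sigma>] bij_prop0[of \<tau>] assms
  by (intro extensionalityI[of _ L]) (auto simp: Bij_def)

lemma automorphism_group_subgroup:
  assumes "subgroup H G" shows "automorphism_group L (G\<lparr>carrier := H\<rparr>)"
  by (intro automorphism_group.intro type_subfield_axioms induced_action assms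
      automorphism_group_axioms.intro)
    (use subgroup.mem_carrier[OF assms] in \<open>simp add: field_embedding\<close>)

lemma stabilizer_image_subgroup:
  assumes "S \<subseteq> L" shows "subgroup (stabilizer G image S) G"
proof -
  interpret subsets: group_action G "Pow L" "\<lambda>\<sigma>. \<lambda>S\<in>Pow L. \<sigma> ` S" by (rule group_action_Pow)
  have "stabilizer G image S = stabilizer G (\<lambda>\<sigma>. \<lambda>S\<in>Pow L. \<sigma> ` S) S"
    unfolding stabilizer_def using assms by auto
  then show ?thesis using subsets.stabilizer_subgroup[of S] assms by simp
qed

lemma card_orbit_image_subgroup:
  assumes H: "subgroup H G" and "S \<subseteq> L"
  shows "card (orbit (G\<lparr>carrier := H\<rparr>) image S) * card (H \<inter> stabilizer G image S) = card H"
proof -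
  interpret subsets: group_action "G\<lparr>carrier := H\<rparr>" "Pow L" "\<lambda>\<sigma>. \<lambda>S\<in>Pow L. \<sigma> ` S"
    by (rule group_action.induced_action[OF group_action_Pow H])
  have "H \<inter> stabilizer G image S = stabilizer (G\<lparr>carrier := H\<rparr>) (\<lambda>\<sigma>. \<lambda>S\<in>Pow L. \<sigma> ` S) S"
    unfolding stabilizer_def using assms subgroup.subset[OF H] by auto
  moreover have "orbit (G\<lparr>carrier := H\<rparr>) image S = orbit (G\<lparr>carrier := H\<rparr>) (\<lambda>\<sigma>. \<lambda>S\<in>Pow L. \<sigma> ` S) S"
    unfolding orbit_def using assms by auto
  ultimately show ?thesis
    using subsets.orbit_stabilizer_theorem[of S] assms by (simp add: Coset.order_def)
qed

lemma bij_betw_left_mult: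
  assumes "subgroup H G" "\<tau> \<in> H" shows "bij_betw (\<lambda>\<sigma>. \<tau> \<otimes> \<sigma>) H H"
proof -
  interpret H: group "G\<lparr>carrier := H\<rparr>" using subgroup_imp_group[OF assms(1)] .
  show ?thesis using H.inj_on_cmult[of \<tau>] H.surj_const_mult[of \<tau>] assms(2)
    by (simp add: bij_betw_def)
qed

definition fixed_field :: "('a \<Rightarrow> 'a) set \<Rightarrow> 'a set" where
  "fixed_field H = {x \<in> L. \<forall>\<sigma>\<in>H. \<sigma> x = x}"

lemma fixed_fieldD: "x \<in> fixed_field H \<Longrightarrow> x \<in> L" "x \<in> fixed_field H \<Longrightarrow> \<sigma> \<in> H \<Longrightarrow> \<sigma> x = x"
  unfolding fixed_field_def by blast+

lemma type_subfield_fixed_field: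
  assumes "H \<subseteq> carrier G" shows "type_subfield (fixed_field H)"
proof -
  have embedding: "field_embedding L \<sigma>" if "\<sigma> \<in> H" for \<sigma>
    using field_embedding assms that by blast
  show ?thesis
    by (rule type_subfieldI)
      (auto simp: fixed_field_def closed field_embedding.one[OF embedding]
        field_embedding.diff[OF embedding] field_embedding.mult[OF embedding]
        field_embedding.inverse[OF embedding])
qed

lemma trace_in_fixed_field:
  assumes H: "subgroup H G" and x: "x \<in> L"
  shows "(\<Sum>\<sigma>\<in>H. \<sigma> x) \<in> fixed_field H"
proof -
  have carrier: "\<sigma> \<in> carrier G" if "\<sigma> \<in> H" for \<sigma> using subgroup.mem_carrier[OF H that] .
  have "\<tau> (\<Sum>\<sigma>\<in>H. \<sigma> x) = (\<Sum>\<sigma>\<in>H. \<sigma> x)" if \<tau>: "\<tau> \<in> H" for \<tau>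
  proof -
    interpret \<tau>: field_embedding L \<tau> using field_embedding[OF carrier[OF \<tau>]] .
    have "\<tau> (\<Sum>\<sigma>\<in>H. \<sigma> x) = (\<Sum>\<sigma>\<in>H. \<tau> (\<sigma> x))"
      by (intro \<tau>.sum apply_in[OF carrier x])
    also have "\<dots> = (\<Sum>\<sigma>\<in>H. (\<tau> \<otimes> \<sigma>) x)"
      using x \<tau> carrier by (intro sum.cong) (auto simp: apply_mult)
    also have "\<dots> = (\<Sum>\<sigma>\<in>H. \<sigma> x)"
      using sum.reindex_bij_betw[OF bij_betw_left_mult[OF H \<tau>]] .
    finally show ?thesis .
  qed
  moreover have "(\<Sum>\<sigma>\<in>H. \<sigma> x) \<in> L" by (intro sum_in apply_in[OF carrier x])
  ultimately show ?thesis by (simp add: fixed_field_def)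
qed

lemma orbit_subset: "x \<in> L \<Longrightarrow> orbit G (\<lambda>\<sigma>. \<sigma>) x \<subseteq> L"
  unfolding orbit_def using apply_in[of _ x] by blast

lemma orbit_prod_in_fixed_field:
  assumes x: "x \<in> L"
  shows "(\<Prod>y\<in>orbit G (\<lambda>\<sigma>. \<sigma>) x. y) \<in> fixed_field (carrier G)"
proof -
  let ?Y = "orbit G (\<lambda>\<sigma>. \<sigma>) x"
  have orbit_eq: "?Y = (\<lambda>\<sigma>. \<sigma> x) ` carrier G" unfolding orbit_def by blast
  note in_L = orbit_subset[OF x]
  have "\<tau> (\<Prod>y\<in>?Y. y) = (\<Prod>y\<in>?Y. y)" if \<tau>: "\<tau> \<in> carrier G" for \<tau>
  proof -
    interpret \<tau>: field_embedding L \<tau> using field_embedding[OF \<tau>] .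
    have "\<tau> ` ?Y = (\<lambda>\<sigma>. \<sigma> x) ` (\<lambda>\<sigma>. \<tau> \<otimes> \<sigma>) ` carrier G"
      unfolding orbit_eq image_image using x \<tau> by (intro image_cong) (auto simp: apply_mult)
    then have image: "\<tau> ` ?Y = ?Y" unfolding orbit_eq surj_const_mult[OF \<tau>] .
    have "\<tau> (\<Prod>y\<in>?Y. y) = (\<Prod>y\<in>?Y. \<tau> y)" using in_L by (intro \<tau>.prod) blast
    also have "\<dots> = (\<Prod>y\<in>\<tau> ` ?Y. y)"
      using prod.reindex[OF inj_on_subset[OF \<tau>.inj_on in_L], of "\<lambda>y. y"] by simp
    finally show ?thesis unfolding image .
  qed
  moreover have "(\<Prod>y\<in>?Y. y) \<in> L" using in_L by (intro prod_in) blast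
  ultimately show ?thesis by (simp add: fixed_field_def)
qed

end

lemma galois_group_carrier:
  "\<sigma> \<in> carrier (galois_group K L) \<longleftrightarrow> \<sigma> \<in> Bij L \<and>
     (\<forall>x\<in>L. \<forall>y\<in>L. \<sigma> (x + y) = \<sigma> x + \<sigma> y \<and> \<sigma> (x * y) = \<sigma> x * \<sigma> y) \<and> (\<forall>x\<in>K. \<sigma> x = x)"
  unfolding galois_group_def by simp

lemma (in type_subfield) subgroup_galois_group:
  assumes "K \<subseteq> L" shows "subgroup (carrier (galois_group K L)) (BijGroup L)"
proof (rule group.subgroupI[OF group_BijGroup])
  show "carrier (galois_group K L) \<subseteq> carrier (BijGroup L)"
    by (auto simp: galois_group_carrier BijGroup_def)
  have "(\<lambda>x\<in>L. x) \<in> carrier (galois_group K L)"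
    using assms by (auto simp: galois_group_carrier id_Bij closed)
  then show "carrier (galois_group K L) \<noteq> {}" by blast
  fix \<sigma> assume \<sigma>: "\<sigma> \<in> carrier (galois_group K L)"
  then have Bij: "\<sigma> \<in> Bij L" by (simp add: galois_group_carrier)
  have "inv_into L \<sigma> (x + y) = inv_into L \<sigma> x + inv_into L \<sigma> y"
    "inv_into L \<sigma> (x * y) = inv_into L \<sigma> x * inv_into L \<sigma> y" if "x \<in> L" "y \<in> L" for x y
    using \<sigma> that closed unfolding galois_group_carrier
    by (auto intro!: Bij_inv_into_lemma)
  moreover have "inv_into L \<sigma> k = k" if "k \<in> K" for k
    using \<sigma> that assms inv_into_f_f[of \<sigma> L k] unfolding galois_group_carrier
    by (auto simp: Bij_def bij_betw_def)
  ultimately show "inv\<^bsub>BijGroup L\<^esub> \<sigma> \<in> carrier (galois_group K L)"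
    using assms Bij closed
    by (auto simp: inv_BijGroup galois_group_carrier restrict_inv_into_Bij subset_iff)
  fix \<tau> assume \<tau>: "\<tau> \<in> carrier (galois_group K L)"
  then have "\<tau> x \<in> L" if "x \<in> L" for x
    using that Bij_imp_funcset by (auto simp: galois_group_carrier)
  then show "\<sigma> \<otimes>\<^bsub>BijGroup L\<^esub> \<tau> \<in> carrier (galois_group K L)"
    using \<sigma> \<tau> Bij assms closed
    by (auto simp: BijGroup_def galois_group_carrier compose_Bij compose_eq subset_iff)
qed

lemma (in type_subfield) automorphism_group_galois_group:
  assumes "K \<subseteq> L" "1 \<in> K" shows "automorphism_group L (galois_group K L)"
proof (intro automorphism_group.intro type_subfield_axioms automorphism_group_axioms.intro)
  have "galois_group K L = BijGroup L\<lparr>carrier := carrier (galois_group K L)\<rparr>"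
    unfolding galois_group_def by simp
  then show "group_action (galois_group K L) L (\<lambda>\<sigma>. \<sigma>)"
    using subgroup_BijGroup_action[OF subgroup_galois_group[OF assms(1)]] by simp
  show "field_embedding L \<sigma>" if "\<sigma> \<in> carrier (galois_group K L)" for \<sigma>
    using that assms(2)
    by (intro field_embedding.intro type_subfield_axioms field_embedding_axioms.intro)
      (auto simp: galois_group_carrier)
qed

subsection \<open>Minimal polynomials and simple extensions\<close>

lemma alg_closed_size_proots:
  fixes p :: "'a::alg_closed_field poly"
  shows "size (proots p) = degree p"
proof (cases "p = 0")
  case False
  obtain A where A: "size A = degree p" "p = smult (lead_coeff p) (\<Prod>x\<in>#A. [:- x, 1:])"
    using alg_closed_imp_factorization[OF False] by blast
  have "0 \<notin> (\<lambda>x. [:- x, 1:]) ` set_mset A" by auto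
  then have "proots (\<Prod>x\<in>#A. [:- x, 1:]) = A"
    using proots_prod_mset[of "image_mset (\<lambda>x. [:- x, 1:]) A"]
    by (simp add: image_mset.compositionality comp_def)
  then have "proots p = A" using A(2) False by (metis leading_coeff_0_iff proots_smult)
  then show ?thesis using A(1) by simp
qed simp

lemma card_roots_rsquarefree:
  fixes p :: "'a::alg_closed_field poly"
  assumes "rsquarefree p"
  shows "card {x. poly p x = 0} = degree p"
proof -
  have "p \<noteq> 0" using assms by (simp add: rsquarefree_def)
  have "degree p = (\<Sum>x\<in>set_mset (proots p). count (proots p) x)"
    by (simp add: size_multiset_overloaded_eq flip: alg_closed_size_proots)
  also have "\<dots> = (\<Sum>x | poly p x = 0. 1)"
    using \<open>p \<noteq> 0\<close> rsquarefree_root_order[OF assms] by (intro sum.cong) auto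
  finally show ?thesis by simp
qed

lemma exists_generic_combination:
  fixes a b :: "'a::field_char_0"
  assumes "finite A" "finite B"
  obtains n :: nat
  where "\<And>x y. x \<in> A \<Longrightarrow> y \<in> B \<Longrightarrow> a + of_nat n * b = x + of_nat n * y \<Longrightarrow> y = b"
proof -
  define Q where "Q = (\<lambda>(x, y). (x - a) / (b - y)) ` (A \<times> B)"
  have "finite Q" unfolding Q_def using assms by blast
  then have "finite (of_nat -` Q :: nat set)" by (intro finite_vimageI) (auto simp: inj_on_def)
  then obtain n :: nat where n: "of_nat n \<notin> Q"
    using ex_new_if_finite[of "of_nat -` Q :: nat set"] by auto
  have "y = b" if xy: "x \<in> A" "y \<in> B" and eq: "a + of_nat n * b = x + of_nat n * y" for x y
  proof (rule ccontr)
    assume "y \<noteq> b"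
    moreover have "of_nat n * (b - y) = x - a" using eq by (simp add: algebra_simps)
    ultimately have "of_nat n = (x - a) / (b - y)" by (simp add: eq_divide_eq)
    then show False using n xy unfolding Q_def by (auto intro: image_eqI[of _ _ "(x, y)"])
  qed
  then show ?thesis using that by blast
qed

locale algebraic_base = type_subfield K for K :: "'a::{alg_closed_field, field_char_0} set" +
  assumes algebraic: "\<exists>p\<in>polys_over K. p \<noteq> 0 \<and> poly p x = 0"
begin

definition is_minpoly :: "'a poly \<Rightarrow> 'a \<Rightarrow> bool" where
  "is_minpoly m x \<longleftrightarrow>
     m \<in> polys_over K \<and> m \<noteq> 0 \<and> (\<forall>p\<in>polys_over K. poly p x = 0 \<longleftrightarrow> m dvd p)"

lemma is_minpoly_root: "is_minpoly m x \<Longrightarrow> poly m x = 0"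
  unfolding is_minpoly_def by auto

lemma is_minpoly_exists: obtains m where "is_minpoly m x"
proof -
  let ?annihilator = "\<lambda>p. p \<in> polys_over K \<and> p \<noteq> 0 \<and> poly p x = 0"
  obtain p where "?annihilator p" using algebraic by blast
  then obtain m where m: "?annihilator m" and least: "\<And>p. ?annihilator p \<Longrightarrow> degree m \<le> degree p"
    using ex_has_least_nat[of ?annihilator p degree] by blast
  have "m dvd p" if p: "p \<in> polys_over K" "poly p x = 0" for p
  proof -
    have "poly (p mod m) x = 0" using p(2) m by (metis poly_mod)
    then have "p mod m = 0"
      using least[of "p mod m"] degree_mod_less[of m p] m p(1) polys_over_mod by fastforce
    then show ?thesis by (simp add: dvd_eq_mod_eq_0)
  qed
  then have "is_minpoly m x" unfolding is_minpoly_def using m by (auto elim!: dvdE)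
  then show ?thesis by (rule that)
qed

lemma is_minpoly_degree_pos:
  assumes "is_minpoly m x" shows "degree m > 0"
proof (rule ccontr)
  assume "\<not> degree m > 0"
  then obtain k where "m = [:k:]" using degree_eq_zeroE by blast
  then show False using assms is_minpoly_root[OF assms] unfolding is_minpoly_def by auto
qed

lemma is_minpoly_conjugate:
  assumes m: "is_minpoly m x" and y: "poly m y = 0"
  shows "is_minpoly m y"
proof -
  obtain m' where m': "is_minpoly m' y" by (rule is_minpoly_exists)
  define h where "h = m div m'"
  have "m' dvd m" using m m' y unfolding is_minpoly_def by blast
  then have h: "m = m' * h" unfolding h_def by simp
  have "h \<in> polys_over K" unfolding h_def using m m' polys_over_div by (simp add: is_minpoly_def)
  have "m \<noteq> 0" using m by (simp add: is_minpoly_def)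
  have "\<not> m dvd h"
  proof
    assume "m dvd h"
    then have "degree m \<le> degree h" using h \<open>m \<noteq> 0\<close> by (intro dvd_imp_degree_le) auto
    moreover have "degree m = degree m' + degree h"
      using h \<open>m \<noteq> 0\<close> by (metis degree_mult_eq mult_zero_left mult_zero_right)
    ultimately show False using is_minpoly_degree_pos[OF m'] by simp
  qed
  then have "poly h x \<noteq> 0" using m \<open>h \<in> polys_over K\<close> unfolding is_minpoly_def by blast
  then have "poly m' x = 0" using is_minpoly_root[OF m] h by simp
  then have "m dvd m'" using m m' unfolding is_minpoly_def by blast
  then show ?thesis using m m' \<open>m' dvd m\<close> unfolding is_minpoly_def by (meson dvd_trans)
qed

lemma is_minpoly_rsquarefree:
  assumes "is_minpoly m x" shows "rsquarefree m"
  unfolding rsquarefree_roots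
proof safe
  fix y assume "poly m y = 0" and deriv: "poly (pderiv m) y = 0"
  then have "is_minpoly m y" using assms is_minpoly_conjugate by blast
  then have "m dvd pderiv m" using deriv polys_over_pderiv unfolding is_minpoly_def by blast
  moreover have "pderiv m \<noteq> 0" using is_minpoly_degree_pos[OF assms] by (simp add: pderiv_eq_0_iff)
  ultimately have "degree m \<le> degree m - 1" by (metis degree_pderiv dvd_imp_degree_le)
  then show False using is_minpoly_degree_pos[OF assms] by simp
qed

lemma card_conjugates: "is_minpoly m x \<Longrightarrow> card {y. poly m y = 0} = degree m"
  using is_minpoly_rsquarefree card_roots_rsquarefree by blast

lemma common_root_in:
  assumes "p \<in> polys_over K" "q \<in> polys_over K" "poly p b = 0" "poly q b = 0"
    and unique: "\<And>y. poly p y = 0 \<Longrightarrow> poly q y = 0 \<Longrightarrow> y = b"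
  shows "b \<in> K"
proof -
  obtain m where m: "is_minpoly m b" by (rule is_minpoly_exists)
  then have "m dvd p" "m dvd q" using assms(1-4) unfolding is_minpoly_def by blast+
  then have "y = b" if "poly m y = 0" for y
    using unique that by (metis dvdE mult_zero_left poly_mult)
  then have "{y. poly m y = 0} = {b}" using is_minpoly_root[OF m] by blast
  then have deg: "degree m = 1" using card_conjugates[OF m] by simp
  then have "coeff m 0 + coeff m 1 * b = 0"
    using is_minpoly_root[OF m] by (simp add: poly_altdef)
  moreover have "coeff m 1 \<noteq> 0" using deg by (metis leading_coeff_neq_0 degree_0 zero_neq_one)
  ultimately have "b = - coeff m 0 / coeff m 1" by (simp add: field_simps eq_neg_iff_add_eq_0)
  then show ?thesis using m coeff_in_polys_over by (auto simp: is_minpoly_def intro!: closed)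
qed

definition adjoin :: "'a \<Rightarrow> 'a set" where
  "adjoin x = (\<lambda>p. poly p x) ` polys_over K"

lemma adjoinI: "p \<in> polys_over K \<Longrightarrow> poly p x \<in> adjoin x"
  unfolding adjoin_def by blast

lemma generator_in_adjoin: "x \<in> adjoin x"
  using adjoinI[OF polys_over_X, of x] by simp

lemma base_subset_adjoin: "K \<subseteq> adjoin x"
  using adjoinI[OF polys_over_const, of _ x] by auto

lemma adjoinE_degree_less:
  assumes "is_minpoly m x" "y \<in> adjoin x"
  obtains p where "p \<in> polys_over K" "degree p < degree m" "y = poly p x"
proof -
  obtain q where q: "q \<in> polys_over K" "y = poly q x" using assms(2) unfolding adjoin_def by blast
  show ?thesis
  proof (rule that)
    show "q mod m \<in> polys_over K" using q(1) assms(1) polys_over_mod by (simp add: is_minpoly_def)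
    show "degree (q mod m) < degree m"
      using degree_mod_less[of m q] assms(1) is_minpoly_degree_pos[OF assms(1)]
      by (auto simp: is_minpoly_def)
    show "y = poly (q mod m) x" using q(2) is_minpoly_root[OF assms(1)] by (simp add: poly_mod)
  qed
qed

lemma type_subfield_adjoin: "type_subfield (adjoin x)"
proof (rule type_subfieldI)
  show "1 \<in> adjoin x" using base_subset_adjoin one_in by blast
  fix y assume "y \<in> adjoin x"
  then obtain p where p: "p \<in> polys_over K" "y = poly p x" unfolding adjoin_def by blast
  show "inverse y \<in> adjoin x" if "y \<noteq> 0"
  proof -
    obtain m where m: "is_minpoly m y" by (rule is_minpoly_exists)
    obtain k q where mq: "m = pCons k q" by (metis pCons_cases)
    then have q: "k \<in> K" "q \<in> polys_over K"
      using m by (simp_all add: is_minpoly_def pCons_in_polys_over_iff)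
    have root: "k + y * poly q y = 0" using is_minpoly_root[OF m] mq by simp
    have "k \<noteq> 0"
    proof
      assume "k = 0"
      then have "m dvd q" using root that m q(2) unfolding is_minpoly_def by simp
      moreover have "q \<noteq> 0" using m \<open>k = 0\<close> mq by (auto simp: is_minpoly_def)
      ultimately have "degree m \<le> degree q" by (rule dvd_imp_degree_le)
      then show False using \<open>q \<noteq> 0\<close> by (simp add: mq)
    qed
    have "y * poly q y = - k" using root by (simp add: add_eq_0_iff)
    then have "y * (- inverse k * poly q y) = 1"
      using \<open>k \<noteq> 0\<close> by (simp add: mult.left_commute[of y])
    then have "inverse y = - inverse k * poly q y" by (rule inverse_unique)
    also have "\<dots> = poly (smult (- inverse k) (pcompose q p)) x"
      using p(2) by (simp add: poly_pcompose)
    also have "\<dots> \<in> adjoin x"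
      using p(1) q by (intro adjoinI polys_over_smult polys_over_pcompose uminus_in inverse_in)
    finally show ?thesis .
  qed
  fix z assume "z \<in> adjoin x"
  then obtain q where q: "q \<in> polys_over K" "z = poly q x" unfolding adjoin_def by blast
  show "y - z \<in> adjoin x" using adjoinI[OF polys_over_diff[OF p(1) q(1)]] p(2) q(2) by simp
  show "y * z \<in> adjoin x" using adjoinI[OF polys_over_mult[OF p(1) q(1)]] p(2) q(2) by simp
qed

lemma adjoin_least:
  assumes "type_subfield E" "K \<subseteq> E" "x \<in> E"
  shows "adjoin x \<subseteq> E"
  unfolding adjoin_def
  using type_subfield.poly_in[OF assms(1) _ assms(3)] polys_over_mono[OF assms(2)] by blast

lemma algebraic_base_extension:
  assumes "type_subfield E" "K \<subseteq> E" shows "algebraic_base E"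
  using assms(1) algebraic polys_over_mono[OF assms(2)]
  by (intro algebraic_base.intro algebraic_base_axioms.intro) blast+

subsection \<open>Primitive elements\<close>

lemma primitive_element_pair:
  obtains n :: nat where "a \<in> adjoin (a + of_nat n * b)" "b \<in> adjoin (a + of_nat n * b)"
proof -
  obtain f where f: "is_minpoly f a" by (rule is_minpoly_exists)
  obtain g where g: "is_minpoly g b" by (rule is_minpoly_exists)
  have "finite {x. poly f x = 0}" "finite {y. poly g y = 0}"
    using f g poly_roots_finite unfolding is_minpoly_def by blast+
  then obtain n :: nat where generic: "\<And>x y. poly f x = 0 \<Longrightarrow> poly g y = 0 \<Longrightarrow>
      a + of_nat n * b = x + of_nat n * y \<Longrightarrow> y = b"
    using exists_generic_combination[of "{x. poly f x = 0}" "{y. poly g y = 0}" a b] by auto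
  define t where "t = a + of_nat n * b"
  interpret E: algebraic_base "adjoin t"
    by (intro algebraic_base_extension type_subfield_adjoin base_subset_adjoin)
  have over_E: "p \<in> polys_over (adjoin t)" if "p \<in> polys_over K" for p
    using polys_over_mono[OF base_subset_adjoin] that by blast
  have "b \<in> adjoin t"
  proof (rule E.common_root_in)
    show "g \<in> polys_over (adjoin t)" using g over_E by (simp add: is_minpoly_def)
    show "pcompose f [:t, - of_nat n:] \<in> polys_over (adjoin t)"
      using f over_E E.closed generator_in_adjoin
      by (intro E.polys_over_pcompose)
        (simp_all add: is_minpoly_def pCons_in_polys_over_iff E.polys_over_0)
    show "poly g b = 0" "poly (pcompose f [:t, - of_nat n:]) b = 0"
      using is_minpoly_root[OF f] is_minpoly_root[OF g]
      by (simp_all add: poly_pcompose t_def mult.commute)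
    fix y assume "poly g y = 0" "poly (pcompose f [:t, - of_nat n:]) y = 0"
    then show "y = b"
      using generic[of "t - of_nat n * y" y] by (simp add: t_def poly_pcompose mult.commute)
  qed
  moreover from this have "t - of_nat n * b \<in> adjoin t"
    using generator_in_adjoin by (intro E.closed)
  then have "a \<in> adjoin t" by (simp add: t_def)
  ultimately show ?thesis using that unfolding t_def by blast
qed

lemma primitive_element:
  assumes "finite S" "type_subfield E" "S \<subseteq> E"
  obtains t where "t \<in> E" "S \<subseteq> adjoin t"
proof -
  interpret E: type_subfield E by fact
  have "\<exists>t\<in>E. S \<subseteq> adjoin t"
    using assms(1,3)
  proof (induction S)
    case empty
    show ?case using E.zero_in by blast
  next
    case (insert b S)
    then obtain a where a: "a \<in> E" "S \<subseteq> adjoin a" by blast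
    obtain n :: nat where n: "a \<in> adjoin (a + of_nat n * b)" "b \<in> adjoin (a + of_nat n * b)"
      by (rule primitive_element_pair)
    have "adjoin a \<subseteq> adjoin (a + of_nat n * b)"
      using n(1) by (intro adjoin_least type_subfield_adjoin base_subset_adjoin)
    moreover have "a + of_nat n * b \<in> E" using a(1) insert.prems by (simp add: E.closed)
    ultimately show ?case using a(2) n(2) by blast
  qed
  then show ?thesis using that by blast
qed

end

subsection \<open>Splitting fields\<close>

locale splitting_field = algebraic_base K + L: type_subfield L
  for K L :: "'a::{alg_closed_field, field_char_0} set" +
  fixes f :: "'a poly"
  assumes f_over: "f \<in> polys_over K" and f_nonzero: "f \<noteq> 0"
    and base_subset: "K \<subseteq> L" and roots_subset: "{x. poly f x = 0} \<subseteq> L"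
    and least: "type_subfield E \<Longrightarrow> K \<subseteq> E \<Longrightarrow> {x. poly f x = 0} \<subseteq> E \<Longrightarrow> L \<subseteq> E"
begin

abbreviation roots :: "'a set" where "roots \<equiv> {x. poly f x = 0}"

sublocale galois: automorphism_group L "galois_group K L"
  using L.automorphism_group_galois_group[OF base_subset one_in] .

lemma finite_roots: "finite roots"
  using f_nonzero by (rule poly_roots_finite)

lemma primitive_generator: obtains t where "t \<in> L" "L = adjoin t"
proof -
  obtain t where t: "t \<in> L" "roots \<subseteq> adjoin t"
    using primitive_element[OF finite_roots L.type_subfield_axioms roots_subset] .
  have "adjoin t \<subseteq> L" by (intro adjoin_least L.type_subfield_axioms base_subset t(1))
  moreover have "L \<subseteq> adjoin t" by (intro least type_subfield_adjoin base_subset_adjoin t(2))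
  ultimately show ?thesis using that[OF t(1)] by blast
qed

lemma embedding_image_roots:
  assumes "field_embedding L \<sigma>" and fixes_base: "\<And>k. k \<in> K \<Longrightarrow> \<sigma> k = k"
  shows "\<sigma> ` roots = roots"
proof (rule card_subset_eq[OF finite_roots])
  interpret \<sigma>: field_embedding L \<sigma> by fact
  show "\<sigma> ` roots \<subseteq> roots"
  proof safe
    fix x assume x: "poly f x = 0"
    then have "x \<in> L" using roots_subset by blast
    then have "poly f (\<sigma> x) = \<sigma> (poly f x)"
      using poly_embedding[OF assms(1) base_subset fixes_base f_over] by simp
    then show "poly f (\<sigma> x) = 0" by (simp add: x \<sigma>.zero)
  qed
  show "card (\<sigma> ` roots) = card roots"
    using card_image[OF inj_on_subset[OF \<sigma>.inj_on roots_subset]] .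
qed

lemma embedding_image:
  assumes "field_embedding L \<sigma>" and fixes_base: "\<And>k. k \<in> K \<Longrightarrow> \<sigma> k = k"
  shows "\<sigma> ` L = L"
proof
  interpret \<sigma>: field_embedding L \<sigma> by fact
  note image_roots = embedding_image_roots[OF assms]
  have "L \<subseteq> {x \<in> L. \<sigma> x \<in> L}"
    using base_subset fixes_base roots_subset image_roots
    by (intro least \<sigma>.type_subfield_preimage L.type_subfield_axioms) auto
  then show "\<sigma> ` L \<subseteq> L" by blast
  have "k \<in> \<sigma> ` L" if "k \<in> K" for k
    using fixes_base[OF that] base_subset that by (metis imageI subsetD)
  moreover have "roots \<subseteq> \<sigma> ` L" using image_roots roots_subset by blast
  ultimately show "L \<subseteq> \<sigma> ` L" by (intro least \<sigma>.type_subfield_image) auto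
qed

lemma galois_fixes_base: "\<sigma> \<in> carrier (galois_group K L) \<Longrightarrow> k \<in> K \<Longrightarrow> \<sigma> k = k"
  by (simp add: galois_group_carrier)

lemma galois_image_roots: "\<sigma> \<in> carrier (galois_group K L) \<Longrightarrow> \<sigma> ` roots = roots"
  using embedding_image_roots[OF galois.field_embedding] galois_fixes_base by blast

lemma galois_poly:
  "\<sigma> \<in> carrier (galois_group K L) \<Longrightarrow> p \<in> polys_over K \<Longrightarrow> x \<in> L \<Longrightarrow> \<sigma> (poly p x) = poly p (\<sigma> x)"
  using poly_embedding[OF galois.field_embedding base_subset] galois_fixes_base by blast

lemma galois_eqI_roots:
  assumes "\<sigma> \<in> carrier (galois_group K L)" "\<tau> \<in> carrier (galois_group K L)"
    and "\<And>r. r \<in> roots \<Longrightarrow> \<sigma> r = \<tau> r"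
  shows "\<sigma> = \<tau>"
proof (rule galois.automorphism_eqI[OF assms(1,2)])
  have "L \<subseteq> {x \<in> L. \<sigma> x = \<tau> x}"
    using assms(3) base_subset roots_subset galois_fixes_base[OF assms(1)]
      galois_fixes_base[OF assms(2)]
    by (intro least field_embedding.type_subfield_fixed galois.field_embedding assms(1,2)) auto
  then show "\<sigma> x = \<tau> x" if "x \<in> L" for x using that by blast
qed

lemma finite_galois_group: "finite (carrier (galois_group K L))"
proof -
  obtain t where t: "t \<in> L" "L = adjoin t" by (rule primitive_generator)
  obtain m where m: "is_minpoly m t" by (rule is_minpoly_exists)
  then have m_over: "m \<in> polys_over K" and "m \<noteq> 0" by (simp_all add: is_minpoly_def)
  have "poly m (\<sigma> t) = 0" if "\<sigma> \<in> carrier (galois_group K L)" for \<sigma>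
    using galois_poly[OF that m_over t(1)] is_minpoly_root[OF m]
      field_embedding.zero[OF galois.field_embedding[OF that]] by simp
  then have "finite ((\<lambda>\<sigma>. \<sigma> t) ` carrier (galois_group K L))"
    by (intro finite_subset[OF _ poly_roots_finite[OF \<open>m \<noteq> 0\<close>]]) blast
  moreover have "inj_on (\<lambda>\<sigma>. \<sigma> t) (carrier (galois_group K L))"
  proof (rule inj_onI, rule galois.automorphism_eqI)
    fix \<sigma> \<tau> x
    assume \<sigma>\<tau>: "\<sigma> \<in> carrier (galois_group K L)" "\<tau> \<in> carrier (galois_group K L)" "\<sigma> t = \<tau> t"
      and "x \<in> L"
    then obtain p where "p \<in> polys_over K" "x = poly p t" unfolding t(2) adjoin_def by blast
    then show "\<sigma> x = \<tau> x"
      using galois_poly[OF \<sigma>\<tau>(1)] galois_poly[OF \<sigma>\<tau>(2)] \<sigma>\<tau>(3) t(1) by simp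
  qed
  ultimately show ?thesis by (rule finite_imageD)
qed

lemma galois_conjugate:
  assumes L: "L = adjoin t" and m: "is_minpoly m t" and conjugate: "poly m t' = 0"
  obtains \<sigma> where "\<sigma> \<in> carrier (galois_group K L)"
    "\<And>p. p \<in> polys_over K \<Longrightarrow> \<sigma> (poly p t) = poly p t'"
proof -
  have m': "is_minpoly m t'" using is_minpoly_conjugate[OF m conjugate] .
  have eq_iff: "poly p t = poly q t \<longleftrightarrow> poly p t' = poly q t'"
    if "p \<in> polys_over K" "q \<in> polys_over K" for p q
  proof -
    have "poly (p - q) t = 0 \<longleftrightarrow> poly (p - q) t' = 0"
      using m m' polys_over_diff[OF that] unfolding is_minpoly_def by blast
    then show ?thesis by simp
  qed
  define \<sigma> where "\<sigma> = (\<lambda>x\<in>L. poly (SOME p. p \<in> polys_over K \<and> poly p t = x) t')"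
  have \<sigma>: "\<sigma> (poly p t) = poly p t'" if p: "p \<in> polys_over K" for p
  proof -
    define q where "q = (SOME q. q \<in> polys_over K \<and> poly q t = poly p t)"
    have "q \<in> polys_over K" "poly q t = poly p t"
      unfolding q_def using someI[of "\<lambda>q. q \<in> polys_over K \<and> poly q t = poly p t" p] p by blast+
    then have "poly q t' = poly p t'" using eq_iff p by blast
    then show ?thesis using p by (simp add: \<sigma>_def L adjoinI flip: q_def)
  qed
  have fixes_base: "\<sigma> k = k" if "k \<in> K" for k using \<sigma>[OF polys_over_const[OF that]] by simp
  have hom: "\<sigma> (x + y) = \<sigma> x + \<sigma> y \<and> \<sigma> (x * y) = \<sigma> x * \<sigma> y" if xy: "x \<in> L" "y \<in> L" for x y
  proof -
    obtain p q where "p \<in> polys_over K" "x = poly p t" "q \<in> polys_over K" "y = poly q t"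
      using xy unfolding L adjoin_def by blast
    then show ?thesis
      using \<sigma> \<sigma>[OF polys_over_add] \<sigma>[OF polys_over_mult] by (metis poly_add poly_mult)
  qed
  then have embedding: "field_embedding L \<sigma>"
    using fixes_base one_in
    by (intro field_embedding.intro L.type_subfield_axioms field_embedding_axioms.intro) simp_all
  have "bij_betw \<sigma> L L"
    using field_embedding.inj_on[OF embedding] embedding_image[OF embedding fixes_base]
    by (simp add: bij_betw_def)
  then have "\<sigma> \<in> Bij L" by (simp add: Bij_def \<sigma>_def)
  then have "\<sigma> \<in> carrier (galois_group K L)"
    using hom fixes_base by (simp add: galois_group_carrier)
  then show ?thesis using that \<sigma> by blast
qed

text \<open>Writing a fixed element as \<open>p(t)\<close> with \<open>deg p < deg m\<close>, the polynomial \<open>p - p(t)\<close> vanishes at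
  the \<open>deg m\<close> conjugates of the primitive element \<open>t\<close>.\<close>

lemma galois_fixed_field: "galois.fixed_field (carrier (galois_group K L)) = K"
proof (intro equalityI subsetI)
  show "x \<in> galois.fixed_field (carrier (galois_group K L))" if "x \<in> K" for x
    using that base_subset galois_fixes_base by (auto simp: galois.fixed_field_def)
  fix x assume x: "x \<in> galois.fixed_field (carrier (galois_group K L))"
  obtain t where L: "L = adjoin t" by (rule primitive_generator)
  obtain m where m: "is_minpoly m t" by (rule is_minpoly_exists)
  obtain p where p: "p \<in> polys_over K" "degree p < degree m" "x = poly p t"
    using adjoinE_degree_less[OF m] galois.fixed_fieldD(1)[OF x] L by blast
  have conjugates: "{y. poly m y = 0} \<subseteq> {y. poly (p - [:x:]) y = 0}"
  proof safe
    fix t' assume "poly m t' = 0"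
    then obtain \<sigma> where "\<sigma> \<in> carrier (galois_group K L)" "\<sigma> (poly p t) = poly p t'"
      using galois_conjugate[OF L m] p(1) by blast
    then show "poly (p - [:x:]) t' = 0" using galois.fixed_fieldD(2)[OF x, of \<sigma>] p(3) by simp
  qed
  have "p - [:x:] = 0"
  proof (rule ccontr)
    assume nonzero: "p - [:x:] \<noteq> 0"
    have "degree m \<le> card {y. poly (p - [:x:]) y = 0}"
      unfolding card_conjugates[OF m, symmetric]
      using card_mono[OF poly_roots_finite[OF nonzero] conjugates] .
    also have "\<dots> \<le> degree (p - [:x:])" using nonzero by (rule card_poly_roots_bound)
    also have "\<dots> \<le> degree p" by (rule degree_diff_le) simp_all
    finally show False using p(2) by simp
  qed
  then have "p = [:x:]" by simp
  then show "x \<in> K" using p(1) by (simp add: pCons_in_polys_over_iff)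
qed

end

subsection \<open>Valued fields\<close>

locale valued_field =
  fixes v :: "'a::field \<Rightarrow> rat"
  assumes valuation: "valuation v"
begin

abbreviation integral :: "'a \<Rightarrow> bool" where "integral x \<equiv> val_ge v x 0"
abbreviation infinitesimal :: "'a \<Rightarrow> bool" where "infinitesimal x \<equiv> val_gt v x 0"

lemma v_mult: "x \<noteq> 0 \<Longrightarrow> y \<noteq> 0 \<Longrightarrow> v (x * y) = v x + v y"
  using valuation unfolding valuation_def by blast

lemma v_add: "x \<noteq> 0 \<Longrightarrow> y \<noteq> 0 \<Longrightarrow> x + y \<noteq> 0 \<Longrightarrow> min (v x) (v y) \<le> v (x + y)"
  using valuation unfolding valuation_def by blast

lemma v_1 [simp]: "v 1 = 0"
  using v_mult[of 1 1] by simp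

lemma v_uminus [simp]: "v (- x) = v x"
proof (cases "x = 0")
  case False
  have "v (-1) + v (-1) = 0" using v_mult[of "-1" "-1"] by simp
  then show ?thesis using v_mult[of "-1" x] False by simp
qed simp

lemma v_inverse: "x \<noteq> 0 \<Longrightarrow> v (inverse x) = - v x"
  using v_mult[of x "inverse x"] by simp

lemma v_divide: "x \<noteq> 0 \<Longrightarrow> y \<noteq> 0 \<Longrightarrow> v (x / y) = v x - v y"
  using v_mult[of x "inverse y"] v_inverse[of y] by (simp add: divide_inverse)

lemma v_power: "x \<noteq> 0 \<Longrightarrow> v (x ^ n) = of_nat n * v x"
  by (induction n) (simp_all add: v_mult algebra_simps)

lemma v_prod: "finite A \<Longrightarrow> (\<And>i. i \<in> A \<Longrightarrow> f i \<noteq> 0) \<Longrightarrow> v (prod f A) = (\<Sum>i\<in>A. v (f i))"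
  by (induction A rule: finite_induct) (auto simp: v_mult)

lemma val_0 [simp]: "val_ge v 0 d" "val_gt v 0 d"
  unfolding val_ge_def val_gt_def by simp_all

lemma integral_1 [simp]: "integral 1"
  unfolding val_ge_def by simp

lemma not_infinitesimal_1 [simp]: "\<not> infinitesimal 1"
  by (simp add: val_gt_def)

lemma val_ge_self: "val_ge v x (v x)"
  unfolding val_ge_def by simp

lemma val_gt_imp_ge: "val_gt v x d \<Longrightarrow> val_ge v x d"
  unfolding val_ge_def val_gt_def by auto

lemma val_ge_mono: "val_ge v x d \<Longrightarrow> d' \<le> d \<Longrightarrow> val_ge v x d'"
  unfolding val_ge_def by auto

lemma val_ge_add: "val_ge v x d \<Longrightarrow> val_ge v y d \<Longrightarrow> val_ge v (x + y) d"
  unfolding val_ge_def using v_add[of x y] by (cases "x = 0"; cases "y = 0"; cases "x + y = 0") auto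

lemma val_gt_add: "val_gt v x d \<Longrightarrow> val_gt v y d \<Longrightarrow> val_gt v (x + y) d"
  unfolding val_gt_def using v_add[of x y] by (cases "x = 0"; cases "y = 0"; cases "x + y = 0") auto

lemma val_ge_uminus [simp]: "val_ge v (- x) d \<longleftrightarrow> val_ge v x d"
  unfolding val_ge_def by simp

lemma val_gt_uminus [simp]: "val_gt v (- x) d \<longleftrightarrow> val_gt v x d"
  unfolding val_gt_def by simp

lemma val_ge_minus_commute: "val_ge v (x - y) d \<longleftrightarrow> val_ge v (y - x) d"
  using val_ge_uminus[of "x - y"] by simp

lemma val_gt_minus_commute: "val_gt v (x - y) d \<longleftrightarrow> val_gt v (y - x) d"
  using val_gt_uminus[of "x - y"] by simp

lemma val_ge_diff: "val_ge v x d \<Longrightarrow> val_ge v y d \<Longrightarrow> val_ge v (x - y) d"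
  using val_ge_add[of x d "- y"] by simp

lemma val_gt_diff: "val_gt v x d \<Longrightarrow> val_gt v y d \<Longrightarrow> val_gt v (x - y) d"
  using val_gt_add[of x d "- y"] by simp

lemma val_ge_diff_trans: "val_ge v (x - y) d \<Longrightarrow> val_ge v (y - z) d \<Longrightarrow> val_ge v (x - z) d"
  using val_ge_add[of "x - y" d "y - z"] by simp

lemma val_gt_diff_trans: "val_gt v (x - y) d \<Longrightarrow> val_gt v (y - z) d \<Longrightarrow> val_gt v (x - z) d"
  using val_gt_add[of "x - y" d "y - z"] by simp

lemma val_ge_sum: "(\<And>i. i \<in> A \<Longrightarrow> val_ge v (f i) d) \<Longrightarrow> val_ge v (sum f A) d"
  by (induction A rule: infinite_finite_induct) (auto intro: val_ge_add)

lemma val_gt_sum: "(\<And>i. i \<in> A \<Longrightarrow> val_gt v (f i) d) \<Longrightarrow> val_gt v (sum f A) d"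
  by (induction A rule: infinite_finite_induct) (auto intro: val_gt_add)

lemma val_ge_mult: "val_ge v x d \<Longrightarrow> val_ge v y d' \<Longrightarrow> val_ge v (x * y) (d + d')"
  unfolding val_ge_def by (cases "x = 0"; cases "y = 0") (auto simp: v_mult)

lemma val_ge_mult_unit: "x \<noteq> 0 \<Longrightarrow> val_ge v (x * y) d \<longleftrightarrow> val_ge v y (d - v x)"
  unfolding val_ge_def by (cases "y = 0") (auto simp: v_mult)

lemma val_gt_mult_unit: "x \<noteq> 0 \<Longrightarrow> val_gt v (x * y) d \<longleftrightarrow> val_gt v y (d - v x)"
  unfolding val_gt_def by (cases "y = 0") (auto simp: v_mult)

lemma integral_mult: "integral x \<Longrightarrow> integral y \<Longrightarrow> integral (x * y)"
  using val_ge_mult[of x 0 y 0] by simp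

lemma integral_power: "integral x \<Longrightarrow> integral (x ^ n)"
  by (induction n) (auto intro: integral_mult)

lemma integral_of_nat: "integral (of_nat n)"
  by (induction n) (auto intro: val_ge_add)

lemma infinitesimal_mult_iff:
  assumes "integral x" "integral y"
  shows "infinitesimal (x * y) \<longleftrightarrow> infinitesimal x \<or> infinitesimal y"
  using assms unfolding val_ge_def val_gt_def
  by (cases "x = 0"; cases "y = 0") (auto simp: v_mult)

lemma v_eq_0_if_unit: "integral x \<Longrightarrow> \<not> infinitesimal x \<Longrightarrow> x \<noteq> 0 \<and> v x = 0"
  unfolding val_ge_def val_gt_def by auto

lemma v_eq_of_val_gt_diff:
  assumes "x \<noteq> 0" "val_gt v (y - x) (v x)"
  shows "y \<noteq> 0" "v y = v x"
proof -
  show "y \<noteq> 0" using assms by (auto simp: val_gt_def)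
  have "val_ge v (x + (y - x)) (v x)"
    using assms(2) by (intro val_ge_add) (auto simp: val_ge_def val_gt_def)
  then have "v y \<ge> v x" using \<open>y \<noteq> 0\<close> by (auto simp: val_ge_def)
  moreover have "\<not> v y > v x"
  proof
    assume "v y > v x"
    then have "val_gt v (y - (y - x)) (v x)"
      using val_gt_diff[of y "v x" "y - x"] assms by (auto simp: val_gt_def)
    then show False using assms(1) by (simp add: val_gt_def)
  qed
  ultimately show "v y = v x" by simp
qed

definition residue_eq :: "'a \<Rightarrow> 'a \<Rightarrow> bool" (infix \<open>\<approx>\<close> 50) where
  "a \<approx> b \<longleftrightarrow> infinitesimal (a - b)"

lemma residue_eq_refl [simp]: "a \<approx> a"
  unfolding residue_eq_def by simp

lemma residue_eq_sym: "a \<approx> b \<Longrightarrow> b \<approx> a"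
  unfolding residue_eq_def using val_gt_minus_commute by blast

lemma residue_eq_trans [trans]: "a \<approx> b \<Longrightarrow> b \<approx> c \<Longrightarrow> a \<approx> c"
  unfolding residue_eq_def by (rule val_gt_diff_trans)

lemma residue_eq_mult:
  assumes "a \<approx> a'" "b \<approx> b'" "integral a" "integral b" "integral b'"
  shows "a * b \<approx> a' * b'"
proof -
  have "infinitesimal (a * (b - b'))"
    using assms by (simp add: infinitesimal_mult_iff val_ge_diff residue_eq_def)
  moreover have "integral (a - a')" using assms(1) val_gt_imp_ge by (simp add: residue_eq_def)
  then have "infinitesimal ((a - a') * b')"
    using assms by (simp add: infinitesimal_mult_iff residue_eq_def)
  ultimately have "infinitesimal (a * (b - b') + (a - a') * b')" by (rule val_gt_add)
  then show ?thesis by (simp add: residue_eq_def algebra_simps)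
qed

lemma poly_integral: "p \<in> polys_over {x. integral x} \<Longrightarrow> integral x \<Longrightarrow> integral (poly p x)"
  unfolding poly_altdef using coeff_in_polys_over
  by (intro val_ge_sum integral_mult integral_power) blast

lemma synthetic_div_integral:
  "p \<in> polys_over {x. integral x} \<Longrightarrow> integral c \<Longrightarrow> synthetic_div p c \<in> polys_over {x. integral x}"
  by (induction p) (auto simp: pCons_in_polys_over_iff poly_integral)

lemma card_incongruent_roots_le:
  assumes "finite A" "\<And>a. a \<in> A \<Longrightarrow> integral a"
    and incongruent: "\<And>a b. a \<in> A \<Longrightarrow> b \<in> A \<Longrightarrow> a \<approx> b \<Longrightarrow> a = b"
    and "p \<in> polys_over {x. integral x}" "\<not> infinitesimal (lead_coeff p)"
    and "\<And>a. a \<in> A \<Longrightarrow> infinitesimal (poly p a)"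
  shows "card A \<le> degree p"
  using assms
proof (induction "degree p" arbitrary: A p)
  case 0
  then obtain c where "p = [:c:]" by (metis degree_eq_zeroE)
  then have "A = {}" using 0 by auto
  then show ?case by simp
next
  case (Suc n)
  show ?case
  proof (cases "A = {}")
    case False
    then obtain b where b: "b \<in> A" by blast
    define q where "q = synthetic_div p b"
    have p: "p = [:- b, 1:] * q + [:poly p b:]"
      unfolding q_def using synthetic_div_correct' by metis
    have degree_q: "degree q = n"
      unfolding q_def by (simp add: degree_synthetic_div flip: Suc.hyps(2))
    have lead: "lead_coeff q = lead_coeff p"
      unfolding q_def by (rule lead_coeff_synthetic_div) (simp flip: Suc.hyps(2))
    have q_integral: "q \<in> polys_over {x. integral x}"
      unfolding q_def using Suc.prems b synthetic_div_integral by blast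
    have "card (A - {b}) \<le> degree q"
    proof (rule Suc.hyps(1))
      show "infinitesimal (poly q a)" if a: "a \<in> A - {b}" for a
      proof -
        have "poly p a - poly p b = (a - b) * poly q a"
          by (subst p) (simp add: algebra_simps)
        then have "infinitesimal ((a - b) * poly q a)"
          using a b Suc.prems(6) val_gt_diff by (metis DiffD1)
        moreover have "\<not> infinitesimal (a - b)"
          using Suc.prems(3)[of a b] a b by (auto simp: residue_eq_def)
        ultimately show ?thesis
          using Suc.prems(2) a b q_integral
          by (simp add: infinitesimal_mult_iff val_ge_diff poly_integral)
      qed
    qed (use Suc.prems q_integral lead degree_q in auto)
    then show ?thesis using b Suc.prems(1) degree_q by (simp flip: Suc.hyps(2))
  qed simp
qed

end

subsection \<open>Independence of characters modulo the maximal ideal\<close>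

locale integral_characters = valued_field v for v :: "'a::field \<Rightarrow> rat" +
  fixes \<chi> :: "'i \<Rightarrow> 'b::monoid_mult \<Rightarrow> 'a" and T :: "'i set" and U :: "'b set"
  assumes one_in: "1 \<in> U" and mult_in: "x \<in> U \<Longrightarrow> y \<in> U \<Longrightarrow> x * y \<in> U"
    and character_integral: "i \<in> T \<Longrightarrow> x \<in> U \<Longrightarrow> integral (\<chi> i x)"
    and character_mult: "i \<in> T \<Longrightarrow> x \<in> U \<Longrightarrow> y \<in> U \<Longrightarrow> \<chi> i (x * y) = \<chi> i x * \<chi> i y"
    and character_one: "i \<in> T \<Longrightarrow> \<chi> i 1 = 1"
begin

lemma eliminate_character:
  assumes S: "finite S" "S \<subseteq> T" "j \<in> S" and w: "w \<in> U"
    and relation: "\<And>x. x \<in> U \<Longrightarrow> infinitesimal (\<Sum>i\<in>S. a i * \<chi> i x)" and x: "x \<in> U"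
  shows "infinitesimal (\<Sum>i\<in>S - {j}. a i * (\<chi> i w - \<chi> j w) * \<chi> i x)"
proof -
  have "integral (\<chi> j w)" using S w character_integral by blast
  moreover have "integral (\<Sum>i\<in>S. a i * \<chi> i x)" using relation[OF x] by (rule val_gt_imp_ge)
  ultimately have "infinitesimal (\<chi> j w * (\<Sum>i\<in>S. a i * \<chi> i x))"
    using relation[OF x] by (simp add: infinitesimal_mult_iff)
  then have "infinitesimal ((\<Sum>i\<in>S. a i * \<chi> i (w * x)) - \<chi> j w * (\<Sum>i\<in>S. a i * \<chi> i x))"
    using relation[OF mult_in[OF w x]] val_gt_diff by blast
  also have "(\<Sum>i\<in>S. a i * \<chi> i (w * x)) - \<chi> j w * (\<Sum>i\<in>S. a i * \<chi> i x)
      = (\<Sum>i\<in>S. a i * (\<chi> i w - \<chi> j w) * \<chi> i x)"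
    unfolding sum_distrib_left sum_subtractf[symmetric]
    using S(2) w x by (intro sum.cong refl) (auto simp: character_mult algebra_simps)
  also have "\<dots> = (\<Sum>i\<in>S - {j}. a i * (\<chi> i w - \<chi> j w) * \<chi> i x)"
    using S(1,3) by (simp add: sum.remove[of S j])
  finally show ?thesis .
qed

lemma infinitesimal_sum_cancel:
  assumes "\<And>i. i \<in> A \<Longrightarrow> integral (a i)" "\<And>i. i \<in> A \<Longrightarrow> f i \<approx> z" "integral (z - y)" "\<not> z \<approx> y"
    and sum: "infinitesimal (\<Sum>i\<in>A. a i * (f i - y))"
  shows "infinitesimal (\<Sum>i\<in>A. a i)"
proof -
  have "infinitesimal (\<Sum>i\<in>A. a i * (f i - z))"
    using assms(1,2) val_gt_imp_ge unfolding residue_eq_def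
    by (intro val_gt_sum) (simp add: infinitesimal_mult_iff)
  with sum have "infinitesimal ((\<Sum>i\<in>A. a i * (f i - y)) - (\<Sum>i\<in>A. a i * (f i - z)))"
    by (rule val_gt_diff)
  moreover have "(\<Sum>i\<in>A. a i * (f i - y)) - (\<Sum>i\<in>A. a i * (f i - z)) = (\<Sum>i\<in>A. a i) * (z - y)"
    unfolding sum_distrib_right sum_subtractf[symmetric] by (simp add: algebra_simps)
  ultimately show ?thesis
    using assms(1,3,4) val_ge_sum[of A a 0] by (simp add: infinitesimal_mult_iff residue_eq_def)
qed

text \<open>Dedekind's argument, applied to one class of congruent characters at a time: eliminating a
  character outside the class of \<open>t\<close> multiplies the coefficients in this class by one and the same
  unit modulo the maximal ideal.\<close>

lemma infinitesimal_coefficient_sum: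
  assumes "finite S" "S \<subseteq> T" "t \<in> S" and "\<And>i. i \<in> S \<Longrightarrow> integral (a i)"
    and "\<And>x. x \<in> U \<Longrightarrow> infinitesimal (\<Sum>i\<in>S. a i * \<chi> i x)"
  shows "infinitesimal (\<Sum>i | i \<in> S \<and> (\<forall>x\<in>U. \<chi> i x \<approx> \<chi> t x). a i)"
  using assms
proof (induction "card S" arbitrary: S a)
  case 0
  then show ?case by simp
next
  case (Suc n)
  let ?class = "\<lambda>S. {i \<in> S. \<forall>x\<in>U. \<chi> i x \<approx> \<chi> t x}"
  show ?case
  proof (cases "?class S = S")
    case True
    have "(\<Sum>i\<in>S. a i * \<chi> i 1) = (\<Sum>i\<in>S. a i)"
      using Suc.prems(2) character_one by (intro sum.cong) auto
    then show ?thesis unfolding True using Suc.prems(5)[OF one_in] by simp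
  next
    case False
    then obtain j w where j: "j \<in> S" "w \<in> U" and incongruent: "\<not> \<chi> j w \<approx> \<chi> t w" by blast
    have "t \<noteq> j" using incongruent by auto
    have integral_diff: "integral (\<chi> i w - \<chi> k w)" if "i \<in> S" "k \<in> S" for i k
      using that Suc.prems(2) j(2) character_integral by (intro val_ge_diff) auto
    have "infinitesimal (\<Sum>i\<in>?class (S - {j}). a i * (\<chi> i w - \<chi> j w))"
    proof (rule Suc.hyps(1))
      show "integral (a i * (\<chi> i w - \<chi> j w))" if "i \<in> S - {j}" for i
        using that Suc.prems(4) integral_diff j(1) by (intro integral_mult) auto
      show "infinitesimal (\<Sum>i\<in>S - {j}. a i * (\<chi> i w - \<chi> j w) * \<chi> i x)" if "x \<in> U" for x
        using eliminate_character[OF Suc.prems(1,2) j Suc.prems(5) that] .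
    qed (use Suc \<open>t \<noteq> j\<close> j(1) in auto)
    moreover have "?class (S - {j}) = ?class S" using j(2) incongruent by auto
    ultimately have "infinitesimal (\<Sum>i\<in>?class S. a i * (\<chi> i w - \<chi> j w))" by simp
    moreover have "\<not> \<chi> t w \<approx> \<chi> j w" using incongruent residue_eq_sym by blast
    ultimately show ?thesis
      using Suc.prems(4) integral_diff[OF Suc.prems(3) j(1)] j(2)
      by (intro infinitesimal_sum_cancel[of _ a "\<lambda>i. \<chi> i w" "\<chi> t w" "\<chi> j w"]) auto
  qed
qed

end

subsection \<open>Finite-dimensional spaces over a complete field\<close>

definition val_lim :: "('a::field \<Rightarrow> rat) \<Rightarrow> (nat \<Rightarrow> 'a) \<Rightarrow> 'a \<Rightarrow> bool" where
  "val_lim v Y x \<longleftrightarrow> (\<forall>d. \<forall>\<^sub>F n in sequentially. val_ge v (Y n - x) d)"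

definition val_Cauchy :: "('a::field \<Rightarrow> rat) \<Rightarrow> (nat \<Rightarrow> 'a) \<Rightarrow> bool" where
  "val_Cauchy v Y \<longleftrightarrow>
     (\<forall>d. \<forall>\<^sub>F (m, n) in sequentially \<times>\<^sub>F sequentially. val_ge v (Y m - Y n) d)"

definition val_complete :: "('a::field \<Rightarrow> rat) \<Rightarrow> 'a set \<Rightarrow> bool" where
  "val_complete v V \<longleftrightarrow>
     (\<forall>Y. (\<forall>n. Y n \<in> V) \<longrightarrow> val_Cauchy v Y \<longrightarrow> (\<exists>x\<in>V. val_lim v Y x))"

lemma val_completeD:
  assumes "val_complete v V" "\<And>n. Y n \<in> V" "val_Cauchy v Y"
  obtains x where "x \<in> V" "val_lim v Y x"
  using assms unfolding val_complete_def by blast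

context valued_field
begin

lemma val_lim_unique: assumes "val_lim v Y x" "val_lim v Y y" shows "x = y"
proof (rule ccontr)
  assume "x \<noteq> y"
  have "\<forall>\<^sub>F n in sequentially. val_ge v (x - y) (v (x - y) + 1)"
    using assms[unfolded val_lim_def, rule_format, of "v (x - y) + 1"]
    by eventually_elim (meson val_ge_diff_trans val_ge_minus_commute)
  then show False using \<open>x \<noteq> y\<close> by (simp add: val_ge_def)
qed

lemma val_lim_add:
  assumes "val_lim v W x" "val_lim v Y y" shows "val_lim v (\<lambda>n. W n + Y n) (x + y)"
  unfolding val_lim_def
proof
  fix d
  show "\<forall>\<^sub>F n in sequentially. val_ge v (W n + Y n - (x + y)) d"
    using assms[unfolded val_lim_def, rule_format, of d]
    by eventually_elim (metis add_diff_add val_ge_add)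
qed

lemma val_lim_mult_right:
  assumes "val_lim v W x" shows "val_lim v (\<lambda>n. W n * b) (x * b)"
  unfolding val_lim_def
proof
  fix d
  show "\<forall>\<^sub>F n in sequentially. val_ge v (W n * b - x * b) d"
  proof (cases "b = 0")
    case False
    from assms[unfolded val_lim_def, rule_format, of "d - v b"] show ?thesis
      by eventually_elim (simp add: val_ge_mult_unit[OF False] mult.commute[of _ b]
          flip: right_diff_distrib)
  qed simp
qed

lemma val_lim_imp_Cauchy:
  assumes "val_lim v Y x" shows "val_Cauchy v Y"
  unfolding val_Cauchy_def eventually_prod_sequentially split_conv
proof
  fix d
  obtain N where N: "\<And>n. n \<ge> N \<Longrightarrow> val_ge v (Y n - x) d"
    using assms unfolding val_lim_def eventually_sequentially by blast
  then have "val_ge v (Y m - Y n) d" if "m \<ge> N" "n \<ge> N" for m n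
    using N[OF that(1)] N[OF that(2)] val_ge_diff_trans val_ge_minus_commute by blast
  then show "\<exists>N. \<forall>m\<ge>N. \<forall>n\<ge>N. val_ge v (Y n - Y m) d" by blast
qed

lemma val_Cauchy_diff:
  assumes "val_Cauchy v W" "val_Cauchy v Y" shows "val_Cauchy v (\<lambda>n. W n - Y n)"
  unfolding val_Cauchy_def
proof
  fix d
  have regroup: "W m - Y m - (W n - Y n) = (W m - W n) - (Y m - Y n)" for m n
    by (simp add: algebra_simps)
  show "\<forall>\<^sub>F (m, n) in sequentially \<times>\<^sub>F sequentially. val_ge v (W m - Y m - (W n - Y n)) d"
    using assms[unfolded val_Cauchy_def, rule_format, of d]
    by eventually_elim (clarsimp simp: regroup val_ge_diff)
qed

lemma val_Cauchy_mult_right: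
  assumes "val_Cauchy v W" shows "val_Cauchy v (\<lambda>n. W n * b)"
  unfolding val_Cauchy_def
proof
  fix d
  show "\<forall>\<^sub>F (m, n) in sequentially \<times>\<^sub>F sequentially. val_ge v (W m * b - W n * b) d"
  proof (cases "b = 0")
    case False
    from assms[unfolded val_Cauchy_def, rule_format, of "d - v b"] show ?thesis
      by eventually_elim (auto simp: val_ge_mult_unit[OF False] mult.commute[of _ b]
          simp flip: right_diff_distrib)
  qed (simp add: case_prod_unfold)
qed

lemma bounded_distance_to_complete:
  assumes "val_complete v V" "b \<notin> V"
  obtains D where "\<And>y. y \<in> V \<Longrightarrow> \<not> val_ge v (b - y) D"
proof -
  have "\<exists>D. \<forall>y\<in>V. \<not> val_ge v (b - y) D"
  proof (rule ccontr)
    assume "\<nexists>D. \<forall>y\<in>V. \<not> val_ge v (b - y) D"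
    then have "\<forall>n::nat. \<exists>y\<in>V. val_ge v (b - y) (of_nat n)" by blast
    then obtain Y where Y: "\<And>n::nat. Y n \<in> V" "\<And>n. val_ge v (b - Y n) (of_nat n)" by metis
    have lim: "val_lim v Y b"
      unfolding val_lim_def
    proof
      fix d :: rat
      have "val_ge v (Y n - b) d" if "n \<ge> nat \<lceil>d\<rceil>" for n
        unfolding val_ge_minus_commute[of _ b] using that by (intro val_ge_mono[OF Y(2)]) linarith
      then show "\<forall>\<^sub>F n in sequentially. val_ge v (Y n - b) d"
        unfolding eventually_sequentially by blast
    qed
    then obtain y where "y \<in> V" "val_lim v Y y"
      using val_completeD[OF assms(1), of Y] Y(1) val_lim_imp_Cauchy by blast
    then show False using val_lim_unique[OF lim] assms(2) by blast
  qed
  then show ?thesis using that by blast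
qed

end

locale complete_scalars = valued_field v for v :: "'a::field \<Rightarrow> rat" +
  fixes j :: "'q::field \<Rightarrow> 'a"
  assumes embedding: "field_embedding UNIV j" and complete: "val_complete v (range j)"
begin

sublocale j: field_embedding UNIV j by (rule embedding)

sublocale vector_space "\<lambda>k x. j k * x"
  by unfold_locales (simp_all add: j.add j.mult j.one algebra_simps)

lemma coefficient_bounded:
  assumes V: "subspace V" "y \<in> V" and distance: "\<And>z. z \<in> V \<Longrightarrow> \<not> val_ge v (b - z) D"
    and x: "val_ge v (j k * b + y) d"
  shows "val_ge v (j k) (d - D)"
proof (cases "k = 0")
  case False
  then have jk: "j k \<noteq> 0" using j.nonzero by simp
  then have "j k * b + y = j k * (b - j (- inverse k) * y)"
    by (simp add: j.uminus j.inverse algebra_simps)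
  then have "val_ge v (b - j (- inverse k) * y) (d - v (j k))"
    using x val_ge_mult_unit[OF jk] by simp
  moreover have "\<not> val_ge v (b - j (- inverse k) * y) D" using V by (intro distance subspace_scale)
  ultimately have "d - v (j k) < D" using val_ge_mono linorder_not_less by blast
  then show ?thesis by (simp add: val_ge_def)
qed (simp add: j.zero)

lemma val_complete_span_insert:
  assumes V: "val_complete v (span S)" and b: "b \<notin> span S"
  shows "val_complete v (span (insert b S))"
  unfolding val_complete_def
proof (intro allI impI)
  fix Y assume Y: "\<forall>n. Y n \<in> span (insert b S)" and Cauchy: "val_Cauchy v Y"
  obtain D where D: "\<And>z. z \<in> span S \<Longrightarrow> \<not> val_ge v (b - z) D"
    using bounded_distance_to_complete[OF V b] by blast
  obtain k where k: "\<And>n. Y n - j (k n) * b \<in> span S" using Y unfolding span_insert by auto metis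
  define y where "y = (\<lambda>n. Y n - j (k n) * b)"
  have k_Cauchy: "val_Cauchy v (\<lambda>n. j (k n))"
    unfolding val_Cauchy_def
  proof
    fix d
    have decompose: "Y m - Y n = j (k m - k n) * b + (y m - y n)" for m n
      by (simp add: y_def j.diff algebra_simps)
    have in_span: "y m - y n \<in> span S" for m n unfolding y_def by (intro span_diff k)
    have coeff: "val_ge v (j (k m - k n)) d" if "val_ge v (Y m - Y n) (d + D)" for m n
      using coefficient_bounded[OF subspace_span in_span D, where d = "d + D"] that
      unfolding decompose by simp
    from Cauchy[unfolded val_Cauchy_def, rule_format, of "d + D"]
    show "\<forall>\<^sub>F (m, n) in sequentially \<times>\<^sub>F sequentially. val_ge v (j (k m) - j (k n)) d"
      by eventually_elim (auto dest: coeff simp: j.diff)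
  qed
  then obtain l where "val_lim v (\<lambda>n. j (k n)) (j l)"
    using val_completeD[OF complete, of "\<lambda>n. j (k n)"] by blast
  moreover obtain z where z: "z \<in> span S" "val_lim v y z"
  proof (rule val_completeD[OF V])
    show "val_Cauchy v y"
      unfolding y_def by (intro val_Cauchy_diff val_Cauchy_mult_right Cauchy k_Cauchy)
  qed (simp_all add: y_def k)
  ultimately have "val_lim v (\<lambda>n. j (k n) * b + y n) (j l * b + z)"
    by (intro val_lim_add val_lim_mult_right)
  moreover have "j l * b + z \<in> span (insert b S)"
    using z(1) by (auto simp: span_insert intro!: exI[of _ l])
  ultimately show "\<exists>x\<in>span (insert b S). val_lim v Y x" by (auto simp: y_def)
qed

lemma val_complete_span: "finite S \<Longrightarrow> val_complete v (span S)"
proof (induction S rule: finite_induct)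
  case empty
  show ?case by (simp add: val_complete_def val_lim_def)
next
  case (insert b S)
  then show ?case
    using val_complete_span_insert by (cases "b \<in> span S") (simp_all add: span_redundant)
qed

lemma linear_map_bounded_insert:
  assumes V: "subspace V" "y \<in> V" and distance: "\<And>z. z \<in> V \<Longrightarrow> \<not> val_ge v (b - z) D"
    and bound: "\<And>z d. z \<in> V \<Longrightarrow> val_ge v z d \<Longrightarrow> val_ge v (\<phi> z) (d - C)"
    and x: "val_ge v (j k * b + y) d"
  shows "val_ge v (j k * c + \<phi> y) (d - max (D - v c) (max 0 (D - v b) + C))"
proof (rule val_ge_add)
  define E where "E = max 0 (D - v b)"
  have coeff: "val_ge v (j k) (d - D)" using coefficient_bounded[OF V distance x] .
  show "val_ge v (j k * c) (d - max (D - v c) (max 0 (D - v b) + C))"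
    by (rule val_ge_mono[OF val_ge_mult[OF coeff val_ge_self]]) simp
  have "val_ge v (j k * b) (d - E)"
    by (rule val_ge_mono[OF val_ge_mult[OF coeff val_ge_self]]) (simp add: E_def)
  moreover have "val_ge v (j k * b + y) (d - E)" by (rule val_ge_mono[OF x]) (simp add: E_def)
  ultimately have "val_ge v y (d - E)" using val_ge_diff by fastforce
  then have "val_ge v (\<phi> y) (d - E - C)" by (rule bound[OF V(2)])
  then show "val_ge v (\<phi> y) (d - max (D - v c) (max 0 (D - v b) + C))"
    by (rule val_ge_mono) (simp add: E_def)
qed

lemma linear_map_bounded:
  assumes "finite S"
    and "\<And>x y. x \<in> span S \<Longrightarrow> y \<in> span S \<Longrightarrow> \<phi> (x + y) = \<phi> x + \<phi> y"
    and "\<And>k x. x \<in> span S \<Longrightarrow> \<phi> (j k * x) = j k * \<phi> x"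
  shows "\<exists>C. \<forall>x\<in>span S. \<forall>d. val_ge v x d \<longrightarrow> val_ge v (\<phi> x) (d - C)"
  using assms
proof (induction S rule: finite_induct)
  case empty
  have "\<phi> 0 = 0" using empty(2)[of 0 0] by (simp add: j.zero)
  then show ?case by simp
next
  case (insert b S)
  have mono: "x \<in> span (insert b S)" if "x \<in> span S" for x
    using that span_mono[of S "insert b S"] by blast
  obtain C where C: "\<And>x d. x \<in> span S \<Longrightarrow> val_ge v x d \<Longrightarrow> val_ge v (\<phi> x) (d - C)"
    using insert.IH insert.prems mono by meson
  show ?case
  proof (cases "b \<in> span S")
    case True
    then show ?thesis using C by (auto simp: span_redundant)
  next
    case False
    obtain D where D: "\<And>z. z \<in> span S \<Longrightarrow> \<not> val_ge v (b - z) D"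
      using bounded_distance_to_complete[OF val_complete_span[OF insert.hyps(1)] False] by blast
    have "val_ge v (\<phi> x) (d - max (D - v (\<phi> b)) (max 0 (D - v b) + C))"
      if x: "x \<in> span (insert b S)" and d: "val_ge v x d" for x d
    proof -
      obtain k where k: "x - j k * b \<in> span S" using x unfolding span_insert by blast
      define y where "y = x - j k * b"
      have y: "y \<in> span S" "x = j k * b + y" using k by (simp_all add: y_def)
      have "\<phi> x = j k * \<phi> b + \<phi> y"
        using insert.prems y mono span_base[of b "insert b S"] span_scale by simp
      then show ?thesis
        using linear_map_bounded_insert[where \<phi> = \<phi>, OF subspace_span y(1) D C d[unfolded y(2)]]
        by simp
    qed
    then show ?thesis by blast
  qed
qed

text \<open>The values of \<open>\<sigma> x\<close> and \<open>x\<close> differ by a bounded amount, hence not at all: apply this to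
  the powers of \<open>x\<close>.\<close>

lemma embedding_val_ge:
  assumes "finite S" and embedding: "field_embedding (span S) \<sigma>"
    and fixes_scalars: "\<And>k. \<sigma> (j k) = j k"
    and x: "x \<in> span S" "x \<noteq> 0"
  shows "v x \<le> v (\<sigma> x)"
proof -
  interpret \<sigma>: field_embedding "span S" \<sigma> by fact
  have scalars_in: "j k \<in> span S" for k using span_scale[OF \<sigma>.one_in, of k] by simp
  have "\<exists>C. \<forall>y\<in>span S. \<forall>d. val_ge v y d \<longrightarrow> val_ge v (\<sigma> y) (d - C)"
    using assms(1) \<sigma>.add \<sigma>.mult[OF scalars_in] fixes_scalars by (intro linear_map_bounded) simp_all
  then obtain C where C: "\<And>y d. y \<in> span S \<Longrightarrow> val_ge v y d \<Longrightarrow> val_ge v (\<sigma> y) (d - C)" by blast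
  have bound: "of_nat n * v x - C \<le> of_nat n * v (\<sigma> x)" for n
    using C[OF \<sigma>.power_in[OF x(1)] val_ge_self, of n] \<sigma>.nonzero[OF x] x
    by (simp add: \<sigma>.power val_ge_def v_power)
  show ?thesis
  proof (rule ccontr)
    assume "\<not> v x \<le> v (\<sigma> x)"
    then have "v x - v (\<sigma> x) > 0" by simp
    then obtain n where "of_nat n * (v x - v (\<sigma> x)) > C" using ex_less_of_nat_mult by blast
    with bound[of n] show False by (simp add: algebra_simps)
  qed
qed

end

subsection \<open>Isometric automorphisms and inertia\<close>

locale valued_automorphism_group = valued_field v + automorphism_group L G
  for v :: "'a::field \<Rightarrow> rat" and L :: "'a set" and G (structure) +
  assumes finite_carrier: "finite (carrier G)"
    and v_apply: "\<sigma> \<in> carrier G \<Longrightarrow> x \<in> L \<Longrightarrow> x \<noteq> 0 \<Longrightarrow> v (\<sigma> x) = v x"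
begin

lemma apply_nonzero: "\<sigma> \<in> carrier G \<Longrightarrow> x \<in> L \<Longrightarrow> x \<noteq> 0 \<Longrightarrow> \<sigma> x \<noteq> 0"
  using field_embedding.nonzero[OF field_embedding] .

lemma val_apply_iff:
  assumes "\<sigma> \<in> carrier G" "x \<in> L"
  shows "val_ge v (\<sigma> x) d \<longleftrightarrow> val_ge v x d" "val_gt v (\<sigma> x) d \<longleftrightarrow> val_gt v x d"
  using v_apply[OF assms] apply_nonzero[OF assms]
    field_embedding.zero[OF field_embedding[OF assms(1)]]
  unfolding val_ge_def val_gt_def by (cases "x = 0"; simp)+

lemma quotient_integral:
  "\<sigma> \<in> carrier G \<Longrightarrow> x \<in> L \<Longrightarrow> x \<noteq> 0 \<Longrightarrow> integral (\<sigma> x / x)"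
  by (simp add: v_apply apply_nonzero v_divide val_ge_def)

definition inertia :: "('a \<Rightarrow> 'a) set" where
  "inertia = {\<sigma> \<in> carrier G. \<forall>x\<in>L. integral x \<longrightarrow> infinitesimal (\<sigma> x - x)}"

lemma inertia_carrier: "\<sigma> \<in> inertia \<Longrightarrow> \<sigma> \<in> carrier G"
  by (simp add: inertia_def)

lemma subgroup_inertia: "subgroup inertia G"
proof (rule subgroupI)
  show "inertia \<subseteq> carrier G" using inertia_carrier by blast
  have "\<one> \<in> inertia" by (simp add: inertia_def apply_one)
  then show "inertia \<noteq> {}" by blast
  fix \<sigma> assume \<sigma>: "\<sigma> \<in> inertia"
  then have \<sigma>_in: "\<sigma> \<in> carrier G" by (rule inertia_carrier)
  have "infinitesimal ((inv \<sigma>) x - x)" if x: "x \<in> L" "integral x" for x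
  proof -
    let ?y = "(inv \<sigma>) x"
    have "?y \<in> L" "integral ?y"
      using \<sigma>_in x apply_in[of "inv \<sigma>" x] val_apply_iff(1)[of "inv \<sigma>" x] by auto
    then have "infinitesimal (\<sigma> ?y - ?y)" using \<sigma> unfolding inertia_def by blast
    then show ?thesis using apply_inv(2)[OF \<sigma>_in x(1)] val_gt_minus_commute by simp
  qed
  then show "inv \<sigma> \<in> inertia" using \<sigma>_in by (simp add: inertia_def)
  fix \<tau> assume \<tau>: "\<tau> \<in> inertia"
  then have \<tau>_in: "\<tau> \<in> carrier G" by (rule inertia_carrier)
  have "infinitesimal ((\<sigma> \<otimes> \<tau>) x - x)" if x: "x \<in> L" "integral x" for x
  proof -
    have "\<tau> x \<in> L" "integral (\<tau> x)" using \<tau>_in x apply_in[of \<tau> x] val_apply_iff(1)[of \<tau> x] by auto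
    then have "infinitesimal (\<sigma> (\<tau> x) - \<tau> x)" using \<sigma> unfolding inertia_def by blast
    moreover have "infinitesimal (\<tau> x - x)" using \<tau> x unfolding inertia_def by blast
    ultimately show ?thesis using val_gt_diff_trans apply_mult[OF x(1) \<sigma>_in \<tau>_in] by simp
  qed
  then show "\<sigma> \<otimes> \<tau> \<in> inertia" using \<sigma>_in \<tau>_in by (simp add: inertia_def)
qed

lemma exists_unit_trace:
  assumes tame: "\<not> infinitesimal (of_nat (card inertia))"
    and fixed: "x \<in> fixed_field inertia" "x \<noteq> 0"
  obtains u where "u \<in> L" "integral u" "\<not> infinitesimal (\<Sum>\<sigma>\<in>carrier G. \<sigma> x / x * \<sigma> u)"
proof -
  have x: "x \<in> L" using fixed(1) by (rule fixed_fieldD)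
  let ?U = "{u \<in> L. integral u}"
  interpret integral_characters v "\<lambda>\<sigma>. \<sigma>" "carrier G" ?U
  proof
    show "\<sigma> (u * u') = \<sigma> u * \<sigma> u'" if "\<sigma> \<in> carrier G" "u \<in> ?U" "u' \<in> ?U" for \<sigma> u u'
      using that field_embedding.mult[OF field_embedding] by blast
    show "\<sigma> 1 = 1" if "\<sigma> \<in> carrier G" for \<sigma> using field_embedding.one[OF field_embedding[OF that]] .
  qed (auto simp: one_in mult_in integral_mult val_apply_iff)
  have "\<exists>u\<in>?U. \<not> infinitesimal (\<Sum>\<sigma>\<in>carrier G. \<sigma> x / x * \<sigma> u)"
  proof (rule ccontr)
    assume "\<not> (\<exists>u\<in>?U. \<not> infinitesimal (\<Sum>\<sigma>\<in>carrier G. \<sigma> x / x * \<sigma> u))"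
    then have "infinitesimal (\<Sum>\<sigma> | \<sigma> \<in> carrier G \<and> (\<forall>u\<in>?U. \<sigma> u \<approx> \<one> u). \<sigma> x / x)"
      using x fixed(2)
      by (intro infinitesimal_coefficient_sum finite_carrier quotient_integral) auto
    also have "{\<sigma> \<in> carrier G. \<forall>u\<in>?U. \<sigma> u \<approx> \<one> u} = inertia"
      by (auto simp: inertia_def residue_eq_def apply_one)
    also have "(\<Sum>\<sigma>\<in>inertia. \<sigma> x / x) = (\<Sum>\<sigma>\<in>inertia. 1)"
      using fixed_fieldD(2)[OF fixed(1)] fixed(2) by (intro sum.cong) simp_all
    also have "\<dots> = of_nat (card inertia)" by simp
    finally show False using tame by simp
  qed
  then show ?thesis using that by blast
qed

lemma inertia_fixed_value:
  assumes tame: "\<not> infinitesimal (of_nat (card inertia))"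
    and fixed: "x \<in> fixed_field inertia" "x \<noteq> 0"
  obtains y where "y \<in> fixed_field (carrier G)" "y \<noteq> 0" "v y = v x"
proof -
  have x: "x \<in> L" using fixed(1) by (rule fixed_fieldD)
  obtain u where u: "u \<in> L" "integral u"
    and unit: "\<not> infinitesimal (\<Sum>\<sigma>\<in>carrier G. \<sigma> x / x * \<sigma> u)"
    using exists_unit_trace[OF assms] .
  define s where "s = (\<Sum>\<sigma>\<in>carrier G. \<sigma> x / x * \<sigma> u)"
  have "integral s"
    unfolding s_def using u x fixed(2)
    by (intro val_ge_sum integral_mult quotient_integral) (simp_all add: val_apply_iff)
  then have s: "s \<noteq> 0" "v s = 0" using v_eq_0_if_unit unit unfolding s_def by blast+
  have "x * s = (\<Sum>\<sigma>\<in>carrier G. \<sigma> (x * u))"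
    unfolding s_def sum_distrib_left using x u fixed(2)
    by (intro sum.cong) (auto simp: field_embedding.mult[OF field_embedding])
  then have "x * s \<in> fixed_field (carrier G)"
    using trace_in_fixed_field[OF subgroup_self mult_in[OF x u(1)]] by simp
  then show ?thesis using that[of "x * s"] fixed(2) s by (simp add: v_mult)
qed

end

subsection \<open>Local fields\<close>

lemma val_complete_Qp:
  assumes "is_Qp p w" shows "val_complete w UNIV"
  unfolding val_complete_def val_lim_def eventually_sequentially
proof (intro allI impI)
  fix Y assume "val_Cauchy w Y"
  then have "\<forall>d. \<exists>N. \<forall>m\<ge>N. \<forall>n\<ge>N. val_ge w (Y m - Y n) d"
    unfolding val_Cauchy_def eventually_prod_sequentially split_conv by meson
  with assms show "\<exists>x\<in>UNIV. \<forall>d. \<exists>N. \<forall>n\<ge>N. val_ge w (Y n - x) d"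
    unfolding is_Qp_def by simp
qed

lemma val_complete_range_embedding:
  assumes "field_embedding UNIV j" and c: "c > 0" and v_j: "\<And>x. x \<noteq> 0 \<Longrightarrow> v (j x) = c * w x"
    and complete: "val_complete w UNIV"
  shows "val_complete v (range j)"
  unfolding val_complete_def
proof (intro allI impI)
  interpret j: field_embedding UNIV j by fact
  have val_ge_j: "val_ge v (j x - j y) d \<longleftrightarrow> val_ge w (x - y) (d / c)" for x y d
    using c v_j[of "x - y"] j.diff[of x y] j.zero j.nonzero[of "x - y"]
    unfolding val_ge_def by (cases "x = y") (simp_all add: pos_divide_le_eq mult.commute)
  fix Y assume range: "\<forall>n. Y n \<in> range j" and Cauchy: "val_Cauchy v Y"
  define y where "y = (\<lambda>n. inv_into UNIV j (Y n))"
  have y: "Y = (\<lambda>n. j (y n))" using range by (simp add: y_def f_inv_into_f)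
  have "val_Cauchy w y"
    unfolding val_Cauchy_def
  proof
    fix d
    have "d * c / c = d" using c by simp
    with Cauchy[unfolded val_Cauchy_def y val_ge_j, rule_format, of "d * c"]
    show "\<forall>\<^sub>F (m, n) in sequentially \<times>\<^sub>F sequentially. val_ge w (y m - y n) d" by simp
  qed
  then obtain x where "val_lim w y x" using val_completeD[OF complete, of y] by blast
  then have "val_lim v Y (j x)" by (simp add: val_lim_def y val_ge_j)
  then show "\<exists>x\<in>range j. val_lim v Y x" by blast
qed

lemma field_embedding_to_ac: "field_embedding UNIV to_ac"
  by (intro field_embedding.intro type_subfieldI field_embedding_axioms.intro) simp_all

lemma polys_over_map_poly_to_ac: "map_poly to_ac p \<in> polys_over (range to_ac)"
  by (simp add: polys_over_def coeff_map_poly)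

lemma algebraic_base_range_to_ac: "algebraic_base (range (to_ac :: 'k::field_char_0 \<Rightarrow> _))"
proof (intro algebraic_base.intro algebraic_base_axioms.intro)
  show "type_subfield (range (to_ac :: 'k \<Rightarrow> _))"
    using field_embedding.type_subfield_image[OF field_embedding_to_ac] .
  fix x :: "'k alg_closure"
  obtain p :: "'k poly" where "p \<noteq> 0" "poly (map_poly to_ac p) x = 0"
    by (rule alg_closure_algebraic)
  then show "\<exists>p\<in>polys_over (range to_ac). p \<noteq> 0 \<and> poly p x = 0"
    using polys_over_map_poly_to_ac
    by (intro bexI[of _ "map_poly to_ac p"]) (simp_all add: map_poly_eq_0_iff)
qed

lemma splitting_field_root_field:
  fixes f :: "'k::field_char_0 poly"
  assumes "f \<noteq> 0"
  shows "splitting_field (range to_ac) (root_field f) (map_poly to_ac f)"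
proof (intro splitting_field.intro splitting_field_axioms.intro)
  show "type_subfield (root_field f)"
    unfolding root_field_def by (rule type_subfield_generate_field)
  show "range to_ac \<subseteq> root_field f" "{x. poly (map_poly to_ac f) x = 0} \<subseteq> root_field f"
    unfolding root_field_def ac_roots_def by (auto intro: generate_field.incl)
  show "root_field f \<subseteq> E"
    if "type_subfield E" "range to_ac \<subseteq> E" "{x. poly (map_poly to_ac f) x = 0} \<subseteq> E" for E
    using that unfolding root_field_def ac_roots_def by (intro generate_field_least) simp_all
qed (use assms in \<open>simp_all add: algebraic_base_range_to_ac polys_over_map_poly_to_ac
  map_poly_eq_0_iff\<close>)

locale local_field =
  fixes p :: nat and w :: "'q::field_char_0 \<Rightarrow> rat" and \<iota> :: "'q \<Rightarrow> 'k::field_char_0"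
    and v :: "'k alg_closure \<Rightarrow> rat" and f :: "'k poly"
  assumes prime: "prime p" and Qp: "is_Qp p w" and finite_extension: "finite_field_extension \<iota>"
    and normalised: "normalised_valuation w \<iota> v" and nonzero: "f \<noteq> 0"
begin

abbreviation K :: "'k alg_closure set" where "K \<equiv> range to_ac"
abbreviation L :: "'k alg_closure set" where "L \<equiv> root_field f"

sublocale splitting_field K L "map_poly to_ac f"
  using nonzero by (rule splitting_field_root_field)

lemma field_embedding_\<iota>: "field_embedding UNIV \<iota>"
proof -
  have "\<iota> \<in> ring_hom ring_of_type_algebra ring_of_type_algebra"
    using finite_extension unfolding finite_field_extension_def by blast
  from ring_hom_add[OF this] ring_hom_mult[OF this] ring_hom_one[OF this] show ?thesis
    by (intro field_embedding.intro type_subfieldI field_embedding_axioms.intro)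
      (simp_all add: ring_of_type_algebra_def)
qed

lemma valuation_scale: "\<exists>c>0. \<forall>x. x \<noteq> 0 \<longrightarrow> v (to_ac (\<iota> x)) = c * w x"
  using normalised unfolding normalised_valuation_def by blast

sublocale complete_scalars v "\<lambda>x. to_ac (\<iota> x)"
proof (intro complete_scalars.intro complete_scalars_axioms.intro)
  show "valued_field v" using normalised unfolding normalised_valuation_def by unfold_locales blast
  interpret \<iota>: field_embedding UNIV \<iota> by (rule field_embedding_\<iota>)
  show embedding: "field_embedding UNIV (\<lambda>x. to_ac (\<iota> x))"
    by unfold_locales (simp_all add: \<iota>.add \<iota>.mult \<iota>.one)
  obtain c where "c > 0" "\<And>x. x \<noteq> 0 \<Longrightarrow> v (to_ac (\<iota> x)) = c * w x" using valuation_scale by blast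
  then show "val_complete v (range (\<lambda>x. to_ac (\<iota> x)))"
    using val_complete_range_embedding[OF embedding] val_complete_Qp[OF Qp] by blast
qed

lemma v_base_eq_Ints: "v ` (K - {0}) = \<int>"
proof -
  have "K - {0} = to_ac ` (UNIV - {0})" by auto
  then show ?thesis using normalised by (simp add: normalised_valuation_def image_image)
qed

lemma of_nat_unit:
  assumes "\<not> p dvd n" shows "\<not> infinitesimal (of_nat n)"
proof -
  interpret \<iota>: field_embedding UNIV \<iota> by (rule field_embedding_\<iota>)
  obtain c where c: "\<And>x. x \<noteq> 0 \<Longrightarrow> v (to_ac (\<iota> x)) = c * w x" using valuation_scale by blast
  have "n \<noteq> 0" using assms by (intro notI) simp
  then have "v (of_nat n) = c * w (of_rat (of_nat n))"
    using c[of "of_nat n"] by (simp add: \<iota>.of_nat)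
  also have "w (of_rat (of_nat n)) = of_int (padic_val_rat p (of_nat n))"
    using Qp \<open>n \<noteq> 0\<close> unfolding is_Qp_def by (metis of_nat_eq_0_iff)
  also have "quotient_of (of_nat n) = (int n, 1)" using quotient_of_int[of "int n"] by simp
  then have "padic_val_rat p (of_nat n) = 0"
    unfolding padic_val_rat_def using assms prime
    by (simp add: not_dvd_imp_multiplicity_0 multiplicity_one)
  finally show ?thesis using \<open>n \<noteq> 0\<close> by (simp add: val_gt_def)
qed

lemma root_field_finite_dimensional: obtains S where "finite S" "L = span S"
proof -
  obtain B where B: "finite B" "\<And>k. \<exists>a. k = (\<Sum>b\<in>B. \<iota> (a b) * b)"
    using finite_extension unfolding finite_field_extension_def by blast
  obtain t where t: "t \<in> L" "L = adjoin t" by (rule primitive_generator)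
  obtain m where m: "is_minpoly m t" by (rule is_minpoly_exists)
  define S where "S = (\<lambda>(b, i). to_ac b * t ^ i) ` (B \<times> {..<degree m})"
  have monomial: "to_ac k * t ^ i \<in> span S" if "i < degree m" for k i
  proof -
    obtain a where "k = (\<Sum>b\<in>B. \<iota> (a b) * b)" using B(2) by blast
    then have "to_ac k * t ^ i = (\<Sum>b\<in>B. to_ac (\<iota> (a b)) * (to_ac b * t ^ i))"
      by (simp add: to_ac_sum sum_distrib_right mult.assoc)
    also have "\<dots> \<in> span S" using that unfolding S_def by (intro span_sum span_scale span_base) auto
    finally show ?thesis .
  qed
  have "L \<subseteq> span S"
  proof
    fix x assume "x \<in> L"
    then obtain q where q: "q \<in> polys_over K" "degree q < degree m" "x = poly q t"
      using adjoinE_degree_less[OF m] t(2) by blast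
    have "coeff q i * t ^ i \<in> span S" if "i \<le> degree q" for i
      using coeff_in_polys_over[OF q(1), of i] monomial that q(2) by auto
    then show "x \<in> span S" unfolding q(3) poly_altdef by (intro span_sum) simp
  qed
  moreover have "span S \<subseteq> L"
    using base_subset t(1)
    by (intro span_minimal subspaceI) (auto simp: S_def intro!: L.closed)
  moreover have "finite S" unfolding S_def using B(1) by blast
  ultimately show ?thesis by (intro that[of S]) simp_all
qed

lemma v_galois_ge:
  assumes "\<sigma> \<in> carrier (galois_group K L)" "x \<in> L" "x \<noteq> 0"
  shows "v x \<le> v (\<sigma> x)"
proof -
  obtain S where S: "finite S" "L = span S" by (rule root_field_finite_dimensional)
  show ?thesis
    using galois.field_embedding[OF assms(1)] galois_fixes_base[OF assms(1)] assms(2,3) S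
    by (intro embedding_val_ge) simp_all
qed

sublocale galois: valued_automorphism_group v L "galois_group K L"
proof (intro valued_automorphism_group.intro valued_automorphism_group_axioms.intro)
  fix \<sigma> x assume \<sigma>: "\<sigma> \<in> carrier (galois_group K L)" and x: "x \<in> L" "x \<noteq> 0"
  have "\<sigma> x \<in> L" "\<sigma> x \<noteq> 0"
    using galois.apply_in[OF \<sigma> x(1)] field_embedding.nonzero[OF galois.field_embedding[OF \<sigma>]] x
    by auto
  then have "v (\<sigma> x) \<le> v ((inv\<^bsub>galois_group K L\<^esub> \<sigma>) (\<sigma> x))" using \<sigma> by (intro v_galois_ge) auto
  then show "v (\<sigma> x) = v x" using v_galois_ge[OF \<sigma> x] galois.apply_inv(1)[OF \<sigma> x(1)] by simp
qed (rule valued_field_axioms galois.automorphism_group_axioms finite_galois_group)+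

lemma carrier_inertia_group: "carrier (inertia_group v K L) = galois.inertia"
  unfolding inertia_group_def galois.inertia_def by simp

lemma inertia_group_eq: "inertia_group v K L = galois_group K L\<lparr>carrier := galois.inertia\<rparr>"
  unfolding inertia_group_def galois.inertia_def ..

lemma inertia_fixed_values:
  assumes tame: "\<not> p dvd card galois.inertia"
  shows "v ` (galois.fixed_field galois.inertia - {0}) = \<int>"
proof
  have "K \<subseteq> galois.fixed_field galois.inertia"
    using galois_fixed_field galois.inertia_carrier unfolding galois.fixed_field_def by blast
  then show "\<int> \<subseteq> v ` (galois.fixed_field galois.inertia - {0})"
    unfolding v_base_eq_Ints[symmetric] by blast
  show "v ` (galois.fixed_field galois.inertia - {0}) \<subseteq> \<int>"
  proof (rule image_subsetI)
    fix x assume "x \<in> galois.fixed_field galois.inertia - {0}"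
    then obtain y where "y \<in> K" "y \<noteq> 0" "v y = v x"
      using galois.inertia_fixed_value[OF of_nat_unit[OF tame], of x] galois_fixed_field by auto
    then show "v x \<in> \<int>" using v_base_eq_Ints by (metis DiffI imageI singletonD)
  qed
qed

end

subsection \<open>The tame character\<close>

locale tame_inertia = valued_automorphism_group v L I
  for v :: "'a::field \<Rightarrow> rat" and L :: "'a set" and I (structure) +
  assumes inertia_eq_carrier: "inertia = carrier I"
    and tame: "\<not> infinitesimal (of_nat (card (carrier I)))"
    and fixed_values: "v ` (fixed_field (carrier I) - {0}) = \<int>"
begin

abbreviation e :: nat where "e \<equiv> card (carrier I)"

lemma card_rcosets_mult: "subgroup H I \<Longrightarrow> card (rcosets H) * card H = e"
  using lagrange unfolding Coset.order_def by blast

lemma e_pos: "e > 0"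
  using finite_carrier one_closed by (auto simp: card_gt_0_iff)

lemma card_subgroup_pos: "subgroup H I \<Longrightarrow> card H > 0"
  using card_rcosets_mult e_pos by (metis mult_0_right not_gr_zero)

lemma card_rcosets_pos: "subgroup H I \<Longrightarrow> card (rcosets H) > 0"
  using card_rcosets_mult e_pos by (metis mult_0 not_gr_zero)

lemma card_subgroup_dvd:
  assumes "subgroup H I" "subgroup H' I" "H' \<subseteq> H" shows "card H' dvd card H"
proof -
  interpret H: group "I\<lparr>carrier := H\<rparr>" using subgroup_imp_group[OF assms(1)] .
  have "card (rcosets\<^bsub>I\<lparr>carrier := H\<rparr>\<^esub> H') * card H' = card H"
    using H.lagrange[OF subgroup_incl[OF assms(2,1,3)]] by (simp add: Coset.order_def)
  then show ?thesis by (metis dvd_triv_right)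
qed

lemma tame_subgroup:
  assumes "subgroup H I"
  shows "of_nat (card H) \<noteq> (0::'a)" "v (of_nat (card H)) = 0"
proof -
  have "(of_nat e :: 'a) = of_nat (card (rcosets H)) * of_nat (card H)"
    using card_rcosets_mult[OF assms] by (metis of_nat_mult)
  then have "\<not> infinitesimal (of_nat (card H))"
    using tame by (simp add: infinitesimal_mult_iff integral_of_nat)
  then show "of_nat (card H) \<noteq> (0::'a)" "v (of_nat (card H)) = 0"
    using v_eq_0_if_unit integral_of_nat by blast+
qed

lemma infinitesimal_displacement:
  "\<sigma> \<in> carrier I \<Longrightarrow> x \<in> L \<Longrightarrow> integral x \<Longrightarrow> infinitesimal (\<sigma> x - x)"
  using inertia_eq_carrier unfolding inertia_def by blast

lemma fixed_centre:
  assumes H: "subgroup H I" and x: "x \<in> L" and close: "\<And>\<sigma>. \<sigma> \<in> H \<Longrightarrow> val_ge v (\<sigma> x - x) d"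
  obtains z where "z \<in> fixed_field H" "val_ge v (x - z) d"
proof
  interpret F: type_subfield "fixed_field H"
    using type_subfield_fixed_field[OF subgroup.subset[OF H]] .
  let ?z = "(\<Sum>\<sigma>\<in>H. \<sigma> x) / of_nat (card H)"
  note unit = tame_subgroup[OF H]
  show "?z \<in> fixed_field H" using trace_in_fixed_field[OF H x] F.of_nat_in by (rule F.divide_in)
  have "val_ge v (\<Sum>\<sigma>\<in>H. x - \<sigma> x) d"
    using close val_ge_minus_commute by (intro val_ge_sum) blast
  also have "(\<Sum>\<sigma>\<in>H. x - \<sigma> x) = of_nat (card H) * (x - ?z)"
    using unit(1) by (simp add: sum_subtractf algebra_simps)
  finally show "val_ge v (x - ?z) d" using unit by (simp add: val_ge_mult_unit)
qed

lemma fixed_representative: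
  assumes H: "subgroup H I" and x: "x \<in> L" "x \<noteq> 0"
    and close: "\<And>\<sigma>. \<sigma> \<in> H \<Longrightarrow> val_gt v (\<sigma> x - x) (v x)"
  obtains y where "y \<in> fixed_field H" "y \<noteq> 0" "v y = v x"
proof -
  define y where "y = (\<Sum>\<sigma>\<in>H. \<sigma> x)"
  have "val_gt v (\<Sum>\<sigma>\<in>H. \<sigma> x - x) (v x)" using close by (intro val_gt_sum)
  then have "val_gt v (y - of_nat (card H) * x) (v x)" unfolding y_def by (simp add: sum_subtractf)
  moreover have "of_nat (card H) * x \<noteq> 0" "v (of_nat (card H) * x) = v x"
    using tame_subgroup[OF H] x by (auto simp: v_mult)
  ultimately have "y \<noteq> 0" "v y = v x" using v_eq_of_val_gt_diff[of "of_nat (card H) * x" y] by auto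
  moreover have "y \<in> fixed_field H" unfolding y_def using trace_in_fixed_field[OF H x(1)] .
  ultimately show ?thesis using that by blast
qed

definition value_group :: "rat set" (\<open>\<Gamma>\<close>) where "\<Gamma> = v ` (L - {0})"

lemma value_groupI: "x \<in> L \<Longrightarrow> x \<noteq> 0 \<Longrightarrow> v x \<in> \<Gamma>"
  unfolding value_group_def by blast

lemma value_groupE:
  assumes "d \<in> \<Gamma>" obtains x where "x \<in> L" "x \<noteq> 0" "v x = d"
  using assms unfolding value_group_def by blast

lemma value_group_diff: "d \<in> \<Gamma> \<Longrightarrow> d' \<in> \<Gamma> \<Longrightarrow> d - d' \<in> \<Gamma>"
  by (elim value_groupE) (metis divide_eq_0_iff divide_in v_divide value_groupI)

lemma one_fixed_value: obtains x where "x \<in> fixed_field (carrier I)" "x \<noteq> 0" "v x = 1"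
proof -
  have "1 \<in> v ` (fixed_field (carrier I) - {0})" unfolding fixed_values by simp
  then obtain x where "1 = v x" "x \<in> fixed_field (carrier I) - {0}" by (rule imageE)
  then show ?thesis using that[of x] by simp
qed

lemma value_group_1: "1 \<in> \<Gamma>"
  using one_fixed_value fixed_fieldD(1) value_groupI by metis

lemma value_group_int_mult: "d \<in> \<Gamma> \<Longrightarrow> of_int k * d \<in> \<Gamma>"
  using int_mult_closed value_group_diff by blast

lemma value_group_nat_mult: "d \<in> \<Gamma> \<Longrightarrow> of_nat n * d \<in> \<Gamma>"
  using value_group_int_mult[of d "int n"] by simp

text \<open>The class of \<open>\<sigma> x / x\<close> modulo the maximal ideal depends only on \<open>\<sigma>\<close> and \<open>v x\<close>, because
  \<open>\<sigma>\<close> acts trivially on the residue classes of units.\<close>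

definition tame_char :: "('a \<Rightarrow> 'a) \<Rightarrow> rat \<Rightarrow> 'a" (\<open>\<theta>\<close>) where
  "\<theta> \<sigma> d = (let x = SOME x. x \<in> L \<and> x \<noteq> 0 \<and> v x = d in \<sigma> x / x)"

lemma quotient_residue_eq:
  assumes \<sigma>: "\<sigma> \<in> carrier I" and x: "x \<in> L" "x \<noteq> 0" and y: "y \<in> L" "y \<noteq> 0" and "v x = v y"
  shows "\<sigma> x / x \<approx> \<sigma> y / y"
proof -
  interpret \<sigma>: field_embedding L \<sigma> using field_embedding[OF \<sigma>] .
  define u where "u = x / y"
  have u: "u \<in> L" "u \<noteq> 0" "v u = 0"
    unfolding u_def using x y assms(6) by (auto simp: v_divide divide_in)
  then have "infinitesimal (\<sigma> u - u)"
    using infinitesimal_displacement[OF \<sigma>] by (simp add: val_ge_def)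
  also have "\<sigma> u - u = u * (\<sigma> u / u - 1)" using u(2) by (simp add: algebra_simps)
  finally have "\<sigma> u / u \<approx> 1" using u by (simp add: residue_eq_def val_gt_mult_unit)
  then have "\<sigma> u / u * (\<sigma> y / y) \<approx> 1 * (\<sigma> y / y)"
    using u y \<sigma> by (intro residue_eq_mult quotient_integral) auto
  moreover have "\<sigma> u / u * (\<sigma> y / y) = \<sigma> x / x"
    unfolding u_def using x y \<sigma>.nonzero[OF y] by (simp add: \<sigma>.divide field_simps)
  ultimately show ?thesis by simp
qed

lemma tame_char_witness:
  assumes "d \<in> \<Gamma>"
  obtains x where "x \<in> L" "x \<noteq> 0" "v x = d" "\<forall>\<sigma>. \<theta> \<sigma> d = \<sigma> x / x"
proof -
  let ?P = "\<lambda>x. x \<in> L \<and> x \<noteq> 0 \<and> v x = d"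
  have "\<exists>x. ?P x" using assms by (elim value_groupE) blast
  then have "?P (SOME x. ?P x)" by (rule someI_ex)
  moreover have "\<theta> \<sigma> d = \<sigma> (SOME x. ?P x) / (SOME x. ?P x)" for \<sigma>
    by (simp add: tame_char_def Let_def)
  ultimately show ?thesis using that[of "SOME x. ?P x"] by blast
qed

lemma tame_char_residue_eq:
  assumes "\<sigma> \<in> carrier I" "x \<in> L" "x \<noteq> 0"
  shows "\<theta> \<sigma> (v x) \<approx> \<sigma> x / x"
proof -
  obtain y where "y \<in> L" "y \<noteq> 0" "v y = v x" "\<forall>\<sigma>. \<theta> \<sigma> (v x) = \<sigma> y / y"
    by (rule tame_char_witness[OF value_groupI[OF assms(2,3)]])
  then show ?thesis using quotient_residue_eq[OF assms(1) _ _ assms(2,3)] by simp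
qed

lemma tame_char_integral:
  assumes "\<sigma> \<in> carrier I" "d \<in> \<Gamma>" shows "integral (\<theta> \<sigma> d)"
  by (rule tame_char_witness[OF assms(2)]) (simp add: quotient_integral[OF assms(1)])

lemma tame_char_eq_iff:
  assumes \<sigma>: "\<sigma> \<in> carrier I" "\<tau> \<in> carrier I" and x: "x \<in> L" "x \<noteq> 0"
  shows "\<theta> \<sigma> (v x) \<approx> \<theta> \<tau> (v x) \<longleftrightarrow> val_gt v (\<sigma> x - \<tau> x) (v x)"
proof -
  have "\<theta> \<sigma> (v x) \<approx> \<theta> \<tau> (v x) \<longleftrightarrow> \<sigma> x / x \<approx> \<tau> x / x"
    using tame_char_residue_eq \<sigma> x residue_eq_trans residue_eq_sym by meson
  also have "\<dots> \<longleftrightarrow> infinitesimal (\<sigma> x / x - \<tau> x / x)" unfolding residue_eq_def ..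
  also have "\<dots> \<longleftrightarrow> val_gt v (x * (\<sigma> x / x - \<tau> x / x)) (v x)" using x by (simp add: val_gt_mult_unit)
  also have "x * (\<sigma> x / x - \<tau> x / x) = \<sigma> x - \<tau> x" using x(2) by (simp add: algebra_simps)
  finally show ?thesis .
qed

lemma tame_char_one: assumes "d \<in> \<Gamma>" shows "\<theta> \<one> d = 1"
  using assms apply_one by (elim tame_char_witness) simp

lemma tame_char_trivial_iff:
  assumes "\<sigma> \<in> carrier I" "x \<in> L" "x \<noteq> 0"
  shows "\<theta> \<sigma> (v x) \<approx> 1 \<longleftrightarrow> val_gt v (\<sigma> x - x) (v x)"
  using tame_char_eq_iff[OF assms(1) one_closed assms(2,3)] assms
  by (simp add: tame_char_one value_groupI apply_one)

lemma tame_char_add: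
  assumes \<sigma>: "\<sigma> \<in> carrier I" and d: "d \<in> \<Gamma>" "d' \<in> \<Gamma>"
  shows "\<theta> \<sigma> (d + d') \<approx> \<theta> \<sigma> d * \<theta> \<sigma> d'"
proof -
  obtain x where x: "x \<in> L" "x \<noteq> 0" "v x = d" "\<forall>\<sigma>. \<theta> \<sigma> d = \<sigma> x / x"
    by (rule tame_char_witness[OF d(1)])
  obtain y where y: "y \<in> L" "y \<noteq> 0" "v y = d'" "\<forall>\<sigma>. \<theta> \<sigma> d' = \<sigma> y / y"
    by (rule tame_char_witness[OF d(2)])
  have "\<theta> \<sigma> (v (x * y)) \<approx> \<sigma> (x * y) / (x * y)"
    using \<sigma> x y by (intro tame_char_residue_eq) (simp_all add: mult_in)
  then show ?thesis using x y by (simp add: v_mult field_embedding.mult[OF field_embedding[OF \<sigma>]])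
qed

lemma tame_char_mult:
  assumes \<sigma>\<tau>: "\<sigma> \<in> carrier I" "\<tau> \<in> carrier I" and d: "d \<in> \<Gamma>"
  shows "\<theta> (\<sigma> \<otimes> \<tau>) d \<approx> \<theta> \<sigma> d * \<theta> \<tau> d"
proof -
  obtain x where x: "x \<in> L" "x \<noteq> 0" "v x = d" "\<forall>\<sigma>. \<theta> \<sigma> d = \<sigma> x / x"
    by (rule tame_char_witness[OF d])
  have \<tau>x: "\<tau> x \<in> L" "\<tau> x \<noteq> 0" "v (\<tau> x) = v x"
    using apply_in[OF \<sigma>\<tau>(2) x(1)] apply_nonzero[OF \<sigma>\<tau>(2) x(1,2)] v_apply[OF \<sigma>\<tau>(2) x(1,2)] .
  have "\<sigma> (\<tau> x) / \<tau> x * (\<tau> x / x) \<approx> \<sigma> x / x * (\<tau> x / x)"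
    using \<sigma>\<tau> x \<tau>x by (intro residue_eq_mult quotient_residue_eq quotient_integral) auto
  then show ?thesis using \<tau>x(2) apply_mult[OF x(1) \<sigma>\<tau>] by (simp add: x(4))
qed

lemma tame_char_0: assumes "\<sigma> \<in> carrier I" shows "\<theta> \<sigma> 0 \<approx> 1"
  using tame_char_trivial_iff[OF assms one_in] field_embedding.one[OF field_embedding[OF assms]]
  by simp

lemma tame_char_1: assumes "\<sigma> \<in> carrier I" shows "\<theta> \<sigma> 1 \<approx> 1"
proof -
  obtain x where "x \<in> fixed_field (carrier I)" "x \<noteq> 0" "v x = 1" by (rule one_fixed_value)
  then show ?thesis
    using tame_char_trivial_iff[OF assms, of x] fixed_fieldD(1) fixed_fieldD(2)[OF _ assms] by simp
qed

lemma tame_char_nat_mult: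
  assumes "\<sigma> \<in> carrier I" "d \<in> \<Gamma>" shows "\<theta> \<sigma> (of_nat n * d) \<approx> \<theta> \<sigma> d ^ n"
proof (induction n)
  case 0
  show ?case using tame_char_0[OF assms(1)] by simp
next
  case (Suc n)
  have "\<theta> \<sigma> (d + of_nat n * d) \<approx> \<theta> \<sigma> d * \<theta> \<sigma> (of_nat n * d)"
    using assms by (intro tame_char_add value_group_nat_mult)
  also have "\<dots> \<approx> \<theta> \<sigma> d * \<theta> \<sigma> d ^ n"
    using Suc assms
    by (intro residue_eq_mult tame_char_integral integral_power residue_eq_refl
        value_group_nat_mult)
  finally show ?case by (simp add: algebra_simps)
qed

lemma tame_char_nat_pow:
  assumes "\<sigma> \<in> carrier I" "d \<in> \<Gamma>" shows "\<theta> (\<sigma> [^] (n::nat)) d \<approx> \<theta> \<sigma> d ^ n"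
proof (induction n)
  case 0
  show ?case using tame_char_one[OF assms(2)] by simp
next
  case (Suc n)
  have "\<theta> (\<sigma> [^] n \<otimes> \<sigma>) d \<approx> \<theta> (\<sigma> [^] n) d * \<theta> \<sigma> d" using assms by (intro tame_char_mult) simp_all
  also have "\<dots> \<approx> \<theta> \<sigma> d ^ n * \<theta> \<sigma> d"
    using Suc assms
    by (intro residue_eq_mult tame_char_integral integral_power residue_eq_refl) simp_all
  finally show ?case by (simp add: mult.commute)
qed

lemma tame_char_int_mult_trivial:
  assumes \<sigma>: "\<sigma> \<in> carrier I" and "d \<in> \<Gamma>" "\<theta> \<sigma> d \<approx> 1"
  shows "\<theta> \<sigma> (of_int k * d) \<approx> 1"
proof -
  let ?trivial = "{d \<in> \<Gamma>. \<theta> \<sigma> d \<approx> 1}"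
  have "of_int k * d \<in> ?trivial"
  proof (rule int_mult_closed)
    fix a b assume a: "a \<in> ?trivial" and b: "b \<in> ?trivial"
    have "\<theta> \<sigma> (a - b) * 1 \<approx> \<theta> \<sigma> (a - b) * \<theta> \<sigma> b"
      using a b \<sigma> by (intro residue_eq_mult tame_char_integral value_group_diff)
        (auto intro: residue_eq_sym tame_char_integral)
    also have "\<dots> \<approx> \<theta> \<sigma> (a - b + b)"
      using a b \<sigma> by (intro residue_eq_sym[OF tame_char_add] value_group_diff) auto
    also have "\<theta> \<sigma> (a - b + b) \<approx> 1" using a by simp
    finally show "a - b \<in> ?trivial" using a b value_group_diff by simp
  qed (use assms in simp)
  then show ?thesis by simp
qed

subsection \<open>Kernels of the tame character\<close>

definition kernel :: "('a \<Rightarrow> 'a) set \<Rightarrow> rat \<Rightarrow> ('a \<Rightarrow> 'a) set" where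
  "kernel H d = {\<sigma> \<in> H. \<theta> \<sigma> d \<approx> 1}"

lemma kernel_subset: "kernel H d \<subseteq> H"
  unfolding kernel_def by blast

lemma tame_char_eq_iff_kernel:
  assumes \<sigma>\<tau>: "\<sigma> \<in> carrier I" "\<tau> \<in> carrier I" and d: "d \<in> \<Gamma>"
  shows "\<theta> \<tau> d \<approx> \<theta> \<sigma> d \<longleftrightarrow> \<tau> \<otimes> inv \<sigma> \<in> kernel (carrier I) d"
proof -
  obtain x where x: "x \<in> L" "x \<noteq> 0" "v x = d" using value_groupE[OF d] .
  have \<sigma>x: "\<sigma> x \<in> L" "\<sigma> x \<noteq> 0" "v (\<sigma> x) = v x"
    using apply_in[OF \<sigma>\<tau>(1) x(1)] apply_nonzero[OF \<sigma>\<tau>(1) x(1,2)] v_apply[OF \<sigma>\<tau>(1) x(1,2)] .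
  have "(\<tau> \<otimes> inv \<sigma>) (\<sigma> x) = \<tau> x"
    using apply_mult[OF \<sigma>x(1) \<sigma>\<tau>(2)] apply_inv(1)[OF \<sigma>\<tau>(1) x(1)] \<sigma>\<tau>(1) by simp
  then show ?thesis
    using tame_char_eq_iff[OF \<sigma>\<tau>(2,1) x(1,2)] tame_char_trivial_iff[of "\<tau> \<otimes> inv \<sigma>" "\<sigma> x"] \<sigma>\<tau> \<sigma>x x(3)
    by (simp add: kernel_def)
qed

lemma subgroup_kernel:
  assumes H: "subgroup H I" and d: "d \<in> \<Gamma>"
  shows "subgroup (kernel H d) I"
proof (rule subgroupI)
  interpret H: subgroup H I by fact
  show "kernel H d \<subseteq> carrier I" using kernel_subset H.subset by blast
  have "\<one> \<in> kernel H d" using tame_char_one[OF d] by (simp add: kernel_def)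
  then show "kernel H d \<noteq> {}" by blast
  fix \<sigma> assume \<sigma>: "\<sigma> \<in> kernel H d"
  then have \<sigma>_in: "\<sigma> \<in> H" "\<theta> \<sigma> d \<approx> 1" by (simp_all add: kernel_def)
  then have "\<theta> \<one> d \<approx> \<theta> \<sigma> d" using tame_char_one[OF d] residue_eq_sym by simp
  then show "inv \<sigma> \<in> kernel H d"
    using tame_char_eq_iff_kernel[of \<sigma> \<one> d] \<sigma>_in(1) d by (simp add: kernel_def)
  fix \<tau> assume \<tau>: "\<tau> \<in> kernel H d"
  have "\<theta> (\<sigma> \<otimes> \<tau>) d \<approx> \<theta> \<sigma> d * \<theta> \<tau> d" using \<sigma> \<tau> d by (intro tame_char_mult) (auto simp: kernel_def)
  also have "\<dots> \<approx> 1 * 1"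
    using \<sigma> \<tau> d by (intro residue_eq_mult tame_char_integral) (auto simp: kernel_def)
  finally show "\<sigma> \<otimes> \<tau> \<in> kernel H d" using \<sigma> \<tau> by (simp add: kernel_def)
qed

text \<open>The product of the conjugates of \<open>x\<close> has value \<open>[I : S] v x\<close>, where \<open>S\<close> is the stabiliser
  of \<open>x\<close>, and \<open>[I : S]\<close> divides \<open>[I : H]\<close>.\<close>

lemma card_rcosets_mult_fixed_value:
  assumes H: "subgroup H I" and x: "x \<in> fixed_field H" "x \<noteq> 0"
  shows "of_nat (card (rcosets H)) * v x \<in> \<int>"
proof -
  let ?S = "stabilizer I (\<lambda>\<sigma>. \<sigma>) x" and ?Y = "orbit I (\<lambda>\<sigma>. \<sigma>) x"
  have xL: "x \<in> L" using x(1) by (rule fixed_fieldD)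
  have S: "subgroup ?S I" using stabilizer_subgroup[OF xL] .
  have "H \<subseteq> ?S"
    using fixed_fieldD(2)[OF x(1)] subgroup.mem_carrier[OF H] by (auto simp: stabilizer_def)
  then obtain k where k: "card ?S = card H * k" using card_subgroup_dvd[OF S H] by blast
  have "card (rcosets H) * card H = card ?Y * card ?S"
    using card_rcosets_mult[OF H] orbit_stabilizer_theorem[OF xL] by (simp add: Coset.order_def)
  then have index: "card (rcosets H) = card ?Y * k" using k card_subgroup_pos[OF H] by simp
  have Y: "y \<noteq> 0" "v y = v x" if "y \<in> ?Y" for y
    using that apply_nonzero v_apply xL x(2) by (auto simp: orbit_def)
  have "finite ?Y" unfolding orbit_def using finite_carrier by simp
  have "v (\<Prod>y\<in>?Y. y) = of_nat (card ?Y) * v x"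
    using \<open>finite ?Y\<close> Y by (subst v_prod) auto
  moreover have "(\<Prod>y\<in>?Y. y) \<in> fixed_field (carrier I) - {0}"
    using orbit_prod_in_fixed_field[OF xL] \<open>finite ?Y\<close> Y(1) by auto
  ultimately have "of_nat (card ?Y) * v x \<in> \<int>" using fixed_values by (metis imageI)
  then have "of_nat k * (of_nat (card ?Y) * v x) \<in> \<int>" by (rule Ints_mult[OF Ints_of_nat])
  then show ?thesis by (simp add: index ac_simps)
qed

lemma e_mult_value: assumes "d \<in> \<Gamma>" shows "of_nat e * d \<in> \<int>"
proof -
  obtain x where x: "x \<in> L" "x \<noteq> 0" "v x = d" using value_groupE[OF assms] .
  moreover have "x \<in> fixed_field {\<one>}" using x(1) apply_one by (simp add: fixed_field_def)
  ultimately show ?thesis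
    using card_rcosets_mult_fixed_value[OF triv_subgroup] card_rcosets_mult[OF triv_subgroup]
    by auto
qed

lemma denom_mult_card_kernel_dvd:
  assumes H: "subgroup H I" and d: "d \<in> \<Gamma>"
  shows "denom (of_nat (card (rcosets H)) * d) * card (kernel H d) dvd card H"
proof -
  note ker = subgroup_kernel[OF H d]
  obtain x where x: "x \<in> L" "x \<noteq> 0" "v x = d" using value_groupE[OF d] .
  have "val_gt v (\<sigma> x - x) (v x)" if "\<sigma> \<in> kernel H d" for \<sigma>
    using tame_char_trivial_iff[of \<sigma> x] that x subgroup.mem_carrier[OF ker that]
    by (simp add: kernel_def)
  then obtain y where "y \<in> fixed_field (kernel H d)" "y \<noteq> 0" "v y = d"
    using fixed_representative[OF ker x(1,2)] x(3) by metis
  then have fixed: "of_nat (card (rcosets (kernel H d))) * d \<in> \<int>"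
    using card_rcosets_mult_fixed_value[OF ker] by blast
  obtain k where k: "card H = card (kernel H d) * k"
    using card_subgroup_dvd[OF H ker kernel_subset] by blast
  have "card (rcosets (kernel H d)) * card (kernel H d) = card (rcosets H) * k * card (kernel H d)"
    using card_rcosets_mult[OF ker] card_rcosets_mult[OF H] by (simp add: k ac_simps)
  then have "card (rcosets (kernel H d)) = card (rcosets H) * k"
    using card_subgroup_pos[OF ker] by simp
  then have "denom (of_nat (card (rcosets H)) * d) dvd k"
    using fixed unfolding denom_dvd_iff by (simp add: ac_simps)
  then show ?thesis unfolding k by (simp add: mult.commute)
qed

lemma card_incongruent_chars_le:
  assumes T: "finite T" "T \<subseteq> carrier I" and d: "d \<in> \<Gamma>" and "b > 0"
    and incongruent: "\<And>\<sigma> \<tau>. \<sigma> \<in> T \<Longrightarrow> \<tau> \<in> T \<Longrightarrow> \<theta> \<sigma> d \<approx> \<theta> \<tau> d \<Longrightarrow> \<sigma> = \<tau>"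
    and trivial: "\<And>\<sigma>. \<sigma> \<in> T \<Longrightarrow> \<theta> \<sigma> (of_nat b * d) \<approx> 1"
  shows "card T \<le> b"
proof -
  let ?A = "(\<lambda>\<sigma>. \<theta> \<sigma> d) ` T" and ?p = "monom 1 b + [:- 1:] :: 'a poly"
  have degree: "degree ?p = b"
    using \<open>b > 0\<close> by (subst degree_add_eq_left) (simp_all add: degree_monom_eq)
  have "card ?A \<le> degree ?p"
  proof (rule card_incongruent_roots_le)
    show "?p \<in> polys_over {x. integral x}"
      by (simp add: polys_over_def val_ge_add coeff_pCons split: nat.split)
    show "\<not> infinitesimal (lead_coeff ?p)"
      using \<open>b > 0\<close> unfolding degree by (simp add: coeff_pCons split: nat.split)
    show "infinitesimal (poly ?p a)" if a: "a \<in> ?A" for a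
    proof -
      obtain \<sigma> where \<sigma>: "\<sigma> \<in> T" "a = \<theta> \<sigma> d" using a by blast
      have "a ^ b \<approx> \<theta> \<sigma> (of_nat b * d)"
        unfolding \<sigma>(2) using \<sigma>(1) T(2) d by (intro residue_eq_sym[OF tame_char_nat_mult]) auto
      also have "\<dots> \<approx> 1" using trivial \<sigma>(1) .
      finally show ?thesis by (simp add: poly_monom residue_eq_def)
    qed
  qed (use T d incongruent tame_char_integral in auto)
  moreover have "inj_on (\<lambda>\<sigma>. \<theta> \<sigma> d) T" using incongruent by (intro inj_onI) simp
  ultimately show ?thesis by (simp add: degree card_image)
qed

lemma card_subgroup_le:
  assumes H: "subgroup H I" and d: "d \<in> \<Gamma>" and "b > 0"
    and trivial: "\<And>\<sigma>. \<sigma> \<in> H \<Longrightarrow> \<theta> \<sigma> (of_nat b * d) \<approx> 1"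
  shows "card H \<le> b * card (kernel H d)"
proof -
  interpret H: subgroup H I by fact
  have "finite H" using finite_subset[OF H.subset finite_carrier] .
  define fibre where "fibre \<sigma> = {\<tau> \<in> H. \<theta> \<tau> d \<approx> \<theta> \<sigma> d}" for \<sigma>
  obtain T where T: "T \<subseteq> H" "inj_on fibre T" "fibre ` H = fibre ` T"
    using subset_image_inj[of "fibre ` H" fibre H] by auto
  have "finite T" using T(1) \<open>finite H\<close> by (rule finite_subset)
  have "\<sigma> \<in> fibre \<sigma>" if "\<sigma> \<in> H" for \<sigma> using that by (simp add: fibre_def)
  then have cover: "H \<subseteq> (\<Union>\<sigma>\<in>T. fibre \<sigma>)" using T(3) by blast
  have card_fibre: "card (fibre \<sigma>) \<le> card (kernel H d)" if "\<sigma> \<in> T" for \<sigma>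
  proof (rule card_inj_on_le)
    have \<sigma>: "\<sigma> \<in> H" using that T(1) by blast
    show "inj_on (\<lambda>\<tau>. \<tau> \<otimes> inv \<sigma>) (fibre \<sigma>)"
      using \<sigma> by (intro inj_onI) (auto simp: fibre_def)
    show "(\<lambda>\<tau>. \<tau> \<otimes> inv \<sigma>) ` fibre \<sigma> \<subseteq> kernel H d"
      using \<sigma> tame_char_eq_iff_kernel[OF _ _ d] by (auto simp: fibre_def kernel_def)
    show "finite (kernel H d)" using kernel_subset \<open>finite H\<close> by (rule finite_subset)
  qed
  have "\<sigma> = \<tau>" if "\<sigma> \<in> T" "\<tau> \<in> T" "\<theta> \<sigma> d \<approx> \<theta> \<tau> d" for \<sigma> \<tau>
  proof -
    have "fibre \<sigma> = fibre \<tau>"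
      unfolding fibre_def using that(3) residue_eq_trans residue_eq_sym by blast
    then show ?thesis using T(2) that by (simp add: inj_on_def)
  qed
  then have "card T \<le> b"
    using \<open>finite T\<close> T(1) d \<open>b > 0\<close> trivial by (intro card_incongruent_chars_le[of T d]) auto
  have "card H \<le> card (\<Union>\<sigma>\<in>T. fibre \<sigma>)"
    using cover \<open>finite T\<close> \<open>finite H\<close> by (intro card_mono) (auto simp: fibre_def)
  also have "\<dots> \<le> (\<Sum>\<sigma>\<in>T. card (fibre \<sigma>))" using \<open>finite T\<close> by (rule card_UN_le)
  also have "\<dots> \<le> card T * card (kernel H d)" using card_fibre sum_bounded_above by (metis of_nat_id)
  also have "\<dots> \<le> b * card (kernel H d)" using \<open>card T \<le> b\<close> by simp
  finally show ?thesis .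
qed

lemma card_subgroup_eq_if_trivial:
  assumes H: "subgroup H I" and d: "d \<in> \<Gamma>" and b: "b = denom (of_nat (card (rcosets H)) * d)"
    and trivial: "\<And>\<sigma>. \<sigma> \<in> H \<Longrightarrow> \<theta> \<sigma> (of_nat b * d) \<approx> 1"
  shows "card H = b * card (kernel H d)"
proof (rule antisym)
  have "b > 0" unfolding b by (rule denom_pos)
  then show "card H \<le> b * card (kernel H d)" using trivial by (rule card_subgroup_le[OF H d])
  show "b * card (kernel H d) \<le> card H"
    unfolding b using denom_mult_card_kernel_dvd[OF H d] card_subgroup_pos[OF H]
    by (rule dvd_imp_le)
qed

lemma subgroup_displacement_ge:
  assumes x: "x \<in> L" shows "subgroup {\<sigma> \<in> carrier I. val_ge v (\<sigma> x - x) d} I"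
proof (rule subgroupI)
  have displacement: "val_ge v (\<sigma> (\<tau> x) - \<sigma> x) d \<longleftrightarrow> val_ge v (\<tau> x - x) d"
    if \<sigma>\<tau>: "\<sigma> \<in> carrier I" "\<tau> \<in> carrier I" for \<sigma> \<tau>
    using field_embedding.diff[OF field_embedding[OF \<sigma>\<tau>(1)]] apply_in[OF \<sigma>\<tau>(2) x] x
    by (metis diff_in val_apply_iff(1)[OF \<sigma>\<tau>(1)])
  show "{\<sigma> \<in> carrier I. val_ge v (\<sigma> x - x) d} \<noteq> {}" using apply_one[OF x] by force
  fix \<sigma> assume "\<sigma> \<in> {\<sigma> \<in> carrier I. val_ge v (\<sigma> x - x) d}"
  then have \<sigma>: "\<sigma> \<in> carrier I" "val_ge v (\<sigma> x - x) d" by simp_all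
  show "inv \<sigma> \<in> {\<sigma> \<in> carrier I. val_ge v (\<sigma> x - x) d}"
    using displacement[of \<sigma> "inv \<sigma>"] apply_inv(2)[OF \<sigma>(1) x] \<sigma> val_ge_minus_commute by simp
  fix \<tau> assume "\<tau> \<in> {\<sigma> \<in> carrier I. val_ge v (\<sigma> x - x) d}"
  then have \<tau>: "\<tau> \<in> carrier I" "val_ge v (\<tau> x - x) d" by simp_all
  then have "val_ge v (\<sigma> (\<tau> x) - \<sigma> x) d" using displacement[OF \<sigma>(1) \<tau>(1)] by simp
  then have "val_ge v (\<sigma> (\<tau> x) - x) d" using \<sigma>(2) val_ge_diff_trans by blast
  then show "\<sigma> \<otimes> \<tau> \<in> {\<sigma> \<in> carrier I. val_ge v (\<sigma> x - x) d}"
    using \<sigma>(1) \<tau>(1) apply_mult[OF x] by simp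
qed blast

text \<open>Otherwise \<open>x\<close> minus its average over the \<open>\<tau>\<close> with \<open>v (\<tau> x - x) \<ge> v (\<sigma> x - x)\<close> would have
  value \<open>v (\<sigma> x - x)\<close>.\<close>

lemma tame_char_displacement:
  assumes \<sigma>: "\<sigma> \<in> carrier I" and x: "x \<in> L" "\<sigma> x \<noteq> x"
  shows "\<not> \<theta> \<sigma> (v (\<sigma> x - x)) \<approx> 1"
proof
  define d where "d = v (\<sigma> x - x)"
  assume "\<theta> \<sigma> (v (\<sigma> x - x)) \<approx> 1"
  then have trivial: "\<theta> \<sigma> d \<approx> 1" by (simp add: d_def)
  define H where "H = {\<tau> \<in> carrier I. val_ge v (\<tau> x - x) d}"
  have H: "subgroup H I" unfolding H_def using x(1) by (rule subgroup_displacement_ge)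
  obtain z where z: "z \<in> fixed_field H" "val_ge v (x - z) d"
    using fixed_centre[OF H x(1), of d] by (auto simp: H_def)
  have "\<sigma> \<in> H" using \<sigma> by (simp add: H_def d_def val_ge_self)
  interpret \<sigma>: field_embedding L \<sigma> using field_embedding[OF \<sigma>] .
  have zL: "z \<in> L" "x - z \<in> L" using fixed_fieldD(1)[OF z(1)] x(1) diff_in by blast+
  have displacement: "\<sigma> (x - z) - (x - z) = \<sigma> x - x"
    using fixed_fieldD(2)[OF z(1) \<open>\<sigma> \<in> H\<close>] zL x(1) by (simp add: \<sigma>.diff)
  have "\<not> val_gt v (\<sigma> x - x) d" using x(2) by (simp add: val_gt_def d_def)
  then have "\<not> val_gt v (x - z) d"
    using val_gt_diff[of "\<sigma> (x - z)" d "x - z"] val_apply_iff(2)[OF \<sigma> zL(2)] displacement by auto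
  then have "x - z \<noteq> 0" "v (x - z) = d" using z(2) by (auto simp: val_ge_def val_gt_def)
  then have "val_gt v (\<sigma> (x - z) - (x - z)) d"
    using tame_char_trivial_iff[OF \<sigma> zL(2)] trivial by simp
  then show False using \<open>\<not> val_gt v (\<sigma> x - x) d\<close> displacement by simp
qed

lemma e_eq_if_kernel_trivial:
  assumes "m > 0" "1 / of_nat m \<in> \<Gamma>" and faithful: "kernel (carrier I) (1 / of_nat m) \<subseteq> {\<one>}"
  shows "e = m"
proof -
  have "kernel (carrier I) (1 / of_nat m) = {\<one>}"
    using faithful subgroup.one_closed[OF subgroup_kernel[OF subgroup_self assms(2)]] by blast
  moreover have "card (rcosets (carrier I)) = 1"
    using card_rcosets_mult[OF subgroup_self] e_pos by simp
  moreover have "\<theta> \<sigma> (of_nat m * (1 / of_nat m)) \<approx> 1" if "\<sigma> \<in> carrier I" for \<sigma>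
    using tame_char_1[OF that] assms(1) by simp
  ultimately show ?thesis
    using card_subgroup_eq_if_trivial[OF subgroup_self assms(2), of m] assms(1)
    by (simp add: denom_inverse_of_nat)
qed

lemma inverse_e_in_value_group: "1 / of_nat e \<in> \<Gamma>"
proof -
  obtain m where m: "m > 0" "\<Gamma> = range (\<lambda>k. of_int k / of_nat m)"
    by (rule rat_subgroup_eq_multiples[OF value_group_diff value_group_1 e_pos e_mult_value])
  have generator: "1 / of_nat m \<in> \<Gamma>" unfolding m(2) by (rule image_eqI[of _ _ 1]) simp_all
  have "kernel (carrier I) (1 / of_nat m) \<subseteq> {\<one>}"
  proof
    fix \<sigma> assume "\<sigma> \<in> kernel (carrier I) (1 / of_nat m)"
    then have \<sigma>: "\<sigma> \<in> carrier I" "\<theta> \<sigma> (1 / of_nat m) \<approx> 1" by (simp_all add: kernel_def)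
    have "\<sigma> x = x" if x: "x \<in> L" for x
    proof (rule ccontr)
      assume ne: "\<sigma> x \<noteq> x"
      then have "v (\<sigma> x - x) \<in> \<Gamma>" using x apply_in[OF \<sigma>(1) x] by (intro value_groupI diff_in) auto
      then obtain k where "v (\<sigma> x - x) = of_int k * (1 / of_nat m)" unfolding m(2) by auto
      then have "\<theta> \<sigma> (v (\<sigma> x - x)) \<approx> 1"
        using tame_char_int_mult_trivial[OF \<sigma>(1) generator \<sigma>(2)] by simp
      then show False using tame_char_displacement[OF \<sigma>(1) x ne] by blast
    qed
    then show "\<sigma> \<in> {\<one>}" using automorphism_eqI[OF \<sigma>(1) one_closed] apply_one by simp
  qed
  then show ?thesis using e_eq_if_kernel_trivial[OF m(1) generator] generator by simp
qed

lemma tame_char_trivial_if_index_mult_int: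
  assumes H: "subgroup H I" and \<sigma>: "\<sigma> \<in> H" and integer: "of_nat (card (rcosets H)) * d \<in> \<int>"
  shows "\<theta> \<sigma> d \<approx> 1"
proof -
  note \<sigma>_in = subgroup.mem_carrier[OF H \<sigma>] and inverse_e = inverse_e_in_value_group
  interpret H: group "I\<lparr>carrier := H\<rparr>" using subgroup_imp_group[OF H] .
  have "\<sigma> [^] card H = \<one>"
    using H.pow_order_eq_1[of \<sigma>] \<sigma> nat_pow_consistent[of \<sigma> "card H" H]
    by (simp add: Coset.order_def)
  then have "\<theta> \<sigma> (1 / of_nat e) ^ card H \<approx> 1"
    using tame_char_nat_pow[OF \<sigma>_in inverse_e, of "card H"] tame_char_one[OF inverse_e]
      residue_eq_sym by simp
  then have trivial: "\<theta> \<sigma> (of_nat (card H) * (1 / of_nat e)) \<approx> 1"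
    by (rule residue_eq_trans[OF tame_char_nat_mult[OF \<sigma>_in inverse_e]])
  obtain k where k: "of_nat (card (rcosets H)) * d = of_int k"
    using integer by (auto elim: Ints_cases)
  have "of_nat e = (of_nat (card (rcosets H)) * of_nat (card H) :: rat)"
    using card_rcosets_mult[OF H] by (metis of_nat_mult)
  then have "of_int k * (of_nat (card H) * (1 / of_nat e)) = d"
    using card_rcosets_pos[OF H] card_subgroup_pos[OF H] by (simp flip: k)
  then show ?thesis
    using tame_char_int_mult_trivial[OF \<sigma>_in value_group_nat_mult[OF inverse_e] trivial, of k]
    by simp
qed

lemma card_kernel:
  assumes H: "subgroup H I" and d: "d \<in> \<Gamma>"
  shows "card H = denom (of_nat (card (rcosets H)) * d) * card (kernel H d)"
proof (rule card_subgroup_eq_if_trivial[OF H d refl])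
  let ?b = "denom (of_nat (card (rcosets H)) * d)"
  have "of_nat (card (rcosets H)) * (of_nat ?b * d) \<in> \<int>"
    using denom_mult_in_Ints[of "of_nat (card (rcosets H)) * d"] by (simp add: ac_simps)
  then show "\<theta> \<sigma> (of_nat ?b * d) \<approx> 1" if "\<sigma> \<in> H" for \<sigma>
    using tame_char_trivial_if_index_mult_int[OF H that] by blast
qed

end

subsection \<open>Clusters\<close>

definition open_disc :: "('a::field \<Rightarrow> rat) \<Rightarrow> 'a \<Rightarrow> rat \<Rightarrow> 'a set" where
  "open_disc v z d = {x. val_gt v (x - z) d}"

lemma proper_clusterD: "proper_cluster v R s \<Longrightarrow> cluster v R s"
  unfolding proper_cluster_def by blast

context valued_field
begin

lemma centre_in_disc: "z \<in> disc v z d" and centre_in_open_disc: "z \<in> open_disc v z d"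
  unfolding disc_def open_disc_def by simp_all

lemma disc_eq: "r \<in> disc v z d \<Longrightarrow> disc v z d = disc v r d"
  unfolding disc_def using val_ge_diff_trans val_ge_minus_commute by blast

lemma open_disc_eq_iff: "open_disc v r d = open_disc v r' d \<longleftrightarrow> val_gt v (r - r') d"
  unfolding open_disc_def set_eq_iff mem_Collect_eq
  using val_gt_diff_trans val_gt_minus_commute by (metis diff_self val_0(2))

lemma disc_antimono: "d \<le> d' \<Longrightarrow> disc v z d' \<subseteq> disc v z d"
  unfolding disc_def using val_ge_mono by blast

lemma open_disc_subset_disc: "open_disc v z d \<subseteq> disc v z d"
  unfolding open_disc_def disc_def using val_gt_imp_ge by blast

lemma disc_subset_open_disc: "d < d' \<Longrightarrow> disc v z d' \<subseteq> open_disc v z d"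
  unfolding open_disc_def disc_def val_ge_def val_gt_def by auto

end

locale finite_clusters = valued_field v for v :: "'a::field \<Rightarrow> rat" +
  fixes R :: "'a set"
  assumes finite_R: "finite R"
begin

lemma cluster_subset: "cluster v R s \<Longrightarrow> s \<subseteq> R"
  unfolding cluster_def by blast

lemma cluster_finite: "cluster v R s \<Longrightarrow> finite s"
  using cluster_subset finite_R finite_subset by blast

lemma cluster_nonempty: "cluster v R s \<Longrightarrow> \<exists>r. r \<in> s"
  unfolding cluster_def by blast

lemma cluster_disc: "r \<in> R \<Longrightarrow> cluster v R (disc v r d \<inter> R)"
  unfolding cluster_def using centre_in_disc by blast

lemma cluster_eq_disc:
  assumes "cluster v R s" "r \<in> s" obtains d where "s = disc v r d \<inter> R"
  using assms disc_eq unfolding cluster_def by blast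

lemma cluster_R: "R \<noteq> {} \<Longrightarrow> cluster v R R"
proof -
  assume "R \<noteq> {}"
  then obtain r where r: "r \<in> R" by blast
  let ?d = "Min (insert 0 ((\<lambda>x. v (x - r)) ` R))"
  have "R \<subseteq> disc v r ?d" unfolding disc_def val_ge_def using finite_R by auto
  then show ?thesis using cluster_disc[OF r, of ?d] by (simp add: Int_absorb1)
qed

lemma clusters_nested:
  assumes "cluster v R s" "cluster v R t" "r \<in> s" "r \<in> t"
  shows "s \<subseteq> t \<or> t \<subseteq> s"
proof -
  obtain d where d: "s = disc v r d \<inter> R" using cluster_eq_disc[OF assms(1,3)] .
  obtain d' where d': "t = disc v r d' \<inter> R" using cluster_eq_disc[OF assms(2,4)] .
  show ?thesis
    unfolding d d' using disc_antimono[of d d'] disc_antimono[of d' d] by (cases "d \<le> d'") auto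
qed

lemma cluster_open_disc:
  assumes r: "r \<in> R" shows "cluster v R (open_disc v r d \<inter> R)"
proof -
  let ?values = "insert (d + 1) ((\<lambda>x. v (x - r)) ` (open_disc v r d \<inter> R - {r}))"
  have fin: "finite ?values" using finite_R by simp
  define d' where "d' = Min ?values"
  have "d' \<in> ?values" unfolding d'_def using Min_in[OF fin] by blast
  then have "d < d'" unfolding open_disc_def val_gt_def by auto
  have "x \<in> disc v r d'" if "x \<in> open_disc v r d \<inter> R" for x
    using that Min_le[OF fin, of "v (x - r)"] unfolding d'_def disc_def val_ge_def
    by (cases "x = r") auto
  then have "open_disc v r d \<inter> R = disc v r d' \<inter> R"
    using disc_subset_open_disc[OF \<open>d < d'\<close>] by blast
  then show ?thesis using cluster_disc[OF r] by simp
qed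

lemma depth_le:
  assumes "cluster v R s" "r \<in> s" "r' \<in> s" shows "val_ge v (r - r') (depth v s)"
proof -
  have "finite {v (r - r') | r r'. r \<in> s \<and> r' \<in> s \<and> r \<noteq> r'}"
    by (rule finite_subset[of _ "(\<lambda>(r, r'). v (r - r')) ` (s \<times> s)"])
      (use cluster_finite[OF assms(1)] in auto)
  then show ?thesis unfolding depth_def val_ge_def using assms(2,3) by (auto intro!: Min_le)
qed

lemma depth_attained:
  assumes "proper_cluster v R s"
  obtains r r' where "r \<in> s" "r' \<in> s" "r \<noteq> r'" "v (r - r') = depth v s"
proof -
  have s: "finite s" "card s > 1"
    using assms cluster_finite unfolding proper_cluster_def by blast+
  let ?values = "{v (r - r') | r r'. r \<in> s \<and> r' \<in> s \<and> r \<noteq> r'}"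
  have "finite ?values"
    by (rule finite_subset[of _ "(\<lambda>(r, r'). v (r - r')) ` (s \<times> s)"]) (use s(1) in auto)
  moreover have "?values \<noteq> {}"
    using s card_le_Suc0_iff_eq[OF s(1)] by (auto simp: not_le)
  ultimately have "depth v s \<in> ?values" unfolding depth_def by (rule Min_in)
  then show ?thesis using that by auto
qed

lemma proper_cluster_eq_disc:
  assumes s: "proper_cluster v R s" and r: "r \<in> s"
  shows "s = disc v r (depth v s) \<inter> R"
proof
  note cl = proper_clusterD[OF s]
  show "s \<subseteq> disc v r (depth v s) \<inter> R"
    unfolding disc_def using depth_le[OF cl _ r] cluster_subset[OF cl] by blast
  obtain d where d: "s = disc v r d \<inter> R" using cluster_eq_disc[OF cl r] .
  obtain a b where ab: "a \<in> s" "b \<in> s" "a \<noteq> b" "v (a - b) = depth v s"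
    by (rule depth_attained[OF s])
  have "a \<in> disc v b d" using ab(1,2) d disc_eq by blast
  then have "d \<le> depth v s" using ab by (simp add: disc_def val_ge_def)
  then show "disc v r (depth v s) \<inter> R \<subseteq> s" using d disc_antimono by blast
qed

lemma proper_cluster_of_pair:
  assumes r: "r \<in> R" "r' \<in> R" "r \<noteq> r'"
  obtains s where "proper_cluster v R s" "depth v s = v (r - r')"
proof -
  let ?s = "disc v r' (v (r - r')) \<inter> R"
  have in_s: "r \<in> ?s" "r' \<in> ?s" using r by (simp_all add: disc_def val_ge_self)
  have cl: "cluster v R ?s" using cluster_disc[OF r(2)] .
  have "card {r, r'} \<le> card ?s" using cluster_finite[OF cl] in_s by (intro card_mono) auto
  then have s: "proper_cluster v R ?s" unfolding proper_cluster_def using cl r(3) by simp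
  obtain a b where ab: "a \<in> ?s" "b \<in> ?s" "a \<noteq> b" "v (a - b) = depth v ?s"
    by (rule depth_attained[OF s])
  have "a \<in> disc v b (v (r - r'))" using ab(1,2) disc_eq by blast
  then have "v (r - r') \<le> depth v ?s" using ab by (simp add: disc_def val_ge_def)
  moreover have "depth v ?s \<le> v (r - r')" using depth_le[OF cl in_s] r(3) by (simp add: val_ge_def)
  ultimately show ?thesis using that[OF s] by simp
qed

lemma child_imp_proper:
  assumes "cluster v R s" "child v R s c" shows "proper_cluster v R s"
proof -
  have "c \<subset> s" "c \<noteq> {}" using assms(2) cluster_nonempty unfolding child_def by auto
  then have "0 < card c" "card c < card s"
    using cluster_finite[OF assms(1)] by (auto simp: card_gt_0_iff psubset_card_mono finite_subset)
  then show ?thesis using assms(1) unfolding proper_cluster_def by simp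
qed

lemma child_open_disc:
  assumes s: "proper_cluster v R s" and r: "r \<in> s"
  shows "child v R s (open_disc v r (depth v s) \<inter> R)"
proof -
  let ?c = "open_disc v r (depth v s) \<inter> R"
  note s_eq = proper_cluster_eq_disc[OF s r]
  have rR: "r \<in> R" using cluster_subset[OF proper_clusterD[OF s]] r by blast
  have "?c \<subseteq> s" using s_eq open_disc_subset_disc by blast
  moreover have "?c \<noteq> s"
  proof
    assume c_eq: "?c = s"
    obtain a b where ab: "a \<in> s" "b \<in> s" "a \<noteq> b" "v (a - b) = depth v s"
      by (rule depth_attained[OF s])
    then have "val_gt v (a - r) (depth v s)" "val_gt v (b - r) (depth v s)"
      using c_eq unfolding open_disc_def by blast+
    then have "val_gt v (a - b) (depth v s)" using val_gt_diff_trans val_gt_minus_commute by blast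
    then show False using ab by (simp add: val_gt_def)
  qed
  moreover have "\<not> (?c \<subset> t \<and> t \<subset> s)" if t: "cluster v R t" for t
  proof
    assume between: "?c \<subset> t \<and> t \<subset> s"
    then have "r \<in> t" using centre_in_open_disc rR by blast
    then obtain d where d: "t = disc v r d \<inter> R" using cluster_eq_disc[OF t] by blast
    show False
    proof (cases "d \<le> depth v s")
      case True
      then have "s \<subseteq> t" using s_eq d disc_antimono by blast
      then show False using between by blast
    next
      case False
      then have "t \<subseteq> ?c" using d disc_subset_open_disc[of "depth v s" d] by auto
      then show False using between by blast
    qed
  qed
  ultimately show ?thesis unfolding child_def using cluster_open_disc[OF rR] by blast
qed

lemma childE:
  assumes s: "proper_cluster v R s" and c: "child v R s c"
  obtains r where "r \<in> s" "c = open_disc v r (depth v s) \<inter> R"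
proof -
  have cl: "cluster v R c" "c \<subset> s" using c unfolding child_def by blast+
  obtain r where r: "r \<in> c" using cluster_nonempty[OF cl(1)] by blast
  let ?c = "open_disc v r (depth v s) \<inter> R"
  have rs: "r \<in> s" "r \<in> ?c" using r cl cluster_subset centre_in_open_disc by blast+
  have child: "child v R s ?c" using child_open_disc[OF s rs(1)] .
  then have "c \<subseteq> ?c \<or> ?c \<subseteq> c" using clusters_nested[OF cl(1) _ r rs(2)] unfolding child_def by blast
  then have "c = ?c" using c child unfolding child_def by blast
  then show ?thesis using that rs(1) by blast
qed

lemma parent_exists:
  assumes s: "cluster v R s" "s \<noteq> R"
  obtains t where "cluster v R t" "child v R t s"
    "{u. cluster v R u \<and> s \<subset> u} = insert t {u. cluster v R u \<and> t \<subset> u}"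
proof -
  let ?above = "\<lambda>t. cluster v R t \<and> s \<subset> t"
  have "R \<noteq> {}" "s \<subset> R" using cluster_nonempty[OF s(1)] cluster_subset[OF s(1)] s(2) by auto
  then have "?above R" using cluster_R by blast
  then obtain t where t: "?above t" and least: "\<And>u. ?above u \<Longrightarrow> card t \<le> card u"
    using ex_has_least_nat[of ?above R card] by blast
  have minimal: "\<not> u \<subset> t" if "?above u" for u
    using least[OF that] psubset_card_mono[OF cluster_finite, of t u] t by (meson not_le)
  have "t \<subseteq> u" if "?above u" for u
  proof -
    obtain r where "r \<in> s" using cluster_nonempty[OF s(1)] by blast
    then show ?thesis using clusters_nested[of u t r] minimal[OF that] that t by blast
  qed
  then have "{u. ?above u} = insert t {u. cluster v R u \<and> t \<subset> u}" using t by blast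
  moreover have "child v R t s" using s(1) t minimal unfolding child_def by blast
  ultimately show ?thesis using that t by blast
qed

lemma depth_star_parent:
  assumes t: "cluster v R t" "child v R t s" and u: "cluster v R u" "t \<subset> u"
  shows "depth_star v R G s u = depth_star v R G t u"
proof -
  have s: "cluster v R s" "s \<subset> t" using t(2) unfolding child_def by blast+
  obtain r where r: "r \<in> s" using cluster_nonempty[OF s(1)] by blast
  have "s \<subseteq> c \<longleftrightarrow> t \<subseteq> c" if c: "child v R u c" for c
  proof
    assume "s \<subseteq> c"
    then have "r \<in> t" "r \<in> c" using r s(2) by blast+
    moreover have "cluster v R c" using c unfolding child_def by blast
    ultimately have "t \<subseteq> c \<or> c \<subseteq> t" using clusters_nested[OF t(1)] by blast
    moreover have "\<not> c \<subset> t" using c t(1) u(2) unfolding child_def by blast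
    ultimately show "t \<subseteq> c" by blast
  next
    assume "t \<subseteq> c"
    then show "s \<subseteq> c" using s(2) by blast
  qed
  then have "(\<exists>c. child v R u c \<and> s \<subseteq> c \<and> orphan v R G u c) \<longleftrightarrow>
      (\<exists>c. child v R u c \<and> t \<subseteq> c \<and> orphan v R G u c)" by blast
  then show ?thesis unfolding depth_star_def by simp
qed

lemma depth_star_of_parent:
  assumes "child v R t s"
  shows "depth_star v R G s t = (if orphan v R G t s then 1 else depth v t)"
proof -
  have "c = s" if "child v R t c" "s \<subseteq> c" for c using that assms unfolding child_def by blast
  then show ?thesis unfolding depth_star_def using assms by (metis order_refl)
qed

end

subsection \<open>Stabilisers of clusters\<close>

locale tame_clusters = tame_inertia v L I + finite_clusters v R
  for v :: "'a::field \<Rightarrow> rat" and L :: "'a set" and I (structure) and R :: "'a set" +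
  assumes R_subset: "R \<subseteq> L"
    and image_R: "\<sigma> \<in> carrier I \<Longrightarrow> \<sigma> ` R = R"
    and faithful_on_R: "\<sigma> \<in> carrier I \<Longrightarrow> (\<And>r. r \<in> R \<Longrightarrow> \<sigma> r = r) \<Longrightarrow> \<sigma> = \<one>"
begin

abbreviation Stab :: "'a set \<Rightarrow> ('a \<Rightarrow> 'a) set" where "Stab s \<equiv> stabilizer I image s"

lemma Stab_iff: "\<sigma> \<in> Stab s \<longleftrightarrow> \<sigma> \<in> carrier I \<and> \<sigma> ` s = s"
  unfolding stabilizer_def by simp

lemma orphan_iff: "orphan v R I s c \<longleftrightarrow> {c'. child v R s c' \<and> Stab s \<subseteq> Stab c'} = {c}"
proof -
  have "(\<forall>\<sigma>\<in>Stab s. \<sigma> ` c' = c') \<longleftrightarrow> Stab s \<subseteq> Stab c'" for c'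
    unfolding subset_iff Ball_def Stab_iff by meson
  then show ?thesis by (simp add: orphan_def cluster_stab_def)
qed

lemma cluster_subset_L: "cluster v R s \<Longrightarrow> s \<subseteq> L"
  using cluster_subset R_subset by blast

lemma subgroup_Stab: "cluster v R s \<Longrightarrow> subgroup (Stab s) I"
  using stabilizer_image_subgroup cluster_subset_L by blast

lemma stab_index_eq_card_rcosets: "stab_index I s = card (rcosets (Stab s))"
  unfolding stab_index_def cluster_stab_def by simp

lemma depth_in_value_group:
  assumes s: "proper_cluster v R s" shows "depth v s \<in> \<Gamma>"
proof -
  obtain r r' where r: "r \<in> s" "r' \<in> s" "r \<noteq> r'" "v (r - r') = depth v s"
    by (rule depth_attained[OF s])
  then have "r - r' \<in> L" using cluster_subset_L[OF proper_clusterD[OF s]] diff_in by blast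
  then show ?thesis using value_groupI[of "r - r'"] r by simp
qed

lemma image_disc:
  assumes \<sigma>: "\<sigma> \<in> carrier I" and z: "z \<in> L"
  shows "\<sigma> ` (disc v z d \<inter> R) = disc v (\<sigma> z) d \<inter> R"
    and "\<sigma> ` (open_disc v z d \<inter> R) = open_disc v (\<sigma> z) d \<inter> R"
proof -
  have iff: "val_ge v (\<sigma> x - \<sigma> z) d \<longleftrightarrow> val_ge v (x - z) d"
    "val_gt v (\<sigma> x - \<sigma> z) d \<longleftrightarrow> val_gt v (x - z) d" if "x \<in> R" for x
    using val_apply_iff[OF \<sigma>, of "x - z"] field_embedding.diff[OF field_embedding[OF \<sigma>], of x z]
      that z R_subset diff_in
    by auto
  have image: "\<sigma> ` ({x. P x} \<inter> R) = {x. Q x} \<inter> R" if "\<And>x. x \<in> R \<Longrightarrow> Q (\<sigma> x) \<longleftrightarrow> P x" for P Q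
  proof -
    have "\<sigma> ` ({x. P x} \<inter> R) = {x. Q x} \<inter> \<sigma> ` R" using that by auto
    then show ?thesis unfolding image_R[OF \<sigma>] .
  qed
  show "\<sigma> ` (disc v z d \<inter> R) = disc v (\<sigma> z) d \<inter> R"
    unfolding disc_def using iff(1) by (rule image)
  show "\<sigma> ` (open_disc v z d \<inter> R) = open_disc v (\<sigma> z) d \<inter> R"
    unfolding open_disc_def using iff(2) by (rule image)
qed

lemma cluster_image:
  assumes \<sigma>: "\<sigma> \<in> carrier I" and s: "cluster v R s" shows "cluster v R (\<sigma> ` s)"
proof -
  obtain r where r: "r \<in> s" using cluster_nonempty[OF s] by blast
  obtain d where d: "s = disc v r d \<inter> R" using cluster_eq_disc[OF s r] .
  have "r \<in> R" "\<sigma> r \<in> R" using r cluster_subset[OF s] image_R[OF \<sigma>] by blast+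
  then show ?thesis using image_disc(1)[OF \<sigma>] R_subset cluster_disc d by (metis subsetD)
qed

lemma Stab_mono:
  assumes s: "cluster v R s" and t: "cluster v R t" and "s \<subseteq> t"
  shows "Stab s \<subseteq> Stab t"
proof
  fix \<sigma> assume "\<sigma> \<in> Stab s"
  then have \<sigma>: "\<sigma> \<in> carrier I" "\<sigma> ` s = s" unfolding Stab_iff by auto
  obtain r where r: "r \<in> s" using cluster_nonempty[OF s] by blast
  then have "r \<in> t" "r \<in> \<sigma> ` t" using \<sigma>(2) \<open>s \<subseteq> t\<close> by blast+
  then have nested: "\<sigma> ` t \<subseteq> t \<or> t \<subseteq> \<sigma> ` t"
    using clusters_nested[OF cluster_image[OF \<sigma>(1) t] t] by blast
  have "card (\<sigma> ` t) = card t"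
    using inj_prop[OF \<sigma>(1)] inj_on_subset cluster_subset_L[OF t] card_image by blast
  then have "\<sigma> ` t = t" using nested card_subset_eq cluster_finite[OF t] finite_imageI by metis
  then show "\<sigma> \<in> Stab t" using \<sigma>(1) by (simp add: Stab_iff)
qed

lemma cluster_centre:
  assumes s: "proper_cluster v R s"
  obtains z where "z \<in> fixed_field (Stab s)" "\<forall>r\<in>s. val_ge v (r - z) (depth v s)"
proof -
  note cl = proper_clusterD[OF s]
  obtain q where q: "q \<in> s" using cluster_nonempty[OF cl] by blast
  have "val_ge v (\<sigma> q - q) (depth v s)" if "\<sigma> \<in> Stab s" for \<sigma>
    using that q by (intro depth_le[OF cl]) (auto simp: Stab_iff)
  then obtain z where z: "z \<in> fixed_field (Stab s)" "val_ge v (q - z) (depth v s)"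
    using fixed_centre[OF subgroup_Stab[OF cl]] q cluster_subset_L[OF cl] by blast
  have "val_ge v (r - z) (depth v s)" if "r \<in> s" for r
    using depth_le[OF cl that q] z(2) by (rule val_ge_diff_trans)
  then show ?thesis using that z(1) by blast
qed

lemma Stab_open_disc_iff:
  assumes s: "proper_cluster v R s" and z: "z \<in> fixed_field (Stab s)" "val_ge v (r - z) (depth v s)"
    and r: "r \<in> s" and \<sigma>: "\<sigma> \<in> Stab s"
  shows "\<sigma> \<in> Stab (open_disc v r (depth v s) \<inter> R) \<longleftrightarrow>
    val_gt v (r - z) (depth v s) \<or> \<sigma> \<in> kernel (Stab s) (depth v s)" (is "\<sigma> \<in> Stab ?c \<longleftrightarrow> _")
proof -
  let ?d = "depth v s"
  note cl = proper_clusterD[OF s]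
  have \<sigma>I: "\<sigma> \<in> carrier I" "\<sigma> r \<in> s" using \<sigma> r unfolding Stab_iff by blast+
  interpret \<sigma>: field_embedding L \<sigma> using field_embedding[OF \<sigma>I(1)] .
  have L: "r \<in> L" "z \<in> L" "r - z \<in> L"
    using r cluster_subset_L[OF cl] fixed_fieldD(1)[OF z(1)] diff_in by blast+
  have "\<sigma> \<in> Stab ?c \<longleftrightarrow> open_disc v (\<sigma> r) ?d \<inter> R = ?c"
    using image_disc(2)[OF \<sigma>I(1) L(1)] \<sigma>I(1) by (simp only: Stab_iff simp_thms)
  also have "\<dots> \<longleftrightarrow> val_gt v (\<sigma> r - r) ?d"
  proof
    assume "open_disc v (\<sigma> r) ?d \<inter> R = ?c"
    moreover have "\<sigma> r \<in> open_disc v (\<sigma> r) ?d \<inter> R"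
      using centre_in_open_disc \<sigma>I(2) cluster_subset[OF cl] by blast
    ultimately show "val_gt v (\<sigma> r - r) ?d" unfolding open_disc_def by blast
  qed (simp flip: open_disc_eq_iff)
  also have "\<sigma> r - r = \<sigma> (r - z) - (r - z)"
    using fixed_fieldD(2)[OF z(1) \<sigma>] L by (simp add: \<sigma>.diff)
  also have "val_gt v (\<sigma> (r - z) - (r - z)) ?d \<longleftrightarrow> val_gt v (r - z) ?d \<or> \<sigma> \<in> kernel (Stab s) ?d"
  proof (cases "val_gt v (r - z) ?d")
    case True
    then show ?thesis using val_gt_diff val_apply_iff(2)[OF \<sigma>I(1) L(3)] by blast
  next
    case False
    then have "r - z \<noteq> 0" "v (r - z) = ?d" using z(2) by (auto simp: val_ge_def val_gt_def)
    then show ?thesis using tame_char_trivial_iff[OF \<sigma>I(1) L(3)] False \<sigma> by (simp add: kernel_def)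
  qed
  finally show ?thesis .
qed

lemma Stab_child:
  assumes s: "proper_cluster v R s" and c: "child v R s c" and not_orphan: "\<not> orphan v R I s c"
  shows "Stab s \<inter> Stab c = kernel (Stab s) (depth v s)"
proof -
  let ?d = "depth v s"
  obtain z where z: "z \<in> fixed_field (Stab s)" "\<forall>r\<in>s. val_ge v (r - z) ?d"
    by (rule cluster_centre[OF s])
  have Stab_iff_kernel: "\<sigma> \<in> Stab (open_disc v r ?d \<inter> R) \<longleftrightarrow>
      val_gt v (r - z) ?d \<or> \<sigma> \<in> kernel (Stab s) ?d"
    if "r \<in> s" "\<sigma> \<in> Stab s" for r \<sigma>
    using Stab_open_disc_iff[OF s z(1) bspec[OF z(2) that(1)] that] .
  obtain r where r: "r \<in> s" "c = open_disc v r ?d \<inter> R" using childE[OF s c] .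
  show ?thesis
  proof (cases "val_gt v (r - z) ?d")
    case False
    then show ?thesis using Stab_iff_kernel[OF r(1)] kernel_subset unfolding r(2) by blast
  next
    case True
    then have fixed: "Stab s \<subseteq> Stab c" using Stab_iff_kernel[OF r(1)] unfolding r(2) by blast
    have "\<tau> \<in> kernel (Stab s) ?d" if \<tau>: "\<tau> \<in> Stab s" for \<tau>
    proof (rule ccontr)
      assume nontrivial: "\<tau> \<notin> kernel (Stab s) ?d"
      have "c' = c" if c': "child v R s c'" "Stab s \<subseteq> Stab c'" for c'
      proof -
        obtain r' where r': "r' \<in> s" "c' = open_disc v r' ?d \<inter> R" using childE[OF s c'(1)] .
        then have "val_gt v (r' - z) ?d"
          using Stab_iff_kernel[OF r'(1) \<tau>] c'(2) \<tau> nontrivial by blast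
        then have "val_gt v (r' - r) ?d" using True val_gt_diff_trans val_gt_minus_commute by blast
        then show ?thesis using r'(2) r(2) by (simp flip: open_disc_eq_iff)
      qed
      then have "{c'. child v R s c' \<and> Stab s \<subseteq> Stab c'} = {c}" using c fixed by blast
      then show False using not_orphan unfolding orphan_iff by blast
    qed
    then show ?thesis using fixed kernel_subset by blast
  qed
qed

lemma card_orbit_child:
  assumes s: "proper_cluster v R s" and c: "child v R s c" and not_orphan: "\<not> orphan v R I s c"
  shows "card (orbit (cluster_stab I s) image c) = denom (depth v s * of_nat (stab_index I s))"
proof -
  let ?d = "depth v s"
  note H = subgroup_Stab[OF proper_clusterD[OF s]] and d = depth_in_value_group[OF s]
  have "c \<subseteq> L" using c cluster_subset_L unfolding child_def by blast
  then have "card (orbit (cluster_stab I s) image c) * card (Stab s \<inter> Stab c) = card (Stab s)"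
    using card_orbit_image_subgroup[OF H] by (simp add: cluster_stab_def)
  also have "\<dots> = denom (of_nat (stab_index I s) * ?d) * card (kernel (Stab s) ?d)"
    unfolding stab_index_eq_card_rcosets by (rule card_kernel[OF H d])
  finally show ?thesis
    using card_subgroup_pos[OF subgroup_kernel[OF H d]]
    by (simp add: Stab_child[OF assms] mult.commute)
qed

lemma Lcm_denom_depth: "(LCM s\<in>{s. proper_cluster v R s}. denom (depth v s)) = e"
proof -
  define m where "m = (LCM s\<in>{s. proper_cluster v R s}. denom (depth v s))"
  have denom_dvd: "denom (depth v s) dvd m" if "proper_cluster v R s" for s
    unfolding m_def using that by (intro dvd_Lcm) blast
  have "m dvd e"
    unfolding m_def using depth_in_value_group e_mult_value
    by (intro Lcm_least) (auto simp: denom_dvd_iff)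
  then obtain k where k: "e = m * k" by blast
  then have pos: "m > 0" "k > 0" using e_pos by (auto intro: Nat.gr0I)
  then have "1 / of_nat m = of_nat k * (1 / of_nat e :: rat)" by (simp add: k)
  then have in_\<Gamma>: "1 / of_nat m \<in> \<Gamma>" using value_group_nat_mult[OF inverse_e_in_value_group] by simp
  have "kernel (carrier I) (1 / of_nat m) \<subseteq> {\<one>}"
  proof
    fix \<sigma> assume "\<sigma> \<in> kernel (carrier I) (1 / of_nat m)"
    then have \<sigma>: "\<sigma> \<in> carrier I" "\<theta> \<sigma> (1 / of_nat m) \<approx> 1" by (simp_all add: kernel_def)
    have "\<sigma> r = r" if r: "r \<in> R" for r
    proof (rule ccontr)
      assume ne: "\<sigma> r \<noteq> r"
      have "\<sigma> r \<in> R" using image_R[OF \<sigma>(1)] r by blast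
      then obtain s where s: "proper_cluster v R s" "depth v s = v (\<sigma> r - r)"
        using proper_cluster_of_pair[OF _ r ne] by blast
      then obtain l where "of_nat m * v (\<sigma> r - r) = of_int l"
        using denom_dvd unfolding denom_dvd_iff by (metis Ints_cases)
      then have "v (\<sigma> r - r) = of_int l * (1 / of_nat m)" using pos(1) by (simp add: field_simps)
      then have "\<theta> \<sigma> (v (\<sigma> r - r)) \<approx> 1" using tame_char_int_mult_trivial[OF \<sigma>(1) in_\<Gamma> \<sigma>(2)] by simp
      then show False using tame_char_displacement[OF \<sigma>(1) _ ne] r R_subset by blast
    qed
    then show "\<sigma> \<in> {\<one>}" using faithful_on_R[OF \<sigma>(1)] by blast
  qed
  then show ?thesis using e_eq_if_kernel_trivial[OF pos(1) in_\<Gamma>] unfolding m_def by simp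
qed

lemma stab_index_child:
  assumes t: "cluster v R t" and child: "child v R t s"
  shows "stab_index I s = lcm (denom (depth_star v R I s t)) (stab_index I t)"
proof -
  have s: "cluster v R s" "s \<subset> t" using child unfolding child_def by blast+
  note Ht = subgroup_Stab[OF t] and Hs = subgroup_Stab[OF s(1)]
  have Stab_s: "Stab t \<inter> Stab s = Stab s" using Stab_mono[OF s(1) t] s(2) by blast
  show ?thesis
  proof (cases "orphan v R I t s")
    case True
    then have "Stab s = Stab t" using Stab_s unfolding orphan_iff by blast
    then show ?thesis
      using True by (simp add: stab_index_eq_card_rcosets depth_star_of_parent[OF child])
  next
    case False
    let ?b = "denom (of_nat (stab_index I t) * depth v t)"
    have proper: "proper_cluster v R t" using child_imp_proper[OF t child] .
    have "Stab s = kernel (Stab t) (depth v t)"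
      using Stab_child[OF proper child False] unfolding Stab_s .
    then have "card (Stab t) = ?b * card (Stab s)"
      using card_kernel[OF Ht depth_in_value_group[OF proper]]
      by (simp add: stab_index_eq_card_rcosets)
    then have "stab_index I s * card (Stab s) = stab_index I t * ?b * card (Stab s)"
      using card_rcosets_mult[OF Ht] card_rcosets_mult[OF Hs]
      by (simp add: stab_index_eq_card_rcosets)
    then have "stab_index I s = stab_index I t * ?b" using card_subgroup_pos[OF Hs] by simp
    also have "\<dots> = lcm (denom (depth v t)) (stab_index I t)"
      using mult_denom_eq_lcm card_rcosets_pos[OF Ht] by (simp add: stab_index_eq_card_rcosets)
    finally show ?thesis using False by (simp add: depth_star_of_parent[OF child])
  qed
qed

lemma stab_index_eq_Lcm:
  assumes "cluster v R s"
  shows "stab_index I s = (LCM t\<in>{t. cluster v R t \<and> s \<subset> t}. denom (depth_star v R I s t))"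
  using assms
proof (induction "card R - card s" arbitrary: s rule: less_induct)
  case less
  show ?case
  proof (cases "s = R")
    case True
    then have none: "{t. cluster v R t \<and> s \<subset> t} = {}" using cluster_subset by blast
    have "Stab s = carrier I" using image_R True by (auto simp: Stab_iff)
    then have "stab_index I s = 1"
      using card_rcosets_mult[OF subgroup_self] e_pos by (simp add: stab_index_eq_card_rcosets)
    then show ?thesis unfolding none by simp
  next
    case False
    obtain t where t: "cluster v R t" "child v R t s"
      and above: "{u. cluster v R u \<and> s \<subset> u} = insert t {u. cluster v R u \<and> t \<subset> u}"
      by (rule parent_exists[OF less.prems False])
    have "s \<subset> t" using t(2) unfolding child_def by blast
    then have "card s < card t" using psubset_card_mono cluster_finite[OF t(1)] by blast
    moreover have "card t \<le> card R" using card_mono[OF finite_R cluster_subset[OF t(1)]] .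
    ultimately have "card R - card t < card R - card s" by simp
    from less.hyps[OF this t(1)] have "stab_index I s = lcm (denom (depth_star v R I s t))
        (LCM u\<in>{u. cluster v R u \<and> t \<subset> u}. denom (depth_star v R I t u))"
      using stab_index_child[OF t] by simp
    also have "(LCM u\<in>{u. cluster v R u \<and> t \<subset> u}. denom (depth_star v R I t u))
        = (LCM u\<in>{u. cluster v R u \<and> t \<subset> u}. denom (depth_star v R I s u))"
      using depth_star_parent[OF t] by (intro arg_cong[where f = Lcm] image_cong) auto
    finally show ?thesis unfolding above by simp
  qed
qed

end

lemma (in local_field) tame_clusters:
  assumes tame: "\<not> p dvd card (carrier (inertia_group v K L))"
  shows "tame_clusters v L (inertia_group v K L) (ac_roots f)"
proof -
  let ?I = "inertia_group v K L"
  have I_eq: "?I = galois_group K L\<lparr>carrier := galois.inertia\<rparr>" by (rule inertia_group_eq)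
  have carrier: "carrier ?I = galois.inertia" by (rule carrier_inertia_group)
  have roots_eq: "ac_roots f = roots" unfolding ac_roots_def ..
  interpret I: automorphism_group L ?I
    unfolding I_eq using galois.automorphism_group_subgroup[OF galois.subgroup_inertia] .
  interpret I: valued_automorphism_group v L ?I
    using finite_subset[OF _ galois.finite_carrier] galois.inertia_carrier galois.v_apply
    by unfold_locales (auto simp: carrier)
  show ?thesis
  proof
    show "I.inertia = carrier ?I"
      using carrier unfolding I.inertia_def galois.inertia_def by blast
    show "\<not> infinitesimal (of_nat (card (carrier ?I)))" using tame by (rule of_nat_unit)
    show "v ` (I.fixed_field (carrier ?I) - {0}) = \<int>"
      using inertia_fixed_values tame unfolding carrier I.fixed_field_def galois.fixed_field_def
      by simp
    show "finite (ac_roots f)" "ac_roots f \<subseteq> L"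
      unfolding roots_eq by (rule finite_roots roots_subset)+
    show "\<sigma> ` ac_roots f = ac_roots f" if "\<sigma> \<in> carrier ?I" for \<sigma>
      using galois_image_roots galois.inertia_carrier that unfolding carrier roots_eq by blast
    show "\<sigma> = \<one>\<^bsub>?I\<^esub>" if "\<sigma> \<in> carrier ?I" "\<And>r. r \<in> ac_roots f \<Longrightarrow> \<sigma> r = r" for \<sigma>
    proof (rule galois_eqI_roots)
      show "\<sigma> \<in> carrier (galois_group K L)" "\<one>\<^bsub>?I\<^esub> \<in> carrier (galois_group K L)"
        using that(1) I.one_closed galois.inertia_carrier unfolding carrier by blast+
      show "\<sigma> r = \<one>\<^bsub>?I\<^esub> r" if "r \<in> roots" for r
        using that roots_subset I.apply_one \<open>\<And>r. r \<in> ac_roots f \<Longrightarrow> \<sigma> r = r\<close> unfolding roots_eq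
        by auto
    qed
  qed
qed

theorem theorem1p3:
  fixes p :: nat
    and w :: "'q::field_char_0 \<Rightarrow> rat"
    and \<iota> :: "'q \<Rightarrow> 'k::field_char_0"
    and v :: "'k alg_closure \<Rightarrow> rat"
    and f :: "'k poly"
    and R :: "'k alg_closure set"
    and I :: "('k alg_closure \<Rightarrow> 'k alg_closure) monoid"
  assumes "prime p" and "odd p"
    and "is_Qp p w"
    and "finite_field_extension \<iota>"
    and "normalised_valuation w \<iota> v"
    and "squarefree f"
    and R: "R = ac_roots f"
    and I: "I = inertia_group v (range to_ac) (root_field f)"
    and tame: "\<not> p dvd card (carrier I)"
  shows
    "(LCM s\<in>{s. proper_cluster v R s}. denom (depth v s)) = card (carrier I) \<and>
     (\<forall>s. cluster v R s \<longrightarrow>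
        (\<forall>c c'. child v R s c \<and> \<not> orphan v R I s c \<and> child v R s c' \<and> \<not> orphan v R I s c' \<longrightarrow>
           card (orbit (cluster_stab I s) image c) = card (orbit (cluster_stab I s) image c'))) \<and>
     (\<forall>s s'. proper_cluster v R s \<and> child v R s s' \<and> \<not> orphan v R I s s' \<longrightarrow>
        card (orbit (cluster_stab I s) image s') = denom (depth v s * of_nat (stab_index I s))) \<and>
     (\<forall>s. cluster v R s \<longrightarrow>
        stab_index I s = (LCM s'\<in>{s'. cluster v R s' \<and> s \<subset> s'}. denom (depth_star v R I s s')))"
proof -
  have "f \<noteq> 0"
    using \<open>squarefree f\<close> unfolding squarefree_def by (metis dvd_0_right dvd_0_left_iff zero_neq_one)
  then interpret F: local_field p w \<iota> v f using assms(1,3-5) by unfold_locales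
  interpret C: tame_clusters v "root_field f" I R
    unfolding R I by (rule F.tame_clusters) (use tame in \<open>simp add: I\<close>)
  have orbit_length:
    "card (orbit (cluster_stab I s) image c) = denom (depth v s * of_nat (stab_index I s))"
    if "cluster v R s" "child v R s c" "\<not> orphan v R I s c" for s c
    using C.card_orbit_child[OF C.child_imp_proper] that by blast
  show ?thesis
  proof (intro conjI allI impI)
    show "(LCM s\<in>{s. proper_cluster v R s}. denom (depth v s)) = card (carrier I)"
      by (rule C.Lcm_denom_depth)
    show "stab_index I s = (LCM s'\<in>{s'. cluster v R s' \<and> s \<subset> s'}. denom (depth_star v R I s s'))"
      if "cluster v R s" for s using that by (rule C.stab_index_eq_Lcm)
  qed (simp_all add: orbit_length proper_clusterD)
qed

end
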